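(* Let $\mathbf A\in\mathcal D_e(\eta_L)$ for a constant $\eta_L>0$, and suppose there is a constant $c_L>0$ with $$|a_{\ell,k}|\le c_L\,e^{-\eta_L|\ell-k|}\quad\forall\,\ell,k\in\mathbb Z^d,\qquad c_L<\tfrac12\,(e^{\eta_L}-1)\,\min_\ell a_{\ell,\ell}.$$ Let $\mathbf A^{-1}\in\mathcal D_e(\bar\eta_L)$, where $\bar\eta_L\in(0,\eta_L]$ is the constant such that $\bar z=e^{-\bar\eta_L}$ is the unique zero in the interval $(0,1)$ of the polynomial $$z^2-\frac{e^{2\eta_L}+2c_L+1}{e^{\eta_L}(c_L+1)}\,z+1 .$$ Let $1\le d\le10$. If $u\in\mathcal A^{\eta,t}_G$ for some $\eta>0$ and $t\in(0,d]$ such that $$\eta<\omega_d^{\,t/(d(1+2t))}\,\bar\eta_L,$$ then there exist suitable positive constants $\bar\eta\le\eta$ and $\bar t\le t$ such that $r(u_\Lambda)\in\mathcal A^{\bar\eta,\bar t}_G$ for any finite index set $\Lambda\subset\mathbb Z^d$, with $$\|r(u_\Lambda)\|_{\mathcal A^{\bar\eta,\bar t}_G}\lesssim\|u\|_{\mathcal A^{\eta,t}_G}.$$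
   Context: Let $d\ge1$, $\Omega=(0,2\pi)^d$, $\phi_k(x)=(2\pi)^{-d/2}e^{ik\cdot x}$ for $k\in\mathbb Z^d$, $\hat v_k=(v,\phi_k)_{L^2(\Omega)}$. $V=H^1_p(\Omega)$: $H^1$ functions $2\pi$-periodic in each direction, norm $\|v\|^2=\sum_k(1+|k|^2)|\hat v_k|^2$ ($|k|$ Euclidean). $H^{-1}_p(\Omega)$ is its (anti)dual, $\hat f_k=\langle f,\phi_k\rangle$, $\|f\|^2=\sum_k(1+|k|^2)^{-1}|\hat f_k|^2$. For $\Lambda\subset\mathbb Z^d$, $P_\Lambda$ keeps only the Fourier coefficients with index in $\Lambda$; $V_\Lambda=\mathrm{span}\{\phi_k:k\in\Lambda\}$; $|\Lambda|$ is the cardinality. $Lu=-\nabla\cdot(\nu\nabla u)+\sigma u$ with sufficiently smooth real ($2\pi$-periodic) coefficients bounded above and below by positive constants; $a(u,v)=\int_\Omega\nu\nabla u\cdot\nabla\bar v+\int_\Omega\sigma u\bar v$; $f\in H^{-1}_p(\Omega)$; $u\in V$ solves $a(u,v)=\langle f,v\rangle$ for all $v\in V$; for finite $\Lambda$, $u_\Lambda\in V_\Lambda$ solves $a(u_\Lambda,v)=\langle f,v\rangle$ for all $v\in V_\Lambda$; $r(u_\Lambda)=f-Lu_\Lambda$. Stiffness matrix: $\mathbf A=(a_{\ell,k})_{\ell,k\in\mathbb Z^d}$, $a_{\ell,k}=\frac{a(\phi_k,\phi_\ell)}{c_\ell c_k}$, where $c_k=\sqrt{1+|k|^2}$ for $k\in\mathbb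 Z^d$ (not to be confused with the constant $c_L$). A matrix $(b_{\ell,k})$ is in $\mathcal D_e(\eta)$ if for some constant $c>0$, $|b_{\ell,k}|\le c\,e^{-\eta|\ell-k|}$ for all $\ell,k\in\mathbb Z^d$. Under the stated smallness condition on $c_L$, $\mathbf A$ is invertible in $\ell^2(\mathbb Z^d)$. $\omega_d$ is the measure of the Euclidean unit ball in $\mathbb R^d$. Best $N$-term error: $E_N(v)=\inf_{|\Lambda|=N}\|v-P_\Lambda v\|$ ($E_0(v)=\|v\|$). Exponential class: $\mathcal A^{\eta,t}_G=\{v\in V:\ \|v\|_{\mathcal A^{\eta,t}_G}:=\sup_{N\ge0}E_N(v)\exp(\eta\,\omega_d^{-t/d}N^{t/d})<\infty\}$. The same notation is used for forms in $H^{-1}_p(\Omega)$, with $V$ and its norm replaced by $H^{-1}_p(\Omega)$ and its norm. $A\lesssim B$ means $A\le cB$ for some constant $c>0$ independent of the relevant parameters in the inequality (here, of $u$ and $\Lambda$). *)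

theory Defs
  imports "HOL-Analysis.Analysis"
begin

(* The dimension d is CARD('d): points are of type real^'d, frequencies of type int^'d. *)

section \<open>Fourier basis and Sobolev spaces on the torus\<close>

definition Omega :: "(real^'d) set" where
  "Omega = box 0 (\<chi> i. 2 * pi)"

definition periodic :: "(real^'d \<Rightarrow> 'b) \<Rightarrow> bool" where
  "periodic v \<longleftrightarrow> (\<forall>x i. v (x + axis i (2 * pi)) = v x)"

definition rvec :: "int^'d \<Rightarrow> real^'d" where
  "rvec k = (\<chi> i. real_of_int (k $ i))"

definition phi :: "int^'d \<Rightarrow> real^'d \<Rightarrow> complex" where
  "phi k x = complex_of_real ((2 * pi) powr (- real CARD('d) / 2))
               * exp (\<i> * complex_of_real (rvec k \<bullet> x))"

primrec Ck :: "nat \<Rightarrow> (real^'d \<Rightarrow> 'b::real_normed_vector) \<Rightarrow> bool" where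
  "Ck 0 f = continuous_on UNIV f"
| "Ck (Suc m) f = ((\<forall>x. f differentiable (at x)) \<and>
      (\<forall>i. Ck m (\<lambda>x. frechet_derivative f (at x) (axis i 1))))"

(* Elements of L^2 and H^1 are periodic Borel representatives; norms,
   coefficients and forms depend only on the class modulo null sets. *)
definition L2p :: "(real^'d \<Rightarrow> complex) set" where
  "L2p = {v. v \<in> borel_measurable borel \<and> periodic v \<and>
             set_integrable lborel Omega (\<lambda>x. (norm (v x))\<^sup>2)}"

(* Weak derivatives are taken on the torus: the test functions are smooth and periodic,
   so that no boundary terms arise and periodicity of traces is built in. *)
definition weak_partial ::
    "'d \<Rightarrow> (real^'d \<Rightarrow> complex) \<Rightarrow> (real^'d \<Rightarrow> complex) \<Rightarrow> bool" where
  "weak_partial i v g \<longleftrightarrow> g \<in> L2p \<and>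
     (\<forall>\<psi>::real^'d \<Rightarrow> complex. periodic \<psi> \<and> (\<forall>m. Ck m \<psi>) \<longrightarrow>
        (LINT x:Omega|lborel. v x * frechet_derivative \<psi> (at x) (axis i 1)) =
        - (LINT x:Omega|lborel. g x * \<psi> x))"

definition H1p :: "(real^'d \<Rightarrow> complex) set" where
  "H1p = {v \<in> L2p. \<forall>i. \<exists>g. weak_partial i v g}"

(* unique up to null sets for v in H1p *)
definition wderiv :: "'d \<Rightarrow> (real^'d \<Rightarrow> complex) \<Rightarrow> (real^'d \<Rightarrow> complex)" where
  "wderiv i v = (SOME g. weak_partial i v g)"

definition fcoef :: "(real^'d \<Rightarrow> complex) \<Rightarrow> int^'d \<Rightarrow> complex" where
  "fcoef v k = (LINT x:Omega|lborel. v x * cnj (phi k x))"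

definition H1_norm :: "(real^'d \<Rightarrow> complex) \<Rightarrow> real" where
  "H1_norm v = sqrt (\<Sum>\<^sub>\<infinity>k. (1 + (norm (rvec k))\<^sup>2) * (norm (fcoef v k))\<^sup>2)"

(* The antidual of H1p: f v stands for the pairing of f with v, which is conjugate linear
   in v. Only the values of f on H1p matter. *)
definition Hm1p :: "((real^'d \<Rightarrow> complex) \<Rightarrow> complex) set" where
  "Hm1p = {f. (\<forall>v\<in>H1p. \<forall>w\<in>H1p. f (\<lambda>x. v x + w x) = f v + f w) \<and>
              (\<forall>c. \<forall>v\<in>H1p. f (\<lambda>x. c * v x) = cnj c * f v) \<and>
              (\<exists>C. \<forall>v\<in>H1p. norm (f v) \<le> C * H1_norm v)}"

definition Hm1_norm :: "((real^'d \<Rightarrow> complex) \<Rightarrow> complex) \<Rightarrow> real" where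
  "Hm1_norm f = sqrt (\<Sum>\<^sub>\<infinity>k. inverse (1 + (norm (rvec k))\<^sup>2) * (norm (f (phi k)))\<^sup>2)"

section \<open>The elliptic operator and its Galerkin approximation\<close>

definition admissible_coeff :: "(real^'d \<Rightarrow> real) \<Rightarrow> bool" where
  "admissible_coeff \<kappa> \<longleftrightarrow> periodic \<kappa> \<and> Ck 1 \<kappa> \<and>
     (\<exists>lo hi. 0 < lo \<and> 0 < hi \<and> (\<forall>x. lo \<le> \<kappa> x \<and> \<kappa> x \<le> hi))"

definition aform :: "(real^'d \<Rightarrow> real) \<Rightarrow> (real^'d \<Rightarrow> real) \<Rightarrow>
    (real^'d \<Rightarrow> complex) \<Rightarrow> (real^'d \<Rightarrow> complex) \<Rightarrow> complex" where
  "aform \<nu> \<sigma> u v =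
     (LINT x:Omega|lborel. complex_of_real (\<nu> x) * (\<Sum>i\<in>UNIV. wderiv i u x * cnj (wderiv i v x)))
   + (LINT x:Omega|lborel. complex_of_real (\<sigma> x) * u x * cnj (v x))"

definition weak_solution :: "(real^'d \<Rightarrow> real) \<Rightarrow> (real^'d \<Rightarrow> real) \<Rightarrow>
    ((real^'d \<Rightarrow> complex) \<Rightarrow> complex) \<Rightarrow> (real^'d \<Rightarrow> complex) \<Rightarrow> bool" where
  "weak_solution \<nu> \<sigma> f u \<longleftrightarrow> u \<in> H1p \<and> (\<forall>v\<in>H1p. aform \<nu> \<sigma> u v = f v)"

(* span of the phi k with k in \<Lambda>, for finite \<Lambda> *)
definition V_sub :: "(int^'d) set \<Rightarrow> (real^'d \<Rightarrow> complex) set" where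
  "V_sub \<Lambda> = {v. \<exists>c. v = (\<lambda>x. \<Sum>k\<in>\<Lambda>. c k * phi k x)}"

definition galerkin_solution :: "(real^'d \<Rightarrow> real) \<Rightarrow> (real^'d \<Rightarrow> real) \<Rightarrow>
    ((real^'d \<Rightarrow> complex) \<Rightarrow> complex) \<Rightarrow> (int^'d) set \<Rightarrow> (real^'d \<Rightarrow> complex) \<Rightarrow> bool" where
  "galerkin_solution \<nu> \<sigma> f \<Lambda> w \<longleftrightarrow>
     w \<in> V_sub \<Lambda> \<and> (\<forall>v\<in>V_sub \<Lambda>. aform \<nu> \<sigma> w v = f v)"

(* f - L w as an element of the antidual, where L w is the form v |-> a(w, v) *)
definition residual :: "(real^'d \<Rightarrow> real) \<Rightarrow> (real^'d \<Rightarrow> real) \<Rightarrow>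
    ((real^'d \<Rightarrow> complex) \<Rightarrow> complex) \<Rightarrow> (real^'d \<Rightarrow> complex) \<Rightarrow>
    ((real^'d \<Rightarrow> complex) \<Rightarrow> complex)" where
  "residual \<nu> \<sigma> f w = (\<lambda>v. f v - aform \<nu> \<sigma> w v)"

section \<open>Stiffness matrix\<close>

definition stiffness :: "(real^'d \<Rightarrow> real) \<Rightarrow> (real^'d \<Rightarrow> real) \<Rightarrow>
    int^'d \<Rightarrow> int^'d \<Rightarrow> complex" where
  "stiffness \<nu> \<sigma> l k = aform \<nu> \<sigma> (phi k) (phi l) /
     complex_of_real (sqrt (1 + (norm (rvec l))\<^sup>2) * sqrt (1 + (norm (rvec k))\<^sup>2))"

definition De :: "real \<Rightarrow> (int^'d \<Rightarrow> int^'d \<Rightarrow> complex) set" where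
  "De \<eta> = {b. \<exists>c>0. \<forall>l k. norm (b l k) \<le> c * exp (- \<eta> * norm (rvec (l - k)))}"

definition ell2 :: "('i \<Rightarrow> complex) set" where
  "ell2 = {x. (\<lambda>k. (norm (x k))\<^sup>2) summable_on UNIV}"

definition matvec :: "('i \<Rightarrow> 'i \<Rightarrow> complex) \<Rightarrow> ('i \<Rightarrow> complex) \<Rightarrow> ('i \<Rightarrow> complex)" where
  "matvec b x = (\<lambda>l. \<Sum>\<^sub>\<infinity>k. b l k * x k)"

definition ell2_operator :: "('i \<Rightarrow> 'i \<Rightarrow> complex) \<Rightarrow> bool" where
  "ell2_operator b \<longleftrightarrow>
     (\<exists>C. \<forall>x\<in>ell2. (\<forall>l. (\<lambda>k. b l k * x k) summable_on UNIV) \<and> matvec b x \<in> ell2 \<and>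
        sqrt (\<Sum>\<^sub>\<infinity>l. (norm (matvec b x l))\<^sup>2) \<le> C * sqrt (\<Sum>\<^sub>\<infinity>k. (norm (x k))\<^sup>2))"

definition ell2_inverse :: "('i \<Rightarrow> 'i \<Rightarrow> complex) \<Rightarrow> ('i \<Rightarrow> 'i \<Rightarrow> complex) \<Rightarrow> bool" where
  "ell2_inverse a b \<longleftrightarrow> ell2_operator a \<and> ell2_operator b \<and>
     (\<forall>x\<in>ell2. matvec a (matvec b x) = x \<and> matvec b (matvec a x) = x)"

section \<open>Best N-term approximation and exponential classes\<close>

definition omega :: "'d::finite itself \<Rightarrow> real" where
  "omega _ = measure lborel (ball (0::real^'d) 1)"

definition best_err_V :: "(real^'d \<Rightarrow> complex) \<Rightarrow> nat \<Rightarrow> real" where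
  "best_err_V v N = (INF \<Lambda>\<in>{\<Lambda>. finite \<Lambda> \<and> card \<Lambda> = N}.
      H1_norm (\<lambda>x. v x - (\<Sum>k\<in>\<Lambda>. fcoef v k * phi k x)))"

(* The subtracted term is the projection of the form f: its value on phi k is f (phi k)
   for k in \<Lambda> and 0 otherwise. *)
definition best_err_dual :: "((real^'d \<Rightarrow> complex) \<Rightarrow> complex) \<Rightarrow> nat \<Rightarrow> real" where
  "best_err_dual f N = (INF \<Lambda>\<in>{\<Lambda>. finite \<Lambda> \<and> card \<Lambda> = N}.
      Hm1_norm (\<lambda>v. f v - (\<Sum>k\<in>\<Lambda>. f (phi k) * cnj (fcoef v k))))"

definition exp_weight :: "'d::finite itself \<Rightarrow> real \<Rightarrow> real \<Rightarrow> nat \<Rightarrow> real" where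
  "exp_weight T \<eta> t N =
     exp (\<eta> * omega T powr (- t / real CARD('d)) * real N powr (t / real CARD('d)))"

definition AG_V :: "real \<Rightarrow> real \<Rightarrow> (real^'d \<Rightarrow> complex) set" where
  "AG_V \<eta> t = {v \<in> H1p. bdd_above (range (\<lambda>N. best_err_V v N * exp_weight TYPE('d) \<eta> t N))}"

definition AG_V_norm :: "real \<Rightarrow> real \<Rightarrow> (real^'d \<Rightarrow> complex) \<Rightarrow> real" where
  "AG_V_norm \<eta> t v = (SUP N. best_err_V v N * exp_weight TYPE('d) \<eta> t N)"

definition AG_dual :: "real \<Rightarrow> real \<Rightarrow> ((real^'d \<Rightarrow> complex) \<Rightarrow> complex) set" where
  "AG_dual \<eta> t =
     {f \<in> Hm1p. bdd_above (range (\<lambda>N. best_err_dual f N * exp_weight TYPE('d) \<eta> t N))}"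

definition AG_dual_norm :: "real \<Rightarrow> real \<Rightarrow> ((real^'d \<Rightarrow> complex) \<Rightarrow> complex) \<Rightarrow> real" where
  "AG_dual_norm \<eta> t f = (SUP N. best_err_dual f N * exp_weight TYPE('d) \<eta> t N)"

end

theory Submission
  imports Defs
begin

text \<open>
In the basis \<open>phi k / c k\<close>, \<open>c k = sqrt (1 + |k|\<^sup>2)\<close>, the problem becomes one about the matrix
\<open>A = stiffness \<nu> \<sigma>\<close>: the coordinates \<open>U\<close> of \<open>u\<close> satisfy \<open>A U = p\<close>, where \<open>p\<close> are the
coordinates of \<open>f\<close>, the Galerkin coordinates \<open>W\<close> live on \<open>\<Lambda>\<close> and satisfy \<open>(A W) l = p l\<close> for
\<open>l \<in> \<Lambda>\<close>, and the residual has the coordinates \<open>R = A (U - W)\<close>. The \<open>H\<^sup>1\<close> norm and its dual norm are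
the \<open>\<ell>\<^sup>2\<close> norms of coordinates, so best \<open>N\<close>-term errors are read off from tails of \<open>U\<close> and \<open>R\<close>.

The heart of the proof is a weighted stability estimate in the style of Combes and Thomas
(\<open>weighted_galerkin_residual\<close>). If a weight \<open>\<omega>\<close> satisfies \<open>\<omega> l \<le> exp (\<epsilon> |l - m|) \<omega> m\<close>, then
\<open>\<omega> A \<omega>\<^sup>-\<^sup>1\<close> still decays exponentially off the diagonal and differs from \<open>A\<close> by a matrix of operator
norm \<open>O(\<epsilon>)\<close>. The matrix \<open>A\<close> is coercive, since the coefficients are bounded below; for small \<open>\<epsilon>\<close> the
conjugated matrix is therefore coercive on every finite index set, with half of the constant of \<open>A\<close>. This gives
\<open>\<parallel>\<omega> R\<parallel> \<le> K \<parallel>\<omega> U\<parallel>\<close> with \<open>K\<close> and \<open>\<epsilon>\<close> that do not depend on \<open>\<Lambda>\<close>, on \<open>u\<close> or on the weight.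

The estimate is applied with \<open>\<omega> l = exp (\<epsilon> min (dist (l, S)) J)\<close>, where \<open>S\<close> is a set of \<open>N\<close>
frequencies that is nearly optimal for \<open>u\<close> (\<open>residual_localized\<close>). On \<open>S\<close> the weight is \<open>1\<close>, elsewhere
it is at most \<open>exp (\<epsilon> J)\<close>, and outside the \<open>J\<close>-neighbourhood of \<open>S\<close> it equals \<open>exp (\<epsilon> J)\<close>. After division
by \<open>exp (\<epsilon> J)\<close> the residual outside this neighbourhood is at most
\<open>K (\<parallel>u\<parallel> exp (- \<epsilon> J) + \<parallel>u - P\<^bsub>S\<^esub> u\<parallel>)\<close>. With \<open>J = N\<close> the neighbourhood has at most \<open>N (2 N + 1)\<^sup>d\<close>
points, and both terms are bounded by a multiple of \<open>exp (- b N powr (t / d))\<close>. As a function of the number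
\<open>n\<close> of terms this is exponential decay of order \<open>n powr (t / (d (d + 1)))\<close>, which is membership in the
dual class with \<open>t' = t / (d + 1)\<close> (\<open>best_err_dual_residual\<close>).

The passage to coordinates rests on Parseval's identity on the torus (\<open>Parseval\<close>), which is derived from
the Stone-Weierstrass theorem for polynomials on the set of points \<open>(cis (x 1), \<dots>, cis (x d))\<close>. It yields
the Fourier coefficients of weak derivatives, the norm of \<open>H\<^sup>1\<close> as the energy
\<open>\<parallel>v\<parallel>\<^sup>2 + \<Sum>i. \<parallel>\<partial>\<^sub>i v\<parallel>\<^sup>2\<close>, and boundedness and coercivity of the form.
\<close>

section \<open>Matrices with exponential off-diagonal decay\<close>

lemma norm_rvec_diff_triangle: "norm (rvec (l - m)) \<le> norm (rvec (l - k)) + norm (rvec (k - m))"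
proof -
  have "rvec (l - m) = rvec (l - k) + rvec (k - m)"
    by (simp add: rvec_def vec_eq_iff)
  then show ?thesis by (metis norm_triangle_ineq)
qed

lemma norm_rvec_minus: "norm (rvec (l - m)) = norm (rvec (m - l))"
proof -
  have "rvec (l - m) = - rvec (m - l)" by (simp add: rvec_def vec_eq_iff)
  then show ?thesis by simp
qed

lemma sum_geometric_int_le:
  fixes s :: real
  assumes "s > 0" "finite F"
  shows "(\<Sum>n\<in>F. exp (- s * \<bar>real_of_int n\<bar>)) \<le> 2 / (1 - exp (- s))"
proof -
  define q where "q = exp (- s)"
  have q: "0 < q" "q < 1" using assms by (auto simp: q_def)
  have pow: "exp (- s * \<bar>real_of_int n\<bar>) = q ^ nat \<bar>n\<bar>" for n
    by (simp add: q_def exp_of_nat_mult [symmetric] mult.commute)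
  obtain M where M: "\<And>n. n \<in> F \<Longrightarrow> nat \<bar>n\<bar> < M"
    using finite_nat_set_iff_bounded[of "(\<lambda>n. nat \<bar>n\<bar>) ` F"] assms(2) by auto
  have "F \<subseteq> int ` {..<M} \<union> (\<lambda>n. - int n) ` {..<M}"
  proof
    fix n assume "n \<in> F"
    then have "nat \<bar>n\<bar> < M" using M by auto
    then show "n \<in> int ` {..<M} \<union> (\<lambda>n. - int n) ` {..<M}"
      by (cases "n \<ge> 0") (auto simp: image_iff intro!: bexI[of _ "nat \<bar>n\<bar>"])
  qed
  then have "(\<Sum>n\<in>F. q ^ nat \<bar>n\<bar>) \<le> (\<Sum>n\<in>int ` {..<M} \<union> (\<lambda>n. - int n) ` {..<M}. q ^ nat \<bar>n\<bar>)"
    using q by (intro sum_mono2) auto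
  also have "\<dots> \<le> (\<Sum>n\<in>int ` {..<M}. q ^ nat \<bar>n\<bar>) + (\<Sum>n\<in>(\<lambda>n. - int n) ` {..<M}. q ^ nat \<bar>n\<bar>)"
    using q by (simp add: sum_Un sum_nonneg)
  also have "\<dots> = 2 * (\<Sum>n<M. q ^ n)"
    by (simp add: sum.reindex inj_on_def)
  also have "(\<Sum>n<M. q ^ n) \<le> 1 / (1 - q)"
    using q by (simp add: sum_gp_strict divide_right_mono)
  finally show ?thesis unfolding pow by (simp add: q_def)
qed

text \<open>The Euclidean norm dominates the average of the absolute values of the components, so the sum is bounded by
a product of \<open>d\<close> geometric series over the integers.\<close>

lemma sum_exp_lattice_bounded:
  fixes s :: real
  assumes "s > 0"
  shows "\<exists>K>0. \<forall>F::(int^'d) set. finite F \<longrightarrow> (\<Sum>n\<in>F. exp (- s * norm (rvec n))) \<le> K"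
proof -
  define d where "d = real CARD('d)"
  have d: "d > 0" by (simp add: d_def)
  define r where "r = s / d"
  have r: "r > 0" using assms d by (simp add: r_def)
  have le: "exp (- s * norm (rvec n)) \<le> (\<Prod>i\<in>UNIV. exp (- r * \<bar>real_of_int (n $ i)\<bar>))" for n :: "int^'d"
  proof -
    have "(\<Sum>i\<in>UNIV. \<bar>rvec n $ i\<bar>) \<le> (\<Sum>i\<in>(UNIV::'d set). norm (rvec n))"
      by (intro sum_mono component_le_norm_cart)
    then have "(\<Sum>i\<in>UNIV. \<bar>real_of_int (n $ i)\<bar>) \<le> d * norm (rvec n)"
      by (simp add: rvec_def d_def)
    then have "r * (\<Sum>i\<in>UNIV. \<bar>real_of_int (n $ i)\<bar>) \<le> r * (d * norm (rvec n))"
      using r by (intro mult_left_mono) auto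
    moreover have "r * (d * norm (rvec n)) = s * norm (rvec n)" using d by (simp add: r_def)
    moreover have "(\<Sum>i\<in>UNIV. - r * \<bar>real_of_int (n $ i)\<bar>) = - (r * (\<Sum>i\<in>UNIV. \<bar>real_of_int (n $ i)\<bar>))"
      by (simp add: sum_negf sum_distrib_left)
    ultimately have "(\<Sum>i\<in>UNIV. - r * \<bar>real_of_int (n $ i)\<bar>) \<ge> - s * norm (rvec n)" by simp
    then show ?thesis by (simp add: exp_sum [symmetric])
  qed
  define C where "C = 2 / (1 - exp (- r))"
  have C: "C > 0" using r by (simp add: C_def)
  show ?thesis
  proof (intro exI[of _ "C ^ CARD('d)"] conjI allI impI)
    show "C ^ CARD('d) > 0" using C by simp
    fix F :: "(int^'d) set" assume F: "finite F"
    define G where "G = (\<Union>i. (\<lambda>n. n $ i) ` F)"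
    have G: "finite G" using F by (simp add: G_def)
    have "(\<Sum>n\<in>F. exp (- s * norm (rvec n)))
        \<le> (\<Sum>n\<in>F. \<Prod>i\<in>UNIV. exp (- r * \<bar>real_of_int (n $ i)\<bar>))"
      by (intro sum_mono le)
    also have "\<dots> = (\<Sum>f\<in>vec_nth ` F. \<Prod>i\<in>UNIV. exp (- r * \<bar>real_of_int (f i)\<bar>))"
      by (subst sum.reindex) (auto simp: inj_on_def vec_eq_iff fun_eq_iff)
    also have "\<dots> \<le> (\<Sum>f\<in>PiE (UNIV::'d set) (\<lambda>_. G). \<Prod>i\<in>UNIV. exp (- r * \<bar>real_of_int (f i)\<bar>))"
    proof (rule sum_mono2)
      show "finite (PiE (UNIV::'d set) (\<lambda>_. G))" using G by (simp add: finite_PiE)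
      show "vec_nth ` F \<subseteq> PiE (UNIV::'d set) (\<lambda>_. G)" by (auto simp: G_def)
    qed (simp add: prod_nonneg)
    also have "\<dots> = (\<Prod>i\<in>(UNIV::'d set). \<Sum>n\<in>G. exp (- r * \<bar>real_of_int n\<bar>))"
      using G by (subst prod_sum_PiE) auto
    also have "\<dots> \<le> (\<Prod>i\<in>(UNIV::'d set). C)"
      unfolding C_def using sum_geometric_int_le[OF r G] by (intro prod_mono) (auto intro: sum_nonneg)
    finally show "(\<Sum>n\<in>F. exp (- s * norm (rvec n))) \<le> C ^ CARD('d)" by simp
  qed
qed

text \<open>The ball is contained in the cube with half side \<open>N\<close>. Finiteness is part of the conclusion because \<open>card\<close>
would give \<open>0\<close> for an infinite set.\<close>

lemma card_lattice_ball_le: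
  "finite {n::int^'d. norm (rvec (n - k)) \<le> real N} \<and>
   card {n::int^'d. norm (rvec (n - k)) \<le> real N} \<le> (2 * N + 1) ^ CARD('d)"
proof -
  let ?B = "{n::int^'d. norm (rvec (n - k)) \<le> real N}"
  let ?P = "PiE (UNIV::'d set) (\<lambda>i. {k $ i - int N..k $ i + int N})"
  have fin: "finite ?P" by (intro finite_PiE) auto
  have sub: "vec_nth ` ?B \<subseteq> ?P"
  proof -
    have "n $ i \<in> {k $ i - int N..k $ i + int N}" if "norm (rvec (n - k)) \<le> real N" for n i
    proof -
      have "\<bar>rvec (n - k) $ i\<bar> \<le> real N"
        using component_le_norm_cart[of "rvec (n - k)" i] that by linarith
      then have "\<bar>real_of_int (n $ i - k $ i)\<bar> \<le> real N"
        by (simp add: rvec_def)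
      then have "\<bar>n $ i - k $ i\<bar> \<le> int N" by linarith
      then show ?thesis by auto
    qed
    then show ?thesis by (intro image_subsetI PiE_I) auto
  qed
  have inj: "inj_on vec_nth ?B" by (simp add: inj_on_def vec_nth_inject)
  have "card ?B = card (vec_nth ` ?B)" using inj by (simp add: card_image)
  also have "\<dots> \<le> card ?P" by (intro card_mono fin sub)
  also have "\<dots> = (2 * N + 1) ^ CARD('d)" 
  proof -
    have "card {k $ i - int N..k $ i + int N} = 2 * N + 1" for i by simp
    then show ?thesis by (simp only: card_PiE[OF finite] prod_constant)
  qed
  finally show ?thesis
    using finite_imageD[OF finite_subset[OF sub fin] inj] by blast
qed

text \<open>The statement that the \<open>\<ell>\<^sup>2\<close> norm is at most \<open>B\<close>, in terms of finite partial sums. In this form it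
contains square summability, and the triangle inequality and the Schur test need no convergence arguments.\<close>

definition l2_bound :: "('i \<Rightarrow> complex) \<Rightarrow> real \<Rightarrow> bool" where
  "l2_bound x B \<longleftrightarrow> (\<forall>F. finite F \<longrightarrow> L2_set (\<lambda>l. norm (x l)) F \<le> B)"

lemma l2_boundD: "l2_bound x B \<Longrightarrow> finite F \<Longrightarrow> L2_set (\<lambda>l. norm (x l)) F \<le> B"
  by (simp add: l2_bound_def)

lemma l2_bound_nonneg: "l2_bound x B \<Longrightarrow> 0 \<le> B"
  using l2_boundD[of x B "{}"] by simp

lemma l2_bound_add:
  assumes "l2_bound x B" "l2_bound y C"
  shows "l2_bound (\<lambda>l. x l + y l) (B + C)"
  unfolding l2_bound_def
proof (intro allI impI)
  fix F :: "'a set" assume F: "finite F"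
  have "L2_set (\<lambda>l. norm (x l + y l)) F \<le> L2_set (\<lambda>l. norm (x l) + norm (y l)) F"
    by (intro L2_set_mono norm_triangle_ineq) auto
  also have "\<dots> \<le> L2_set (\<lambda>l. norm (x l)) F + L2_set (\<lambda>l. norm (y l)) F"
    by (rule L2_set_triangle_ineq)
  also have "\<dots> \<le> B + C" using assms F by (intro add_mono l2_boundD)
  finally show "L2_set (\<lambda>l. norm (x l + y l)) F \<le> B + C" .
qed

lemma l2_bound_mono:
  assumes "l2_bound x B" "\<And>l. norm (y l) \<le> norm (x l)"
  shows "l2_bound y B"
  unfolding l2_bound_def
proof (intro allI impI)
  fix F :: "'a set" assume "finite F"
  then show "L2_set (\<lambda>l. norm (y l)) F \<le> B"
    using assms(2) by (intro order_trans[OF L2_set_mono l2_boundD[OF assms(1)]]) auto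
qed

text \<open>Schur test for a convolution kernel: by the Cauchy-Schwarz inequality the square of each entry is at most
\<open>K\<close> times a sum of \<open>\<kappa> (l - m) (b m)\<^sup>2\<close>; summation over \<open>l\<close> costs another factor \<open>K\<close>. All row and
column sums of the kernel are sums of \<open>\<kappa>\<close> over finite sets, hence at most \<open>K\<close>.\<close>

lemma schur_finite:
  fixes \<kappa> :: "'g::ab_group_add \<Rightarrow> real" and b :: "'g \<Rightarrow> real"
  assumes \<kappa>: "\<And>n. 0 \<le> \<kappa> n" and K: "\<And>F. finite F \<Longrightarrow> sum \<kappa> F \<le> K"
    and fin: "finite F" "finite G"
  shows "L2_set (\<lambda>l. \<Sum>m\<in>G. \<kappa> (l - m) * b m) F \<le> K * L2_set b G"
proof -
  have K0: "0 \<le> K" using K[of "{}"] by simp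
  have row: "(\<Sum>m\<in>G. \<kappa> (l - m)) \<le> K" for l
    using K[of "(\<lambda>m. l - m) ` G"] fin by (simp add: sum.reindex inj_on_def)
  have col: "(\<Sum>l\<in>F. \<kappa> (l - m)) \<le> K" for m
    using K[of "(\<lambda>l. l - m) ` F"] fin by (simp add: sum.reindex inj_on_def)
  have cs: "(\<Sum>m\<in>G. \<kappa> (l - m) * b m)\<^sup>2 \<le> K * (\<Sum>m\<in>G. \<kappa> (l - m) * (b m)\<^sup>2)" for l
  proof -
    have "(\<Sum>m\<in>G. \<kappa> (l - m) * b m)\<^sup>2
        = (\<Sum>m\<in>G. sqrt (\<kappa> (l - m)) * (sqrt (\<kappa> (l - m)) * b m))\<^sup>2"
      using \<kappa> by (simp flip: mult.assoc)
    also have "\<dots> \<le> (\<Sum>m\<in>G. (sqrt (\<kappa> (l - m)))\<^sup>2) * (\<Sum>m\<in>G. (sqrt (\<kappa> (l - m)) * b m)\<^sup>2)"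
      by (rule Cauchy_Schwarz_ineq_sum)
    also have "\<dots> = (\<Sum>m\<in>G. \<kappa> (l - m)) * (\<Sum>m\<in>G. \<kappa> (l - m) * (b m)\<^sup>2)"
      using \<kappa> by (simp add: power_mult_distrib)
    also have "\<dots> \<le> K * (\<Sum>m\<in>G. \<kappa> (l - m) * (b m)\<^sup>2)"
      using \<kappa> by (intro mult_right_mono row sum_nonneg) auto
    finally show ?thesis .
  qed
  have "(\<Sum>l\<in>F. (\<Sum>m\<in>G. \<kappa> (l - m) * b m)\<^sup>2) \<le> (\<Sum>l\<in>F. K * (\<Sum>m\<in>G. \<kappa> (l - m) * (b m)\<^sup>2))"
    by (intro sum_mono cs)
  also have "\<dots> = K * (\<Sum>m\<in>G. (\<Sum>l\<in>F. \<kappa> (l - m)) * (b m)\<^sup>2)"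
    by (subst sum_distrib_left [symmetric], subst sum.swap) (simp add: sum_distrib_right)
  also have "\<dots> \<le> K * (\<Sum>m\<in>G. K * (b m)\<^sup>2)"
    using K0 by (intro mult_left_mono sum_mono mult_right_mono col) auto
  also have "\<dots> = K\<^sup>2 * (\<Sum>m\<in>G. (b m)\<^sup>2)"
    by (simp add: sum_distrib_left power2_eq_square mult.assoc)
  finally have "sqrt (\<Sum>l\<in>F. (\<Sum>m\<in>G. \<kappa> (l - m) * b m)\<^sup>2) \<le> sqrt (K\<^sup>2 * (\<Sum>m\<in>G. (b m)\<^sup>2))"
    by simp
  then show ?thesis using K0 by (simp add: L2_set_def real_sqrt_mult)
qed

text \<open>The Schur test for infinite rows, by passing to the limit over finite sets of columns.\<close>

lemma schur_has_sum:
  fixes \<kappa> :: "'g::ab_group_add \<Rightarrow> real"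
  assumes \<kappa>: "\<And>n. 0 \<le> \<kappa> n" and K: "\<And>F. finite F \<Longrightarrow> sum \<kappa> F \<le> K"
    and a: "\<And>l m. norm (a l m) \<le> \<kappa> (l - m)"
    and b: "l2_bound b B" and p: "\<And>l. ((\<lambda>m. a l m * b m) has_sum p l) UNIV"
  shows "l2_bound p (K * B)"
  unfolding l2_bound_def
proof (intro allI impI)
  fix F :: "'g set" assume F: "finite F"
  have K0: "0 \<le> K" using K[of "{}"] by simp
  have "((\<lambda>G. L2_set (\<lambda>l. norm (\<Sum>m\<in>G. a l m * b m)) F) \<longlongrightarrow> L2_set (\<lambda>l. norm (p l)) F)
      (finite_subsets_at_top UNIV)"
    unfolding L2_set_def using p by (intro tendsto_intros) (auto simp: has_sum_def)
  moreover have "L2_set (\<lambda>l. norm (\<Sum>m\<in>G. a l m * b m)) F \<le> K * B" if "finite G" for G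
  proof -
    have "L2_set (\<lambda>l. norm (\<Sum>m\<in>G. a l m * b m)) F \<le> L2_set (\<lambda>l. \<Sum>m\<in>G. \<kappa> (l - m) * norm (b m)) F"
      by (intro L2_set_mono order_trans[OF norm_sum] sum_mono)
         (auto simp: norm_mult intro!: mult_right_mono a)
    also have "\<dots> \<le> K * L2_set (\<lambda>m. norm (b m)) G"
      by (rule schur_finite[OF \<kappa> K F that])
    also have "\<dots> \<le> K * B" using K0 b that by (intro mult_left_mono l2_boundD)
    finally show ?thesis .
  qed
  ultimately show "L2_set (\<lambda>l. norm (p l)) F \<le> K * B"
    by (intro tendsto_upperbound[where F="finite_subsets_at_top UNIV"])
       (auto simp: eventually_finite_subsets_at_top intro!: exI[of _ "{}"])
qed

lemma schur_form:
  fixes \<kappa> :: "'g::ab_group_add \<Rightarrow> real"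
  assumes \<kappa>: "\<And>n. 0 \<le> \<kappa> n" and K: "\<And>F. finite F \<Longrightarrow> sum \<kappa> F \<le> K"
    and a: "\<And>l m. norm (a l m) \<le> \<kappa> (l - m)" and fin: "finite \<Lambda>"
  shows "norm (\<Sum>l\<in>\<Lambda>. \<Sum>m\<in>\<Lambda>. cnj (y l) * a l m * y m) \<le> K * (\<Sum>l\<in>\<Lambda>. (norm (y l))\<^sup>2)"
proof -
  let ?y = "\<lambda>l. norm (y l)"
  have "norm (\<Sum>l\<in>\<Lambda>. \<Sum>m\<in>\<Lambda>. cnj (y l) * a l m * y m)
      \<le> (\<Sum>l\<in>\<Lambda>. \<Sum>m\<in>\<Lambda>. ?y l * \<kappa> (l - m) * ?y m)"
    by (intro order_trans[OF norm_sum] sum_mono)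
       (auto simp: norm_mult intro!: mult_right_mono mult_left_mono a)
  also have "\<dots> = (\<Sum>l\<in>\<Lambda>. ?y l * (\<Sum>m\<in>\<Lambda>. \<kappa> (l - m) * ?y m))"
    by (simp add: sum_distrib_left mult.assoc)
  also have "\<dots> \<le> (\<Sum>l\<in>\<Lambda>. \<bar>?y l\<bar> * \<bar>\<Sum>m\<in>\<Lambda>. \<kappa> (l - m) * ?y m\<bar>)"
    by (intro sum_mono mult_mono) (auto intro!: sum_nonneg mult_nonneg_nonneg \<kappa>)
  also have "\<dots> \<le> L2_set ?y \<Lambda> * L2_set (\<lambda>l. \<Sum>m\<in>\<Lambda>. \<kappa> (l - m) * ?y m) \<Lambda>"
    by (rule L2_set_mult_ineq)
  also have "\<dots> \<le> L2_set ?y \<Lambda> * (K * L2_set ?y \<Lambda>)"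
    by (intro mult_left_mono schur_finite[OF \<kappa> K fin fin]) auto
  also have "\<dots> = K * (\<Sum>l\<in>\<Lambda>. (norm (y l))\<^sup>2)"
    by (simp add: L2_set_def power2_eq_square sum_nonneg)
  finally show ?thesis .
qed

text \<open>The conjugated matrix \<open>a l m = \<omega> l / \<omega> m * A l m\<close> is dominated by the kernel
\<open>c exp (- \<eta> |n| / 4)\<close> as long as \<open>\<epsilon> \<le> \<eta> / 2\<close>, and \<open>A - a\<close> is dominated by the same kernel times
\<open>\<epsilon> (4 / \<eta>)\<close>. For \<open>y = \<omega> W\<close> on \<open>\<Lambda>\<close>, coercivity of \<open>A\<close> gives
\<open>\<alpha> \<parallel>y\<parallel>\<^sup>2 \<le> |\<langle>(A - a) y, y\<rangle>| + |\<langle>a y, y\<rangle>|\<close>. The first term is absorbed into the left-hand side, and in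
the second one \<open>a y = \<omega> A W\<close>, which is \<open>\<omega> p\<close> on \<open>\<Lambda>\<close> by the Galerkin equations. Only the values of
the weight relative to each other enter, hence one \<open>\<epsilon>\<close> and one \<open>K\<close> serve all weights and all \<open>\<Lambda>\<close>.\<close>

lemma weighted_galerkin_residual:
  fixes A :: "int^'d \<Rightarrow> int^'d \<Rightarrow> complex"
  assumes \<eta>: "\<eta> > 0" and c: "c > 0" and \<alpha>: "\<alpha> > 0"
    and decay: "\<And>l m. norm (A l m) \<le> c * exp (- \<eta> * norm (rvec (l - m)))"
    and coercive: "\<And>\<Lambda> y. finite \<Lambda> \<Longrightarrow>
      \<alpha> * (\<Sum>l\<in>\<Lambda>. (norm (y l))\<^sup>2) \<le> Re (\<Sum>l\<in>\<Lambda>. \<Sum>m\<in>\<Lambda>. cnj (y l) * A l m * y m)"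
  obtains \<epsilon> K where "\<epsilon> > 0" "K > 0"
    "\<And>\<omega> U p W \<Lambda> B. \<lbrakk>\<And>l. 0 < \<omega> l; \<And>l m. \<omega> l \<le> exp (\<epsilon> * norm (rvec (l - m))) * \<omega> m;
       \<And>l. ((\<lambda>m. A l m * U m) has_sum p l) UNIV; finite \<Lambda>;
       \<And>l. l \<in> \<Lambda> \<Longrightarrow> (\<Sum>m\<in>\<Lambda>. A l m * W m) = p l;
       l2_bound (\<lambda>l. of_real (\<omega> l) * U l) B\<rbrakk> \<Longrightarrow>
       l2_bound (\<lambda>l. of_real (\<omega> l) * (p l - (\<Sum>m\<in>\<Lambda>. A l m * W m))) (K * B)"
proof -
  obtain K1 where K1: "K1 > 0" "\<And>F::(int^'d) set. finite F \<Longrightarrow>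
      (\<Sum>n\<in>F. exp (- (\<eta> / 4) * norm (rvec n))) \<le> K1"
    using sum_exp_lattice_bounded[of "\<eta> / 4", where 'd = 'd] \<eta> by auto
  define \<kappa> where "\<kappa> n = exp (- (\<eta> / 4) * norm (rvec n))" for n :: "int^'d"
  have \<kappa>0: "\<kappa> n \<ge> 0" for n by (simp add: \<kappa>_def)
  have \<kappa>sum: "finite F \<Longrightarrow> sum \<kappa> F \<le> K1" for F using K1 by (simp add: \<kappa>_def)
  \<comment> \<open>The first bound keeps half of the decay rate after conjugation; the second makes the norm of the perturbation \<open>A - a\<close> at most \<open>\<alpha> / 2\<close>.\<close>
  define \<epsilon> where "\<epsilon> = min (\<eta> / 2) (\<alpha> / 2 / (c * (4 / \<eta>) * K1))"
  have \<epsilon>: "\<epsilon> > 0" "\<epsilon> \<le> \<eta> / 2" using \<eta> \<alpha> c K1 by (auto simp: \<epsilon>_def)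
  have \<epsilon>2: "\<epsilon> * (c * (4 / \<eta>) * K1) \<le> \<alpha> / 2"
  proof -
    have "\<epsilon> \<le> \<alpha> / 2 / (c * (4 / \<eta>) * K1)" by (simp add: \<epsilon>_def)
    then show ?thesis using c \<eta> K1 by (subst (asm) pos_le_divide_eq) auto
  qed
  define K2 where "K2 = c * K1"
  have K2: "K2 > 0" using c K1 by (simp add: K2_def)
  have sum2: "finite F \<Longrightarrow> (\<Sum>n\<in>F. c * \<kappa> n) \<le> K2" for F
    using \<kappa>sum[of F] c by (simp add: K2_def flip: sum_distrib_left)
  define K where "K = K2 + K2 * (2 * K2 / \<alpha>)"
  have K: "K > 0" using K2 \<alpha> by (simp add: K_def add_pos_pos)
  show thesis
  proof (rule that[OF \<epsilon>(1) K])
    fix \<omega> :: "int^'d \<Rightarrow> real" and U p W :: "int^'d \<Rightarrow> complex" and \<Lambda> :: "(int^'d) set" and B :: real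
    assume \<omega>0: "\<And>l. 0 < \<omega> l" and \<omega>: "\<And>l m. \<omega> l \<le> exp (\<epsilon> * norm (rvec (l - m))) * \<omega> m"
      and p: "\<And>l. ((\<lambda>m. A l m * U m) has_sum p l) UNIV" and fin: "finite \<Lambda>"
      and gal: "\<And>l. l \<in> \<Lambda> \<Longrightarrow> (\<Sum>m\<in>\<Lambda>. A l m * W m) = p l"
      and U: "l2_bound (\<lambda>l. of_real (\<omega> l) * U l) B"
    have B: "B \<ge> 0" using U by (rule l2_bound_nonneg)
    define a where "a l m = of_real (\<omega> l / \<omega> m) * A l m" for l m
    have quot: "\<omega> l / \<omega> m \<le> exp (\<epsilon> * norm (rvec (l - m)))" for l m
      using \<omega>[of l m] \<omega>0[of m] by (simp add: pos_divide_le_eq)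
    have a: "norm (a l m) \<le> c * \<kappa> (l - m)" for l m
    proof -
      let ?s = "norm (rvec (l - m))"
      have "norm (a l m) = (\<omega> l / \<omega> m) * norm (A l m)"
        using \<omega>0[of l] \<omega>0[of m] by (simp add: a_def norm_mult norm_divide)
      also have "\<dots> \<le> exp (\<epsilon> * ?s) * (c * exp (- \<eta> * ?s))"
        using \<omega>0[of l] \<omega>0[of m] by (intro mult_mono quot decay) auto
      also have "\<dots> = c * exp (\<epsilon> * ?s - \<eta> * ?s)" by (simp add: exp_diff exp_minus field_simps)
      also have "\<dots> \<le> c * exp (- (\<eta> / 4) * ?s)"
      proof -
        have "(\<epsilon> - \<eta>) * ?s \<le> (- (\<eta> / 4)) * ?s" using \<epsilon> \<eta> by (intro mult_right_mono) auto
        then show ?thesis using c by (simp add: algebra_simps)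
      qed
      finally show ?thesis by (simp add: \<kappa>_def)
    qed
    have pert: "norm (A l m - a l m) \<le> (\<epsilon> * c * (4 / \<eta>)) * \<kappa> (l - m)" for l m
    proof -
      let ?s = "norm (rvec (l - m))"
      have s0: "?s \<ge> 0" by simp
      have up: "\<omega> l / \<omega> m \<le> exp (\<epsilon> * ?s)" by (rule quot)
      have "\<omega> m / \<omega> l \<le> exp (\<epsilon> * ?s)" using quot[of m l] by (simp add: norm_rvec_minus[of m l])
      then have lo: "exp (- (\<epsilon> * ?s)) \<le> \<omega> l / \<omega> m"
        using \<omega>0[of l] \<omega>0[of m] by (simp add: exp_minus field_simps)
      have t1: "1 - \<epsilon> * ?s \<le> exp (- (\<epsilon> * ?s))" using exp_ge_add_one_self[of "- (\<epsilon> * ?s)"] by simp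
      have t2: "exp (\<epsilon> * ?s) - 1 \<le> \<epsilon> * ?s * exp (\<epsilon> * ?s)"
      proof -
        have "(1 - \<epsilon> * ?s) * exp (\<epsilon> * ?s) \<le> exp (- (\<epsilon> * ?s)) * exp (\<epsilon> * ?s)"
          by (intro mult_right_mono t1) auto
        then show ?thesis by (simp add: algebra_simps flip: exp_add)
      qed
      have t3: "\<epsilon> * ?s \<le> \<epsilon> * ?s * exp (\<epsilon> * ?s)"
      proof -
        have "\<epsilon> * ?s * 1 \<le> \<epsilon> * ?s * exp (\<epsilon> * ?s)"
          using \<epsilon> by (intro mult_left_mono) auto
        then show ?thesis by simp
      qed
      have d: "\<bar>1 - \<omega> l / \<omega> m\<bar> \<le> \<epsilon> * ?s * exp (\<epsilon> * ?s)"
        using up lo t1 t2 t3 by linarith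
      \<comment> \<open>The linear factor from \<open>|1 - \<omega> l / \<omega> m| \<le> \<epsilon> ?s exp (\<epsilon> ?s)\<close> is paid for with a quarter of the decay rate.\<close>
      have lin: "?s \<le> (4 / \<eta>) * exp (\<eta> / 4 * ?s)"
      proof -
        have "\<eta> / 4 * ?s \<le> exp (\<eta> / 4 * ?s)" using exp_ge_add_one_self[of "\<eta> / 4 * ?s"] by linarith
        then show ?thesis using \<eta> by (simp add: field_simps)
      qed
      have "A l m - a l m = of_real (1 - \<omega> l / \<omega> m) * A l m"
        unfolding a_def of_real_diff by (simp add: left_diff_distrib)
      then have "norm (A l m - a l m) = \<bar>1 - \<omega> l / \<omega> m\<bar> * norm (A l m)"
        by (simp only: norm_mult norm_of_real)
      also have "\<dots> \<le> (\<epsilon> * ?s * exp (\<epsilon> * ?s)) * (c * exp (- \<eta> * ?s))"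
        using \<epsilon> by (intro mult_mono d decay) auto
      also have "\<dots> \<le> (\<epsilon> * ((4 / \<eta>) * exp (\<eta> / 4 * ?s)) * exp (\<epsilon> * ?s)) * (c * exp (- \<eta> * ?s))"
        using \<epsilon> c by (intro mult_right_mono mult_left_mono lin) auto
      also have "\<dots> = (\<epsilon> * c * (4 / \<eta>)) * exp (\<eta> / 4 * ?s + \<epsilon> * ?s + - \<eta> * ?s)"
        by (simp only: exp_add ac_simps)
      also have "\<dots> \<le> (\<epsilon> * c * (4 / \<eta>)) * exp (- (\<eta> / 4) * ?s)"
      proof -
        have "(\<eta> / 4 + \<epsilon> - \<eta>) * ?s \<le> (- (\<eta> / 4)) * ?s" using \<epsilon> \<eta> by (intro mult_right_mono) auto
        then have "\<eta> / 4 * ?s + \<epsilon> * ?s + - \<eta> * ?s \<le> - (\<eta> / 4) * ?s" by (simp add: algebra_simps)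
        then show ?thesis using \<epsilon> c \<eta> by (intro mult_left_mono) auto
      qed
      finally show ?thesis by (simp add: \<kappa>_def)
    qed
    \<comment> \<open>The equation \<open>p = A U\<close> conjugated with the weight.\<close>
    have wp: "l2_bound (\<lambda>l. of_real (\<omega> l) * p l) (K2 * B)"
    proof (rule schur_has_sum[where \<kappa> = "\<lambda>n. c * \<kappa> n" and a = a, OF _ sum2 a U])
      show "((\<lambda>m. a l m * (of_real (\<omega> m) * U m)) has_sum of_real (\<omega> l) * p l) UNIV" for l
      proof -
        have "(\<lambda>m. a l m * (of_real (\<omega> m) * U m)) = (\<lambda>m. of_real (\<omega> l) * (A l m * U m))"
          using \<omega>0 by (auto simp: a_def less_imp_neq[OF \<omega>0, symmetric])
        then show ?thesis using p by (simp add: has_sum_cmult_right)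
      qed
    qed (use c \<kappa>0 in auto)
    define y where "y l = (if l \<in> \<Lambda> then of_real (\<omega> l) * W l else 0)" for l
    have aW: "(\<Sum>m\<in>\<Lambda>. a l m * y m) = of_real (\<omega> l) * (\<Sum>m\<in>\<Lambda>. A l m * W m)" for l
      using \<omega>0 by (auto simp: a_def y_def sum_distrib_left less_imp_neq[OF \<omega>0, symmetric] intro!: sum.cong)
    let ?Y = "L2_set (\<lambda>l. norm (y l)) \<Lambda>"
    have Y2: "(\<Sum>l\<in>\<Lambda>. (norm (y l))\<^sup>2) = ?Y\<^sup>2" by (simp add: L2_set_def sum_nonneg)
    have "\<alpha> * ?Y\<^sup>2 \<le> Re (\<Sum>l\<in>\<Lambda>. \<Sum>m\<in>\<Lambda>. cnj (y l) * A l m * y m)"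
      unfolding Y2 [symmetric] by (rule coercive[OF fin])
    also have "(\<Sum>l\<in>\<Lambda>. \<Sum>m\<in>\<Lambda>. cnj (y l) * A l m * y m)
        = (\<Sum>l\<in>\<Lambda>. \<Sum>m\<in>\<Lambda>. cnj (y l) * (A l m - a l m) * y m)
        + (\<Sum>l\<in>\<Lambda>. cnj (y l) * (\<Sum>m\<in>\<Lambda>. a l m * y m))"
      by (simp add: algebra_simps sum_distrib_left sum.distrib sum_subtractf)
    also have "Re \<dots> \<le> norm (\<Sum>l\<in>\<Lambda>. \<Sum>m\<in>\<Lambda>. cnj (y l) * (A l m - a l m) * y m)
        + norm (\<Sum>l\<in>\<Lambda>. cnj (y l) * (\<Sum>m\<in>\<Lambda>. a l m * y m))"
      unfolding plus_complex.sel by (intro add_mono complex_Re_le_cmod)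
    also have "norm (\<Sum>l\<in>\<Lambda>. \<Sum>m\<in>\<Lambda>. cnj (y l) * (A l m - a l m) * y m)
        \<le> \<epsilon> * (c * (4 / \<eta>) * K1) * (\<Sum>l\<in>\<Lambda>. (norm (y l))\<^sup>2)"
    proof (rule schur_form[where \<kappa> = "\<lambda>n. (\<epsilon> * c * (4 / \<eta>)) * \<kappa> n", OF _ _ pert fin])
      show "(\<Sum>n\<in>F. (\<epsilon> * c * (4 / \<eta>)) * \<kappa> n) \<le> \<epsilon> * (c * (4 / \<eta>) * K1)" if "finite F" for F
      proof -
        have "(\<epsilon> * c * (4 / \<eta>)) * sum \<kappa> F \<le> (\<epsilon> * c * (4 / \<eta>)) * K1"
          using \<epsilon> c \<eta> \<kappa>sum[OF that] by (intro mult_left_mono) auto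
        then show ?thesis by (simp add: sum_distrib_left mult.assoc)
      qed
    qed (use \<epsilon> c \<eta> \<kappa>0 in auto)
    also have "\<dots> \<le> \<alpha> / 2 * ?Y\<^sup>2" unfolding Y2 by (intro mult_right_mono \<epsilon>2) auto
    also have "norm (\<Sum>l\<in>\<Lambda>. cnj (y l) * (\<Sum>m\<in>\<Lambda>. a l m * y m)) \<le> ?Y * (K2 * B)"
    proof -
      have "(\<Sum>l\<in>\<Lambda>. cnj (y l) * (\<Sum>m\<in>\<Lambda>. a l m * y m)) = (\<Sum>l\<in>\<Lambda>. cnj (y l) * (of_real (\<omega> l) * p l))"
        by (simp add: aW gal)
      also have "norm \<dots> \<le> (\<Sum>l\<in>\<Lambda>. \<bar>norm (y l)\<bar> * \<bar>norm (of_real (\<omega> l) * p l)\<bar>)"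
        by (intro order_trans[OF norm_sum] sum_mono) (simp add: norm_mult)
      also have "\<dots> \<le> ?Y * L2_set (\<lambda>l. norm (of_real (\<omega> l) * p l)) \<Lambda>"
        by (rule L2_set_mult_ineq)
      also have "\<dots> \<le> ?Y * (K2 * B)"
        by (intro mult_left_mono l2_boundD[OF wp fin]) auto
      finally show ?thesis .
    qed
    finally have "\<alpha> * ?Y\<^sup>2 \<le> \<alpha> / 2 * ?Y\<^sup>2 + ?Y * (K2 * B)" by simp
    then have "?Y * (\<alpha> / 2 * ?Y) \<le> ?Y * (K2 * B)" by (simp add: power2_eq_square algebra_simps)
    then have "?Y \<le> 2 * K2 / \<alpha> * B"
    proof (cases "?Y = 0")
      case True then show ?thesis using B K2 \<alpha> by simp
    next
      case False
      then have "?Y > 0" using L2_set_nonneg[of "\<lambda>l. norm (y l)" \<Lambda>] by linarith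
      then have "\<alpha> / 2 * ?Y \<le> K2 * B" using \<open>?Y * (\<alpha> / 2 * ?Y) \<le> ?Y * (K2 * B)\<close>
        by (simp only: mult_le_cancel_left_pos)
      then show ?thesis using \<alpha> by (simp add: field_simps)
    qed
    then have y: "l2_bound y (2 * K2 / \<alpha> * B)"
      unfolding l2_bound_def
    proof (intro allI impI)
      fix F :: "(int^'d) set" assume F: "finite F"
      have "(\<Sum>l\<in>F. (norm (y l))\<^sup>2) = (\<Sum>l\<in>F \<inter> \<Lambda>. (norm (y l))\<^sup>2)"
        using F by (intro sum.mono_neutral_right) (auto simp: y_def)
      also have "\<dots> \<le> (\<Sum>l\<in>\<Lambda>. (norm (y l))\<^sup>2)" using fin by (intro sum_mono2) auto
      finally have "L2_set (\<lambda>l. norm (y l)) F \<le> ?Y" by (simp add: L2_set_def)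
      also assume "?Y \<le> 2 * K2 / \<alpha> * B"
      finally show "L2_set (\<lambda>l. norm (y l)) F \<le> 2 * K2 / \<alpha> * B" .
    qed
    have wAW: "l2_bound (\<lambda>l. of_real (\<omega> l) * (\<Sum>m\<in>\<Lambda>. A l m * W m)) (K2 * (2 * K2 / \<alpha> * B))"
    proof (rule schur_has_sum[where \<kappa> = "\<lambda>n. c * \<kappa> n" and a = a, OF _ sum2 a y])
      show "((\<lambda>m. a l m * y m) has_sum of_real (\<omega> l) * (\<Sum>m\<in>\<Lambda>. A l m * W m)) UNIV" for l
      proof -
        have "((\<lambda>m. a l m * y m) has_sum (\<Sum>m\<in>\<Lambda>. a l m * y m)) \<Lambda>"
          using fin by (simp add: has_sum_finite)
        then have "((\<lambda>m. a l m * y m) has_sum (\<Sum>m\<in>\<Lambda>. a l m * y m)) UNIV"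
          by (subst has_sum_cong_neutral[where T = \<Lambda> and g = "\<lambda>m. a l m * y m"]) (auto simp: y_def)
        then show ?thesis by (simp add: aW)
      qed
    qed (use c \<kappa>0 in auto)
    then have "l2_bound (\<lambda>l. - (of_real (\<omega> l) * (\<Sum>m\<in>\<Lambda>. A l m * W m))) (K2 * (2 * K2 / \<alpha> * B))"
      by (rule l2_bound_mono) auto
    from l2_bound_add[OF wp this]
    show "l2_bound (\<lambda>l. of_real (\<omega> l) * (p l - (\<Sum>m\<in>\<Lambda>. A l m * W m))) (K * B)"
      by (simp add: K_def algebra_simps)
  qed
qed

section \<open>Square-integrable functions on the torus\<close>

text \<open>Integrals over \<open>Omega\<close> become integrals with respect to a finite measure, for which constants are integrable.\<close>

definition torus :: "(real^'d) measure" where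
  "torus = restrict_space lborel Omega"

lemma mem_Omega: "x \<in> Omega \<longleftrightarrow> (\<forall>i. 0 < x $ i \<and> x $ i < 2 * pi)"
  by (simp add: Omega_def mem_box_cart)

lemma Omega_borel [measurable]: "Omega \<in> sets borel"
  by (simp add: Omega_def)

lemma space_torus: "space torus = Omega"
  by (simp add: torus_def)

lemma measurable_torusI: "f \<in> borel_measurable borel \<Longrightarrow> f \<in> borel_measurable torus"
  by (simp add: torus_def measurable_restrict_space1)

lemma integrable_torus_iff: "integrable torus f \<longleftrightarrow> set_integrable lborel Omega f"
  for f :: "real^'d \<Rightarrow> 'b::{banach, second_countable_topology}"
  by (simp add: torus_def integrable_restrict_space set_integrable_def)

lemma integral_torus: "(LINT x:Omega|lborel. f x) = integral\<^sup>L torus f"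
  for f :: "real^'d \<Rightarrow> 'b::{banach, second_countable_topology}"
  by (simp add: torus_def integral_restrict_space set_lebesgue_integral_def)

lemma measure_torus: "measure torus (space (torus :: (real^'d) measure)) = (2 * pi) ^ CARD('d)"
proof -
  have "measure torus (space (torus :: (real^'d) measure)) = measure lborel (Omega :: (real^'d) set)"
    unfolding space_torus unfolding torus_def by (subst measure_restrict_space) auto
  also have "\<dots> = (\<Prod>b\<in>(Basis :: (real^'d) set). (2 * pi))"
  proof -
    have b: "(\<chi> i. 2 * pi) \<bullet> b = 2 * pi" if "b \<in> Basis" for b :: "real^'d"
      using that by (auto simp: Basis_vec_def inner_axis)
    show ?thesis unfolding Omega_def by (subst measure_lborel_box) (auto simp: b)
  qed
  finally show ?thesis by simp
qed

lemma finite_measure_torus: "finite_measure (torus :: (real^'d) measure)"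
proof (rule finite_measureI)
  have "emeasure torus (space (torus :: (real^'d) measure)) = emeasure lborel (Omega :: (real^'d) set)"
    unfolding space_torus unfolding torus_def by (subst emeasure_restrict_space) auto
  then show "emeasure torus (space (torus :: (real^'d) measure)) \<noteq> \<infinity>"
    using emeasure_lborel_box_finite[of "0::real^'d" "\<chi> i. 2 * pi"] by (simp add: Omega_def)
qed

interpretation torus: finite_measure torus
  by (rule finite_measure_torus)

lemma integrable_torus_bounded:
  fixes f :: "real^'d \<Rightarrow> 'b::{banach, second_countable_topology}"
  assumes "f \<in> borel_measurable torus" "\<And>x. x \<in> Omega \<Longrightarrow> norm (f x) \<le> B"
  shows "integrable torus f"
  by (rule torus.integrable_const_bound[of _ B]) (use assms in \<open>auto simp: space_torus\<close>)

lemma integrable_torus_continuous: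
  fixes f :: "real^'d \<Rightarrow> complex"
  assumes "continuous_on UNIV f"
  shows "integrable torus f"
proof -
  have "compact (f ` cbox 0 (\<chi> i. 2 * pi))"
    by (intro compact_continuous_image continuous_on_subset[OF assms]) auto
  then obtain B where B: "\<And>x. x \<in> cbox 0 (\<chi> i. 2 * pi) \<Longrightarrow> norm (f x) \<le> B"
    by (metis bounded_iff compact_imp_bounded imageI)
  show ?thesis
  proof (rule integrable_torus_bounded)
    show "f \<in> borel_measurable torus"
      using assms by (intro measurable_torusI borel_measurable_continuous_onI)
    show "x \<in> Omega \<Longrightarrow> norm (f x) \<le> B" for x
      using B box_subset_cbox by (auto simp: Omega_def)
  qed
qed

lemma lborel_integral_translate:
  fixes f :: "'a::euclidean_space \<Rightarrow> 'b::{banach, second_countable_topology}"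
  assumes "f \<in> borel_measurable borel"
  shows "(\<integral>x. f (c + x) \<partial>lborel) = (\<integral>x. f x \<partial>lborel)"
proof -
  have "(\<integral>x. f x \<partial>lborel) = (\<integral>x. f x \<partial>distr lborel borel ((+) c))"
    by (simp add: lborel_distr_plus)
  also have "\<dots> = (\<integral>x. f (c + x) \<partial>lborel)"
    using assms by (subst integral_distr) auto
  finally show ?thesis by simp
qed

lemma AE_component_neq: "AE x in lborel. x $ j \<noteq> (c :: real)" for j :: "'d::finite"
proof -
  have "{x::real^'d. x $ j = c} \<in> null_sets lebesgue"
    using negligible_standard_hyperplane[of "axis j (1::real)" c]
    by (simp add: negligible_iff_null_sets inner_axis axis_in_Basis_iff)
  moreover have "{x::real^'d. x $ j = c} \<in> sets lborel"
    by (simp add: closed_Collect_eq borel_closed continuous_on_component)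
  ultimately have "{x::real^'d. x $ j = c} \<in> null_sets lborel"
    using null_sets_completion_iff by blast
  then show ?thesis by (rule AE_I') auto
qed

text \<open>Up to the null sets on which \<open>x $ j\<close> is \<open>2 pi\<close> or \<open>s\<close>, the translate of the cube consists of the slab
\<open>H\<close> of the cube where \<open>x $ j > s\<close> and of the translate by one period of the slab \<open>L\<close> where \<open>x $ j < s\<close>.
Periodicity moves the second piece back. Both the orthogonality of the exponentials and the integration by
parts below follow from this invariance, without iterated integrals.\<close>

lemma torus_integral_translate:
  fixes g :: "real^'d \<Rightarrow> complex"
  assumes g: "continuous_on UNIV g" "periodic g" and s: "0 \<le> s" "s \<le> 2 * pi"
  shows "(\<integral>x. g (x + axis j s) \<partial>torus) = (\<integral>x. g x \<partial>torus)"
proof -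
  have [measurable]: "g \<in> borel_measurable borel"
    using g(1) by (rule borel_measurable_continuous_onI)
  have per: "g (axis j (2 * pi) + x) = g x" for x
    using g(2) by (simp add: periodic_def add.commute)
  have [measurable]: "{x::real^'d. x $ j > s} \<in> sets borel" "{x::real^'d. x $ j < s} \<in> sets borel"
    by (auto intro!: borel_open open_Collect_less continuous_intros)
  define H where "H = Omega \<inter> {x. x $ j > s}"
  define L where "L = Omega \<inter> {x. x $ j < s}"
  have [measurable]: "H \<in> sets borel" "L \<in> sets borel" unfolding H_def L_def by measurable
  have int: "integrable lborel (\<lambda>x. indicator S x *\<^sub>R g x)" if "S \<in> sets borel" "S \<subseteq> Omega" for S
    using set_integrable_subset[of lborel Omega g S] integrable_torus_continuous[OF g(1)] that
    by (simp add: integrable_torus_iff set_integrable_def)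
  have Hint: "integrable lborel (\<lambda>x. indicator H x *\<^sub>R g x)" by (rule int) (auto simp: H_def)
  have Lint: "integrable lborel (\<lambda>x. indicator L x *\<^sub>R g x)" by (rule int) (auto simp: L_def)
  have [measurable]: "(\<lambda>x. indicator L (x - axis j (2 * pi)) *\<^sub>R g x) \<in> borel_measurable borel"
    by measurable
  have Lint': "integrable lborel (\<lambda>x. indicator L (x - axis j (2 * pi)) *\<^sub>R g x)"
  proof -
    have "integrable (distr lborel borel ((+) (axis j (2 * pi))))
        (\<lambda>x. indicator L (x - axis j (2 * pi)) *\<^sub>R g x)"
      by (subst integrable_distr_eq) (use Lint in \<open>auto simp: per\<close>)
    then show ?thesis by (simp add: lborel_distr_plus)
  qed
  have "(\<integral>x. g (x + axis j s) \<partial>torus) = (\<integral>x. indicator Omega x *\<^sub>R g (axis j s + x) \<partial>lborel)"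
    by (simp add: torus_def integral_restrict_space add.commute)
  also have "\<dots> = (\<integral>x. indicator Omega ((axis j s + x) - axis j s) *\<^sub>R g (axis j s + x) \<partial>lborel)"
    by simp
  also have "\<dots> = (\<integral>x. indicator Omega (x - axis j s) *\<^sub>R g x \<partial>lborel)"
    by (rule lborel_integral_translate) measurable
  also have "\<dots> = (\<integral>x. indicator H x *\<^sub>R g x + indicator L (x - axis j (2 * pi)) *\<^sub>R g x \<partial>lborel)"
  proof (rule integral_cong_AE)
    have "AE x in lborel. x $ j \<noteq> 2 * pi" by (rule AE_component_neq)
    then show "AE x in lborel. indicator Omega (x - axis j s) *\<^sub>R g x
        = indicator H x *\<^sub>R g x + indicator L (x - axis j (2 * pi)) *\<^sub>R g x"
    proof eventually_elim
      case (elim x)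
      have 1: "x - axis j s \<in> Omega \<longleftrightarrow> (\<forall>i. i \<noteq> j \<longrightarrow> 0 < x $ i \<and> x $ i < 2 * pi) \<and> s < x $ j \<and> x $ j < 2 * pi + s"
        unfolding mem_Omega by (auto simp: axis_def) 
      have 2: "x \<in> H \<longleftrightarrow> (\<forall>i. i \<noteq> j \<longrightarrow> 0 < x $ i \<and> x $ i < 2 * pi) \<and> s < x $ j \<and> x $ j < 2 * pi"
        unfolding H_def Int_iff mem_Omega mem_Collect_eq using s by (metis less_le_trans not_less)
      have 3: "x - axis j (2 * pi) \<in> L \<longleftrightarrow>
          (\<forall>i. i \<noteq> j \<longrightarrow> 0 < x $ i \<and> x $ i < 2 * pi) \<and> 2 * pi < x $ j \<and> x $ j < 2 * pi + s"
        unfolding L_def Int_iff mem_Omega mem_Collect_eq using s 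
        by (auto simp: axis_def)
      show ?case
        unfolding indicator_def 1 2 3 using elim s by auto
    qed
  qed measurable
  also have "\<dots> = (\<integral>x. indicator H x *\<^sub>R g x \<partial>lborel)
      + (\<integral>x. indicator L (x - axis j (2 * pi)) *\<^sub>R g x \<partial>lborel)"
    by (rule Bochner_Integration.integral_add[OF Hint Lint'])
  also have "(\<integral>x. indicator L (x - axis j (2 * pi)) *\<^sub>R g x \<partial>lborel)
      = (\<integral>x. indicator L ((axis j (2 * pi) + x) - axis j (2 * pi)) *\<^sub>R g (axis j (2 * pi) + x) \<partial>lborel)"
    by (rule lborel_integral_translate[symmetric]) measurable
  also have "\<dots> = (\<integral>x. indicator L x *\<^sub>R g x \<partial>lborel)" by (simp add: per)
  also have "(\<integral>x. indicator H x *\<^sub>R g x \<partial>lborel) + (\<integral>x. indicator L x *\<^sub>R g x \<partial>lborel)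
      = (\<integral>x. indicator H x *\<^sub>R g x + indicator L x *\<^sub>R g x \<partial>lborel)"
    by (rule Bochner_Integration.integral_add[OF Hint Lint, symmetric])
  also have "\<dots> = (\<integral>x. indicator Omega x *\<^sub>R g x \<partial>lborel)"
  proof (rule integral_cong_AE)
    have "AE x in lborel. x $ j \<noteq> s" by (rule AE_component_neq)
    then show "AE x in lborel. indicator H x *\<^sub>R g x + indicator L x *\<^sub>R g x = indicator Omega x *\<^sub>R g x"
      by eventually_elim (auto simp: indicator_def H_def L_def)
  qed measurable
  also have "\<dots> = (\<integral>x. g x \<partial>torus)"
    by (simp add: torus_def integral_restrict_space)
  finally show ?thesis .
qed

lemma phi_continuous: "continuous_on UNIV (phi k)"
  unfolding phi_def by (intro continuous_intros)

lemma phi_add_axis: "phi k (x + axis j s) = cis (rvec k $ j * s) * phi k x"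
  by (simp add: phi_def inner_add_right inner_axis cis_conv_exp ring_distribs exp_add mult_ac flip: exp_add)

lemma phi_periodic: "periodic (phi k)"
proof -
  have "cis (rvec k $ j * (2 * pi)) = 1" for j
    using cis_multiple_2pi[of "rvec k $ j"] by (simp add: rvec_def mult_ac)
  then show ?thesis by (simp add: periodic_def phi_add_axis)
qed

lemma norm_phi: "norm (phi k x) = (2 * pi) powr (- real CARD('d) / 2)" for x :: "real^'d"
  by (simp add: phi_def norm_mult)

lemma phi_mult: "phi k x * phi l x = complex_of_real ((2 * pi) powr (- real CARD('d) / 2)) * phi (k + l) x"
  for x :: "real^'d"
proof -
  have "rvec (k + l) = rvec k + rvec l" by (simp add: rvec_def vec_eq_iff)
  then show ?thesis by (simp add: phi_def inner_add_left exp_add ring_distribs)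
qed

lemma cnj_phi: "cnj (phi k x) = phi (- k) x"
proof -
  have "rvec (- k) = - rvec k" by (simp add: rvec_def vec_eq_iff)
  then show ?thesis by (simp add: phi_def exp_cnj)
qed

text \<open>Translation by half a period of a coordinate with non-zero frequency multiplies the function by \<open>-1\<close> and
leaves the integral unchanged.\<close>

lemma phi_integral:
  assumes "k \<noteq> 0" shows "(\<integral>x. phi k x \<partial>torus) = 0"
proof -
  obtain j where j: "k $ j \<noteq> 0" using assms by (auto simp: vec_eq_iff)
  let ?a = "\<bar>real_of_int (k $ j)\<bar>"
  have a: "?a \<ge> 1" using j by linarith
  have s: "0 \<le> pi / ?a" "pi / ?a \<le> 2 * pi"
    using a by (auto simp: field_simps intro: order_trans[of _ "1 * 2"]) 
  have "rvec k $ j * (pi / ?a) = pi \<or> rvec k $ j * (pi / ?a) = - pi"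
    using a by (auto simp: rvec_def abs_if)
  \<comment> \<open>The step \<open>pi / ?a\<close> is half a period in direction \<open>j\<close>.\<close>
  then have c: "cis (rvec k $ j * (pi / ?a)) = - 1" by (auto simp: complex_eq_iff)
  have "(\<integral>x. phi k x \<partial>torus) = (\<integral>x. phi k (x + axis j (pi / ?a)) \<partial>torus)"
    using torus_integral_translate[where g = "phi k" and j = j, OF phi_continuous phi_periodic s] by simp
  also have "\<dots> = - (\<integral>x. phi k x \<partial>torus)" unfolding phi_add_axis c by simp
  finally show ?thesis by simp
qed

lemma phi_orthonormal:
  "(\<integral>x. phi k x * cnj (phi l x) \<partial>torus) = (if k = l then 1 else 0)" for k :: "int^'d"
proof (cases "k = l")
  case True
  have "(\<integral>x. phi k x * cnj (phi k x) \<partial>(torus :: (real^'d) measure))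
      = (\<integral>x. complex_of_real (((2 * pi) powr (- real CARD('d) / 2))\<^sup>2) \<partial>(torus :: (real^'d) measure))"
    by (simp add: complex_norm_square [symmetric] norm_phi)
  also have "\<dots> = (2 * pi) ^ CARD('d) * ((2 * pi) powr (- real CARD('d) / 2))\<^sup>2"
    by (simp add: measure_torus scaleR_conv_of_real)
  also have "((2 * pi) powr (- real CARD('d) / 2))\<^sup>2 = inverse ((2 * pi) ^ CARD('d))"
  proof -
    have "((2 * pi) powr (- real CARD('d) / 2))\<^sup>2 = (2 * pi) powr (- real CARD('d))"
      by (simp add: power2_eq_square flip: powr_add)
    then show ?thesis by (simp add: powr_minus powr_realpow)
  qed
  finally show ?thesis using True by (simp add: field_simps)
next
  case False
  then show ?thesis
    using phi_integral[of "k - l"] by (simp add: cnj_phi phi_mult)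
qed

lemma periodic_mult: "periodic u \<Longrightarrow> periodic v \<Longrightarrow> periodic (\<lambda>x. u x * v x)"
  by (simp add: periodic_def)

text \<open>The difference quotients in direction \<open>j\<close> have integral \<open>0\<close> by translation invariance, and they converge
to the derivative under a uniform bound.\<close>

lemma torus_integral_partial_derivative:
  fixes F :: "real^'d \<Rightarrow> complex"
  assumes per: "periodic F" and diff: "\<And>x. F differentiable (at x)"
    and cont: "continuous_on UNIV (\<lambda>x. frechet_derivative F (at x) (axis j 1))"
  shows "(\<integral>x. frechet_derivative F (at x) (axis j 1) \<partial>torus) = 0"
proof -
  let ?D = "\<lambda>x. frechet_derivative F (at x) (axis j 1)"
  let ?S = "cbox (0 :: real^'d) (\<chi> i. 2 * pi + 1)"
  have contF: "continuous_on UNIV F"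
    using diff differentiable_imp_continuous_within by (blast intro: continuous_at_imp_continuous_on)
  have "compact (?D ` ?S)"
    by (intro compact_continuous_image continuous_on_subset[OF cont]) auto
  then have "bounded (?D ` ?S)" by (rule compact_imp_bounded)
  then obtain B where "\<forall>y\<in>?D ` ?S. norm y \<le> B" unfolding bounded_iff by (elim exE)
  then have B: "norm (?D x) \<le> B" if "x \<in> ?S" for x using that by (rule bspec[OF _ imageI])
  have ax: "axis j t = t *\<^sub>R (axis j 1 :: real^'d)" for t by (simp add: axis_def vec_eq_iff)
  have ax0: "axis j 0 = (0 :: real^'d)" by (simp add: axis_def vec_eq_iff)
  have der: "((\<lambda>t. F (x + axis j t)) has_derivative (\<lambda>h. h *\<^sub>R ?D (x + axis j t))) (at t within T)" for x t T
  proof -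
    have F: "(F has_derivative frechet_derivative F (at (x + axis j t))) (at (x + axis j t))"
      using diff frechet_derivative_works by blast
    have "((\<lambda>t. x + axis j t) has_derivative (\<lambda>h. axis j h)) (at t within T)"
    proof -
      have "((\<lambda>t. x + t *\<^sub>R (axis j 1 :: real^'d)) has_derivative (\<lambda>h. h *\<^sub>R axis j 1)) (at t within T)"
        by (auto intro!: derivative_eq_intros)
      moreover have "(\<lambda>t. x + t *\<^sub>R (axis j 1 :: real^'d)) = (\<lambda>t. x + axis j t)" "(\<lambda>h. h *\<^sub>R (axis j 1 :: real^'d)) = axis j"
        by (simp_all add: fun_eq_iff axis_def vec_eq_iff)
      ultimately show ?thesis by simp
    qed
    from has_derivative_compose[OF this F]
    have "((\<lambda>t. F (x + axis j t)) has_derivative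
        (\<lambda>h. frechet_derivative F (at (x + axis j t)) (axis j h))) (at t within T)" .
    moreover have "(\<lambda>h. frechet_derivative F (at (x + axis j t)) (axis j h)) = (\<lambda>h. h *\<^sub>R ?D (x + axis j t))"
      by (rule ext, subst ax, rule linear_scale, rule linear_frechet_derivative[OF diff])
    ultimately show ?thesis by (simp only:)
  qed
  define s where "s n = inverse (real (Suc n))" for n
  have s: "0 < s n" "s n \<le> 1" for n by (auto simp: s_def divide_simps)
  have s0: "s \<longlonglongrightarrow> 0" unfolding s_def by (rule LIMSEQ_inverse_real_of_nat)
  \<comment> \<open>Difference quotients with steps in \<open>(0, 1]\<close>; the enlarged cube \<open>?S\<close> contains all the points they involve.\<close>
  define q where "q n x = (F (x + axis j (s n)) - F x) / of_real (s n)" for n x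
  have q0: "(\<integral>x. q n x \<partial>torus) = 0" for n
  proof -
    have "(\<integral>x. q n x \<partial>torus) = (\<integral>x. F (x + axis j (s n)) - F x \<partial>torus) / of_real (s n)"
      unfolding q_def by (rule integral_divide_zero)
    also have "(\<integral>x. F (x + axis j (s n)) - F x \<partial>torus)
        = (\<integral>x. F (x + axis j (s n)) \<partial>torus) - (\<integral>x. F x \<partial>torus)"
      by (intro Bochner_Integration.integral_diff integrable_torus_continuous contF
            continuous_on_compose2[OF contF] continuous_intros) auto
    also have "\<dots> = 0"
      using torus_integral_translate[OF contF per, of "s n" j] s[of n] pi_gt3 by simp
    finally show ?thesis by simp
  qed
  have "(\<lambda>n. \<integral>x. q n x \<partial>torus) \<longlonglongrightarrow> (\<integral>x. ?D x \<partial>torus)"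
  proof (rule integral_dominated_convergence[where w = "\<lambda>_. B"])
    show "?D \<in> borel_measurable torus"
      using cont by (intro measurable_torusI borel_measurable_continuous_onI)
    show "q n \<in> borel_measurable torus" for n
      unfolding q_def
      by (intro measurable_torusI borel_measurable_continuous_onI continuous_intros contF
            continuous_on_compose2[OF contF]) (use s[of n] in auto)
    show "integrable torus (\<lambda>_. B)" by simp
    show "AE x in torus. (\<lambda>n. q n x) \<longlonglongrightarrow> ?D x"
    proof (rule AE_I2)
      fix x :: "real^'d"
      have "((\<lambda>t. F (x + axis j t)) has_derivative (\<lambda>h. h *\<^sub>R ?D x)) (at 0)"
        using der[of x 0 UNIV] by (simp add: ax0)
      then have "(\<lambda>h. norm (F (x + axis j h) - F x - h *\<^sub>R ?D x) / norm h) \<midarrow>0\<rightarrow> 0"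
        by (simp add: has_derivative_at ax0)
      moreover have "filterlim s (at 0) sequentially"
        using s0 s(1) by (auto simp: filterlim_at less_imp_neq[THEN not_sym])
      ultimately have "(\<lambda>n. norm (F (x + axis j (s n)) - F x - s n *\<^sub>R ?D x) / norm (s n)) \<longlonglongrightarrow> 0"
        by (rule filterlim_compose)
      moreover have "norm (F (x + axis j (s n)) - F x - s n *\<^sub>R ?D x) / norm (s n) = norm (q n x - ?D x)" for n
      proof -
        have "q n x - ?D x = (F (x + axis j (s n)) - F x - s n *\<^sub>R ?D x) / of_real (s n)"
          using s(1)[of n] by (simp add: q_def diff_divide_distrib scaleR_conv_of_real)
        then show ?thesis by (simp add: norm_divide)
      qed
      ultimately show "(\<lambda>n. q n x) \<longlonglongrightarrow> ?D x"
        by (simp add: tendsto_norm_zero_iff LIM_zero_iff)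
    qed
    show "AE x in torus. norm (q n x) \<le> B" for n
    proof (rule AE_I2)
      fix x :: "real^'d" assume "x \<in> space torus"
      then have x: "x \<in> Omega" by (simp add: space_torus)
      have "norm (F (x + axis j (s n)) - F (x + axis j 0)) \<le> B * norm (s n - 0)"
      proof (rule differentiable_bound[of "{0..s n}"])
        show "((\<lambda>t. F (x + axis j t)) has_derivative (\<lambda>h. h *\<^sub>R ?D (x + axis j t))) (at t within {0..s n})" for t
          by (rule der)
        show "onorm (\<lambda>h. h *\<^sub>R ?D (x + axis j t)) \<le> B" if t: "t \<in> {0..s n}" for t
        proof (rule onorm_le)
          have *: "\<forall>i. 0 < x $ i \<and> x $ i < 2 * pi" using x by (simp add: mem_Omega)
          have "0 \<le> (x + axis j t) $ i \<and> (x + axis j t) $ i \<le> 2 * pi + 1" for i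
            using *[rule_format, of i] t s[of n] by (auto simp: axis_def)
          then have "x + axis j t \<in> ?S" by (simp add: mem_box_cart)
          then show "norm (h *\<^sub>R ?D (x + axis j t)) \<le> B * norm h" for h
            using B[of "x + axis j t"] mult_left_mono[of "norm (?D (x + axis j t))" B "norm h"]
            by (simp add: mult.commute)
        qed
      qed (use s[of n] in auto)
      then show "norm (q n x) \<le> B"
        using s[of n] by (simp add: q_def norm_divide pos_divide_le_eq ax0)
    qed
  qed
  then show ?thesis by (simp add: q0 LIMSEQ_const_iff)
qed

text \<open>Square integrability on the open cube, regardless of the values elsewhere. Representatives of \<open>L2p\<close>, their
weak derivatives and indicators of subsets of the cube can thus be compared in one space.\<close>

definition torus_L2 :: "(real^'d \<Rightarrow> complex) set" where
  "torus_L2 = {f. f \<in> borel_measurable torus \<and> integrable torus (\<lambda>x. (norm (f x))\<^sup>2)}"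

definition L2_norm :: "(real^'d \<Rightarrow> complex) \<Rightarrow> real" where
  "L2_norm f = sqrt (\<integral>x. (norm (f x))\<^sup>2 \<partial>torus)"

definition L2_inner :: "(real^'d \<Rightarrow> complex) \<Rightarrow> (real^'d \<Rightarrow> complex) \<Rightarrow> complex" where
  "L2_inner u v = (\<integral>x. u x * cnj (v x) \<partial>torus)"

lemma torus_L2D: "f \<in> torus_L2 \<Longrightarrow> f \<in> borel_measurable torus" "f \<in> torus_L2 \<Longrightarrow> integrable torus (\<lambda>x. (norm (f x))\<^sup>2)"
  by (auto simp: torus_L2_def)

lemma L2_norm_nonneg: "0 \<le> L2_norm f" by (simp add: L2_norm_def)

lemma L2_norm_sq: "(L2_norm f)\<^sup>2 = (\<integral>x. (norm (f x))\<^sup>2 \<partial>torus)"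
  by (simp add: L2_norm_def)

lemma fcoef_eq_ip: "fcoef v k = L2_inner v (phi k)"
  by (simp add: fcoef_def L2_inner_def integral_torus)

lemma L2p_subset: "v \<in> L2p \<Longrightarrow> v \<in> torus_L2"
  by (simp add: L2p_def torus_L2_def integrable_torus_iff measurable_torusI)

lemma norm_add_sq_le: "(norm (a + b))\<^sup>2 \<le> 2 * (norm a)\<^sup>2 + 2 * (norm b)\<^sup>2" for a b :: complex
proof -
  have "(norm (a + b))\<^sup>2 \<le> (norm a + norm b)\<^sup>2" by (intro power_mono norm_triangle_ineq) auto
  also have "\<dots> \<le> 2 * (norm a)\<^sup>2 + 2 * (norm b)\<^sup>2"
    using sum_squares_bound[of "norm a" "norm b"] by (simp add: power2_sum)
  finally show ?thesis .
qed

lemma torus_L2_add: assumes "f \<in> torus_L2" "g \<in> torus_L2" shows "(\<lambda>x. f x + g x) \<in> torus_L2"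
proof -
  note [measurable] = torus_L2D(1)[OF assms(1)] torus_L2D(1)[OF assms(2)]
  have "integrable torus (\<lambda>x. 2 * (norm (f x))\<^sup>2 + 2 * (norm (g x))\<^sup>2)"
    using assms by (auto simp: torus_L2_def)
  then have "integrable torus (\<lambda>x. (norm (f x + g x))\<^sup>2)"
  proof (rule Bochner_Integration.integrable_bound)
    show "AE x in torus. norm ((norm (f x + g x))\<^sup>2) \<le> norm (2 * (norm (f x))\<^sup>2 + 2 * (norm (g x))\<^sup>2)"
      using norm_add_sq_le by (intro AE_I2) simp
  qed measurable
  then show ?thesis by (simp add: torus_L2_def)
qed

lemma torus_L2_mult_bounded:
  fixes f :: "real^'d \<Rightarrow> complex"
  assumes f: "f \<in> torus_L2" and h: "h \<in> borel_measurable torus" "\<And>x. x \<in> Omega \<Longrightarrow> norm (h x) \<le> B"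
  shows "(\<lambda>x. h x * f x) \<in> torus_L2"
proof -
  note [measurable] = torus_L2D(1)[OF f] h(1)
  have "integrable torus (\<lambda>x. B\<^sup>2 * (norm (f x))\<^sup>2)" using f by (auto simp: torus_L2_def)
  then have "integrable torus (\<lambda>x. (norm (h x * f x))\<^sup>2)"
  proof (rule Bochner_Integration.integrable_bound)
    show "AE x in torus. norm ((norm (h x * f x))\<^sup>2) \<le> norm (B\<^sup>2 * (norm (f x))\<^sup>2)"
    proof (rule AE_I2)
      fix x :: "real^'d" assume "x \<in> space torus"
      then have "(norm (h x))\<^sup>2 \<le> B\<^sup>2" using h(2)[of x] by (intro power_mono) (auto simp: space_torus)
      then show "norm ((norm (h x * f x))\<^sup>2) \<le> norm (B\<^sup>2 * (norm (f x))\<^sup>2)"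
        by (simp add: norm_mult power_mult_distrib mult_right_mono)
    qed
  qed measurable
  then show ?thesis by (simp add: torus_L2_def)
qed

lemma torus_L2_scale: "f \<in> torus_L2 \<Longrightarrow> (\<lambda>x. c * f x) \<in> torus_L2"
  by (rule torus_L2_mult_bounded[where B = "norm c"]) auto

lemma borel_measurable_cnj [measurable]: "f \<in> borel_measurable M \<Longrightarrow> (\<lambda>x. cnj (f x)) \<in> borel_measurable M"
  by (rule measurable_compose[of f M borel cnj]) (auto intro!: borel_measurable_continuous_onI continuous_intros)

lemma torus_L2_continuous: assumes "continuous_on UNIV f" shows "f \<in> torus_L2"
proof -
  have "integrable torus (\<lambda>x. f x * cnj (f x))"
    by (intro integrable_torus_continuous continuous_intros assms)
  then have "integrable torus (\<lambda>x. complex_of_real ((norm (f x))\<^sup>2))"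
    by (simp only: complex_norm_square)
  then have "integrable torus (\<lambda>x. (norm (f x))\<^sup>2)"
    by (simp only: complex_of_real_integrable_eq)
  then show ?thesis
    using assms by (simp add: torus_L2_def measurable_torusI borel_measurable_continuous_onI)
qed

lemma torus_L2_phi: "phi k \<in> torus_L2"
  by (intro torus_L2_continuous phi_continuous)

lemma torus_L2_zero: "(\<lambda>x. 0) \<in> torus_L2"
  by (intro torus_L2_continuous continuous_intros)

lemma torus_L2_sum: "(\<And>k. k \<in> F \<Longrightarrow> f k \<in> torus_L2) \<Longrightarrow> (\<lambda>x. \<Sum>k\<in>F. f k x) \<in> torus_L2"
  by (induction F rule: infinite_finite_induct) (auto simp: torus_L2_zero intro: torus_L2_add)

lemma torus_L2_diff: "f \<in> torus_L2 \<Longrightarrow> g \<in> torus_L2 \<Longrightarrow> (\<lambda>x. f x - g x) \<in> torus_L2"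
  using torus_L2_add[of f "\<lambda>x. (-1) * g x"] torus_L2_scale[of g "-1"] by simp

lemma torus_L2_prod_norm_integrable:
  assumes "f \<in> torus_L2" "g \<in> torus_L2" shows "integrable torus (\<lambda>x. norm (f x) * norm (g x))"
proof -
  note [measurable] = torus_L2D(1)[OF assms(1)] torus_L2D(1)[OF assms(2)]
  have "integrable torus (\<lambda>x. (norm (f x))\<^sup>2 + (norm (g x))\<^sup>2)"
    using assms by (auto simp: torus_L2_def)
  then show ?thesis
  proof (rule Bochner_Integration.integrable_bound)
    show "AE x in torus. norm (norm (f x) * norm (g x)) \<le> norm ((norm (f x))\<^sup>2 + (norm (g x))\<^sup>2)"
    proof (rule AE_I2)
      fix x
      show "norm (norm (f x) * norm (g x)) \<le> norm ((norm (f x))\<^sup>2 + (norm (g x))\<^sup>2)"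
        using sum_squares_bound[of "norm (f x)" "norm (g x)"] mult_nonneg_nonneg[OF norm_ge_zero[of "f x"] norm_ge_zero[of "g x"]]
        unfolding real_norm_def abs_mult abs_norm_cancel by linarith
    qed
  qed measurable
qed

lemma torus_L2_prod_integrable:
  assumes "f \<in> torus_L2" "g \<in> torus_L2" shows "integrable torus (\<lambda>x. f x * cnj (g x))"
proof -
  note [measurable] = torus_L2D(1)[OF assms(1)] torus_L2D(1)[OF assms(2)]
  show ?thesis
    by (rule Bochner_Integration.integrable_bound[OF torus_L2_prod_norm_integrable[OF assms]])
       (auto simp: norm_mult)
qed

text \<open>The integral of \<open>(|f| - s |g|)\<^sup>2\<close> is non-negative for every real \<open>s\<close>; the quotient of the mixed term and
\<open>\<parallel>g\<parallel>\<^sup>2\<close> is the optimal \<open>s\<close>.\<close>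

lemma L2_Cauchy_Schwarz:
  assumes f: "f \<in> torus_L2" and g: "g \<in> torus_L2"
  shows "(\<integral>x. norm (f x) * norm (g x) \<partial>torus) \<le> L2_norm f * L2_norm g"
proof -
  note [measurable] = torus_L2D(1)[OF f] torus_L2D(1)[OF g]
  let ?Q = "\<integral>x. norm (f x) * norm (g x) \<partial>torus"
  have Q0: "?Q \<ge> 0" by simp
  have *: "0 \<le> (L2_norm f)\<^sup>2 - 2 * s * ?Q + s\<^sup>2 * (L2_norm g)\<^sup>2" for s
  proof -
    have "0 \<le> (\<integral>x. (norm (f x) - s * norm (g x))\<^sup>2 \<partial>torus)" by simp
    also have "\<dots> = (\<integral>x. (norm (f x))\<^sup>2 - 2 * s * (norm (f x) * norm (g x)) + s\<^sup>2 * (norm (g x))\<^sup>2 \<partial>torus)"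
      by (simp add: power2_diff power_mult_distrib algebra_simps)
    also have "\<dots> = (L2_norm f)\<^sup>2 - 2 * s * ?Q + s\<^sup>2 * (L2_norm g)\<^sup>2"
      unfolding L2_norm_sq using torus_L2D(2)[OF f] torus_L2D(2)[OF g] torus_L2_prod_norm_integrable[OF f g]
      by (subst Bochner_Integration.integral_add Bochner_Integration.integral_diff; simp)+
    finally show ?thesis .
  qed
  show ?thesis
  proof (cases "L2_norm g = 0")
    case True
    have "?Q = 0"
    proof (rule ccontr)
      assume "?Q \<noteq> 0"
      then have "?Q > 0" using Q0 by linarith
      then have "2 * (((L2_norm f)\<^sup>2 + 1) / (2 * ?Q)) * ?Q = (L2_norm f)\<^sup>2 + 1" by simp
      then show False using *[of "((L2_norm f)\<^sup>2 + 1) / (2 * ?Q)"] True by simp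
    qed
    then show ?thesis using True by simp
  next
    case False
    then have g0: "L2_norm g > 0" using L2_norm_nonneg[of g] by linarith
    define r where "r = (L2_norm g)\<^sup>2"
    have r: "r > 0" using g0 by (simp add: r_def)
    have "(?Q / r)\<^sup>2 * r = ?Q\<^sup>2 / r" using r by (simp add: power2_eq_square)
    moreover have "2 * (?Q / r) * ?Q = 2 * (?Q\<^sup>2 / r)" by (simp add: power2_eq_square)
    ultimately have "0 \<le> (L2_norm f)\<^sup>2 - ?Q\<^sup>2 / (L2_norm g)\<^sup>2"
      using *[of "?Q / r"] unfolding r_def[symmetric] by linarith
    then have "?Q\<^sup>2 \<le> (L2_norm f * L2_norm g)\<^sup>2"
      using g0 by (simp add: power_mult_distrib pos_divide_le_eq)
    then show ?thesis using L2_norm_nonneg by (meson mult_nonneg_nonneg power2_le_imp_le)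
  qed
qed

lemma weighted_inner_product_bound:
  fixes f :: "real^'d \<Rightarrow> complex"
  assumes f: "f \<in> torus_L2" and g: "g \<in> torus_L2"
    and h: "h \<in> borel_measurable torus" "\<And>x. x \<in> Omega \<Longrightarrow> norm (h x) \<le> B"
  shows "norm (\<integral>x. h x * f x * cnj (g x) \<partial>torus) \<le> B * (L2_norm f * L2_norm g)"
proof -
  note [measurable] = torus_L2D(1)[OF f] torus_L2D(1)[OF g] h(1)
  have "(\<chi> i. 1) \<in> (Omega :: (real^'d) set)" using pi_gt3 by (simp add: mem_Omega)
  then have B: "B \<ge> 0" using h(2) norm_ge_zero order_trans by blast
  have "norm (\<integral>x. h x * f x * cnj (g x) \<partial>torus) \<le> (\<integral>x. B * (norm (f x) * norm (g x)) \<partial>torus)"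
  proof (rule Bochner_Integration.integral_norm_bound_integral)
    show "integrable torus (\<lambda>x. h x * f x * cnj (g x))"
      by (intro torus_L2_prod_integrable torus_L2_mult_bounded[where B = B] f g h)
    show "integrable torus (\<lambda>x. B * (norm (f x) * norm (g x)))"
      using torus_L2_prod_norm_integrable[OF f g] by simp
    show "norm (h x * f x * cnj (g x)) \<le> B * (norm (f x) * norm (g x))" if "x \<in> space torus" for x
      using mult_right_mono[OF h(2), of x "norm (f x) * norm (g x)"] that
      by (simp add: norm_mult mult.assoc space_torus)
  qed
  also have "\<dots> = B * (\<integral>x. norm (f x) * norm (g x) \<partial>torus)" by simp
  also have "\<dots> \<le> B * (L2_norm f * L2_norm g)"
    by (intro mult_left_mono L2_Cauchy_Schwarz f g B)
  finally show ?thesis .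
qed

section \<open>Completeness of the trigonometric system\<close>

lemma L2_inner_add_left: "\<lbrakk>f \<in> torus_L2; g \<in> torus_L2; h \<in> torus_L2\<rbrakk> \<Longrightarrow> L2_inner (\<lambda>x. f x + g x) h = L2_inner f h + L2_inner g h"
  unfolding L2_inner_def ring_distribs
  by (intro Bochner_Integration.integral_add torus_L2_prod_integrable)

lemma L2_inner_scale_left: "L2_inner (\<lambda>x. c * f x) h = c * L2_inner f h"
  unfolding L2_inner_def mult.assoc by simp

lemma L2_inner_cnj: "cnj (L2_inner f g) = L2_inner g f"
proof -
  have "cnj (L2_inner f g) = (\<integral>x. cnj (f x * cnj (g x)) \<partial>torus)"
    unfolding L2_inner_def by (rule Bochner_Integration.integral_cnj[symmetric])
  then show ?thesis by (simp add: L2_inner_def mult.commute)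
qed

lemma L2_inner_self: "L2_inner f f = of_real ((L2_norm f)\<^sup>2)"
proof -
  have "L2_inner f f = (\<integral>x. complex_of_real ((norm (f x))\<^sup>2) \<partial>torus)"
    unfolding L2_inner_def complex_norm_square ..
  then show ?thesis by (simp only: L2_norm_sq integral_complex_of_real)
qed

lemma L2_inner_sum_left:
  assumes "\<And>k. k \<in> F \<Longrightarrow> f k \<in> torus_L2" "h \<in> torus_L2"
  shows "L2_inner (\<lambda>x. \<Sum>k\<in>F. f k x) h = (\<Sum>k\<in>F. L2_inner (f k) h)"
  using assms(1)
proof (induction F rule: infinite_finite_induct)
  case (insert k F)
  have "L2_inner (\<lambda>x. f k x + (\<Sum>k\<in>F. f k x)) h = L2_inner (f k) h + L2_inner (\<lambda>x. \<Sum>k\<in>F. f k x) h"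
    using insert.prems assms(2) by (intro L2_inner_add_left torus_L2_sum) auto
  then show ?case using insert by simp
qed (simp_all add: L2_inner_def)

lemma L2_norm_sq_add:
  assumes "f \<in> torus_L2" "g \<in> torus_L2"
  shows "(L2_norm (\<lambda>x. f x + g x))\<^sup>2 = (L2_norm f)\<^sup>2 + (L2_norm g)\<^sup>2 + 2 * Re (L2_inner f g)"
proof -
  let ?s = "\<lambda>x. f x + g x"
  have s: "?s \<in> torus_L2" by (intro torus_L2_add assms)
  have r: "L2_inner h ?s = L2_inner h f + L2_inner h g" if "h \<in> torus_L2" for h
    using L2_inner_add_left[OF assms that] by (metis L2_inner_cnj complex_cnj_add)
  have "L2_inner ?s ?s = L2_inner f f + L2_inner f g + (L2_inner g f + L2_inner g g)"
    using L2_inner_add_left[OF assms s] r[OF assms(1)] r[OF assms(2)] by simp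
  moreover have "Re (L2_inner g f) = Re (L2_inner f g)" using L2_inner_cnj[of f g] by (metis cnj.simps(1))
  ultimately have "Re (L2_inner ?s ?s) = Re (L2_inner f f) + Re (L2_inner g g) + 2 * Re (L2_inner f g)" by simp
  then show ?thesis by (simp add: L2_inner_self)
qed

lemma fcoef_add: "\<lbrakk>f \<in> torus_L2; g \<in> torus_L2\<rbrakk> \<Longrightarrow> fcoef (\<lambda>x. f x + g x) k = fcoef f k + fcoef g k"
  by (simp add: fcoef_eq_ip L2_inner_add_left torus_L2_phi)

lemma fcoef_scale: "fcoef (\<lambda>x. c * f x) k = c * fcoef f k"
  by (simp add: fcoef_eq_ip L2_inner_scale_left)

lemma fcoef_phi: "fcoef (phi k) l = (if k = l then 1 else 0)"
  by (simp add: fcoef_eq_ip L2_inner_def phi_orthonormal)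

lemma torus_L2_trig: "(\<lambda>x. \<Sum>k\<in>F. c k * phi k x) \<in> torus_L2"
  by (intro torus_L2_sum torus_L2_scale torus_L2_phi)

lemma fcoef_trig:
  assumes "finite F"
  shows "fcoef (\<lambda>x. \<Sum>k\<in>F. c k * phi k x) l = (if l \<in> F then c l else 0)"
proof -
  have "fcoef (\<lambda>x. \<Sum>k\<in>F. c k * phi k x) l = (\<Sum>k\<in>F. c k * (if k = l then 1 else 0))"
    unfolding fcoef_eq_ip
    by (subst L2_inner_sum_left)
       (auto intro!: torus_L2_scale torus_L2_phi sum.cong simp: L2_inner_scale_left fcoef_phi simp flip: fcoef_eq_ip)
  also have "\<dots> = (if l \<in> F then c l else 0)" using assms by (simp add: if_distrib cong: if_cong)
  finally show ?thesis .
qed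

text \<open>The best approximation identity: the error splits into the error of the Fourier sum and the deviation of the
coefficients from the Fourier coefficients. It contains Bessel's inequality and the optimality of Fourier sums.\<close>

lemma L2_norm_minus_trig:
  assumes v: "v \<in> torus_L2" and F: "finite F"
  shows "(L2_norm (\<lambda>x. v x - (\<Sum>k\<in>F. c k * phi k x)))\<^sup>2
       = (L2_norm v)\<^sup>2 - (\<Sum>k\<in>F. (norm (fcoef v k))\<^sup>2) + (\<Sum>k\<in>F. (norm (fcoef v k - c k))\<^sup>2)"
proof -
  define w where "w = (\<lambda>x. \<Sum>k\<in>F. c k * phi k x)"
  define m where "m = (\<lambda>x. (-1) * w x)"
  have w: "w \<in> torus_L2" unfolding w_def by (rule torus_L2_trig)
  have m: "m \<in> torus_L2" unfolding m_def by (rule torus_L2_scale[OF w])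
  have ww: "L2_inner w g = (\<Sum>k\<in>F. c k * cnj (fcoef g k))" if "g \<in> torus_L2" for g
  proof -
    have "L2_inner w g = (\<Sum>k\<in>F. L2_inner (\<lambda>x. c k * phi k x) g)"
      unfolding w_def by (rule L2_inner_sum_left[OF torus_L2_scale[OF torus_L2_phi] that])
    then show ?thesis by (simp only: L2_inner_scale_left fcoef_eq_ip L2_inner_cnj)
  qed
  have fw: "fcoef w k = c k" if "k \<in> F" for k
    unfolding w_def using fcoef_trig[OF F, of c k] that by simp
  have "L2_inner w w = (\<Sum>k\<in>F. c k * cnj (c k))"
    unfolding ww[OF w] by (rule sum.cong) (simp_all add: fw)
  then have "complex_of_real ((L2_norm w)\<^sup>2) = complex_of_real (\<Sum>k\<in>F. (norm (c k))\<^sup>2)"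
    by (simp only: L2_inner_self of_real_sum complex_norm_square)
  then have nw: "(L2_norm w)\<^sup>2 = (\<Sum>k\<in>F. (norm (c k))\<^sup>2)" by (simp only: of_real_eq_iff)
  have nm: "(L2_norm m)\<^sup>2 = (L2_norm w)\<^sup>2" unfolding L2_norm_sq m_def by simp
  have ipm: "Re (L2_inner v m) = - (\<Sum>k\<in>F. Re (c k * cnj (fcoef v k)))"
  proof -
    have "Re (L2_inner v m) = Re (cnj (L2_inner m v))" by (simp only: L2_inner_cnj)
    also have "\<dots> = Re (L2_inner m v)" by simp
    also have "L2_inner m v = (-1) * L2_inner w v" unfolding m_def by (rule L2_inner_scale_left)
    also have "Re \<dots> = - Re (L2_inner w v)" by simp
    also have "\<dots> = - (\<Sum>k\<in>F. Re (c k * cnj (fcoef v k)))" by (simp only: ww[OF v] Re_sum)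
    finally show ?thesis .
  qed
  have "(L2_norm (\<lambda>x. v x + m x))\<^sup>2 = (L2_norm v)\<^sup>2 + (L2_norm m)\<^sup>2 + 2 * Re (L2_inner v m)"
    by (rule L2_norm_sq_add[OF v m])
  moreover have "(\<lambda>x. v x + m x) = (\<lambda>x. v x - (\<Sum>k\<in>F. c k * phi k x))" by (simp add: m_def w_def)
  ultimately have "(L2_norm (\<lambda>x. v x - (\<Sum>k\<in>F. c k * phi k x)))\<^sup>2
      = (L2_norm v)\<^sup>2 + (\<Sum>k\<in>F. (norm (c k))\<^sup>2) - 2 * (\<Sum>k\<in>F. Re (c k * cnj (fcoef v k)))"
    unfolding nm nw ipm by simp
  moreover have "(\<Sum>k\<in>F. (norm (fcoef v k - c k))\<^sup>2)
      = (\<Sum>k\<in>F. (norm (fcoef v k))\<^sup>2 + (norm (c k))\<^sup>2 - 2 * Re (c k * cnj (fcoef v k)))"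
    unfolding cmod_power2 by (intro sum.cong refl) (simp add: power2_eq_square algebra_simps)
  moreover have "\<dots> = (\<Sum>k\<in>F. (norm (fcoef v k))\<^sup>2) + (\<Sum>k\<in>F. (norm (c k))\<^sup>2)
      - 2 * (\<Sum>k\<in>F. Re (c k * cnj (fcoef v k)))"
    by (simp only: sum.distrib sum_subtractf sum_distrib_left)
  ultimately show ?thesis by linarith
qed

text \<open>Generating trigonometric polynomials by sums and multiples makes closure under products an induction; the
representation by a finite coefficient family is recovered in \<open>trig_expansion\<close>.\<close>

inductive_set trig :: "(real^'d \<Rightarrow> complex) set" where
  phi: "phi k \<in> trig"
| add: "p \<in> trig \<Longrightarrow> q \<in> trig \<Longrightarrow> (\<lambda>x. p x + q x) \<in> trig"
| scale: "p \<in> trig \<Longrightarrow> (\<lambda>x. c * p x) \<in> trig"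

lemma trig_expansion:
  assumes "p \<in> trig" shows "\<exists>F c. finite F \<and> p = (\<lambda>x. \<Sum>k\<in>F. c k * phi k x)"
  using assms
proof induction
  case (phi k)
  then show ?case by (intro exI[of _ "{k}"] exI[of _ "\<lambda>_. 1"]) auto
next
  case (add p q)
  then obtain F c G d where *: "finite F" "p = (\<lambda>x. \<Sum>k\<in>F. c k * phi k x)"
    "finite G" "q = (\<lambda>x. \<Sum>k\<in>G. d k * phi k x)" by blast
  let ?c = "\<lambda>k. if k \<in> F then c k else 0" and ?d = "\<lambda>k. if k \<in> G then d k else 0"
  have "(\<Sum>k\<in>F. c k * phi k x) = (\<Sum>k\<in>F \<union> G. ?c k * phi k x)"
    "(\<Sum>k\<in>G. d k * phi k x) = (\<Sum>k\<in>F \<union> G. ?d k * phi k x)" for x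
    using *(1,3) by (auto intro!: sum.mono_neutral_cong_left)
  then have "(\<lambda>x. p x + q x) = (\<lambda>x. \<Sum>k\<in>F \<union> G. (?c k + ?d k) * phi k x)"
    using * by (simp add: ring_distribs sum.distrib)
  then show ?case using * by (intro exI[of _ "F \<union> G"] exI[of _ "\<lambda>k. ?c k + ?d k"]) simp
next
  case (scale p a)
  then obtain F c where *: "finite F" "p = (\<lambda>x. \<Sum>k\<in>F. c k * phi k x)" by blast
  then have "(\<lambda>x. a * p x) = (\<lambda>x. \<Sum>k\<in>F. (a * c k) * phi k x)"
    by (simp add: sum_distrib_left mult.assoc)
  then show ?case using * by (intro exI[of _ F] exI[of _ "\<lambda>k. a * c k"]) simp
qed

lemma trig_continuous: "p \<in> trig \<Longrightarrow> continuous_on UNIV p"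
  by (induction rule: trig.induct) (auto intro!: continuous_intros phi_continuous)

lemma trig_const: "(\<lambda>x. c) \<in> (trig :: (real^'d \<Rightarrow> complex) set)"
proof -
  let ?a = "complex_of_real ((2 * pi) powr (- real CARD('d) / 2))"
  have "(rvec 0 :: real^'d) = 0" by (simp add: rvec_def vec_eq_iff)
  then have "(\<lambda>x. c) = (\<lambda>x :: real^'d. (c / ?a) * phi 0 x)" by (simp add: phi_def)
  then show ?thesis by (simp only: trig.phi trig.scale)
qed

lemma trig_mult: assumes "p \<in> trig" "q \<in> trig" shows "(\<lambda>x. p x * q x) \<in> trig"
  using assms
proof induction
  case (phi k)
  then show ?case
  proof induction
    case (phi l)
    then show ?case unfolding phi_mult by (intro trig.intros)
  next
    case (add p q) then show ?case unfolding ring_distribs by (intro trig.add)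
  next
    case (scale p c)
    from trig.scale[OF scale.IH, of c] show ?case by (simp add: mult.left_commute)
  qed
next
  case (add p q) then show ?case unfolding ring_distribs by (intro trig.add) auto
next
  case (scale p c) then show ?case unfolding mult.assoc by (intro trig.scale) auto
qed

text \<open>The identification of the torus with a compact subset of \<open>\<complex>\<^sup>d\<close>. Polynomials in the real and imaginary
parts of the coordinates pull back to trigonometric polynomials, and continuous functions on \<open>\<complex>\<^sup>d\<close> pull
back to periodic continuous ones.\<close>

definition torus_point :: "real^'d \<Rightarrow> complex^'d" where
  "torus_point x = (\<chi> i. cis (x $ i))"

definition torus_angle :: "complex^'d \<Rightarrow> real^'d" where
  "torus_angle z = (\<chi> i. Arg2pi (z $ i))"

lemma continuous_torus_point: "continuous_on UNIV torus_point"
  unfolding torus_point_def by (intro continuous_intros)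

lemma torus_angle_point: "x \<in> Omega \<Longrightarrow> torus_angle (torus_point x) = x"
proof -
  assume "x \<in> Omega"
  then have "Arg2pi (cis (x $ i)) = x $ i" for i
    by (intro Arg2pi_unique[of 1]) (auto simp: mem_Omega cis_conv_exp less_imp_le)
  then show ?thesis by (simp add: torus_angle_def torus_point_def)
qed

lemma borel_measurable_Arg2pi: "Arg2pi \<in> borel_measurable borel"
proof -
  have "(\<lambda>z. if z \<in> \<real>\<^sub>\<ge>\<^sub>0 then 0 else Arg2pi z) \<in> borel_measurable borel"
  proof (rule borel_measurable_continuous_on_if)
    show "continuous_on (- \<real>\<^sub>\<ge>\<^sub>0) Arg2pi"
      using continuous_at_Arg2pi by (intro continuous_at_imp_continuous_on) auto
  qed (auto intro: borel_closed)
  moreover have "(\<lambda>z. if z \<in> \<real>\<^sub>\<ge>\<^sub>0 then 0 else Arg2pi z) = Arg2pi"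
    using Arg2pi_eq_0 by (auto simp: fun_eq_iff complex_nonneg_Reals_iff complex_is_Real_iff)
  ultimately show ?thesis by simp
qed

text \<open>\<open>torus_angle\<close> inverts \<open>torus_point\<close> on \<open>Omega\<close>; its measurability shows that \<open>torus_point\<close> carries Borel
subsets of \<open>Omega\<close> to traces of Borel sets. \<open>Arg2pi\<close> jumps across the positive real axis, where it is \<open>0\<close>.\<close>

lemma borel_measurable_torus_angle: "torus_angle \<in> borel_measurable borel"
proof (rule borel_measurable_euclidean_space[THEN iffD2], rule ballI)
  fix b :: "real^'a" assume "b \<in> Basis"
  then obtain i where b: "b = axis i 1" by (auto simp: Basis_vec_def)
  have "(\<lambda>z::complex^'a. Arg2pi (z $ i)) \<in> borel_measurable borel"
    by (rule measurable_compose[OF _ borel_measurable_Arg2pi])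
       (intro borel_measurable_continuous_onI continuous_intros)
  then show "(\<lambda>z. torus_angle z \<bullet> b) \<in> borel_measurable borel"
    by (simp add: b inner_axis torus_angle_def)
qed

lemma trig_cos_sin: "(\<lambda>x. complex_of_real (cos (x $ i))) \<in> trig" "(\<lambda>x. complex_of_real (sin (x $ i))) \<in> trig"
proof -
  have r: "rvec (axis i 1) \<bullet> x = x $ i" "rvec (axis i (-1)) \<bullet> x = - (x $ i)" for x
  proof -
    have "rvec (axis i 1) = axis i 1" "rvec (axis i (-1)) = axis i (-1)"
      by (auto simp: rvec_def axis_def vec_eq_iff)
    then show "rvec (axis i 1) \<bullet> x = x $ i" "rvec (axis i (-1)) \<bullet> x = - (x $ i)"
      by (simp_all add: inner_axis')
  qed
  let ?a = "complex_of_real ((2 * pi) powr (- real CARD('a) / 2))"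
  have e: "(\<lambda>x. cis (x $ i)) \<in> trig" "(\<lambda>x. cis (- (x $ i))) \<in> trig"
    using trig.scale[OF trig.phi, of "1 / ?a" "axis i 1"] trig.scale[OF trig.phi, of "1 / ?a" "axis i (-1)"]
    by (simp_all add: phi_def r cis_conv_exp)
  have c: "complex_of_real (cos t) = (1/2) * cis t + (1/2) * cis (- t)"
    and s: "complex_of_real (sin t) = (- \<i>/2) * cis t + (\<i>/2) * cis (- t)" for t
    by (simp_all add: complex_eq_iff)
  show "(\<lambda>x. complex_of_real (cos (x $ i))) \<in> trig" "(\<lambda>x. complex_of_real (sin (x $ i))) \<in> trig"
    unfolding c s by (intro trig.add trig.scale e)+
qed

lemma trig_sum: "finite A \<Longrightarrow> (\<And>i. i \<in> A \<Longrightarrow> f i \<in> trig) \<Longrightarrow> (\<lambda>x. \<Sum>i\<in>A. f i x) \<in> trig"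
  by (induction A rule: finite_induct) (auto simp: trig_const intro: trig.add)

text \<open>A linear functional of \<open>torus_point x\<close> is a combination of \<open>cos (x i)\<close> and \<open>sin (x i)\<close>; sums and products
of trigonometric polynomials are trigonometric polynomials.\<close>

lemma trig_real_polynomial:
  fixes g :: "complex^'d \<Rightarrow> real"
  assumes "real_polynomial_function g"
  shows "(\<lambda>x. complex_of_real (g (torus_point x))) \<in> trig"
  using assms
proof induction
  case (linear f)
  interpret bounded_linear f by fact
  have "f (torus_point x) = (\<Sum>i\<in>UNIV. cos (x $ i) * f (axis i 1) + sin (x $ i) * f (axis i \<i>))" for x
  proof -
    have "torus_point x = (\<Sum>i\<in>UNIV. cos (x $ i) *\<^sub>R axis i 1 + sin (x $ i) *\<^sub>R axis i \<i>)"
      by (simp add: vec_eq_iff torus_point_def axis_def complex_eq_iff if_distrib sum.distrib cong: if_cong)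
    then show ?thesis by (simp add: sum add scaleR)
  qed
  then have "(\<lambda>x. complex_of_real (f (torus_point x)))
      = (\<lambda>x. \<Sum>i\<in>UNIV. of_real (f (axis i 1)) * of_real (cos (x $ i)) + of_real (f (axis i \<i>)) * of_real (sin (x $ i)))"
    by (simp add: mult.commute)
  also have "\<dots> \<in> trig" by (intro trig_sum trig.add trig.scale trig_cos_sin) auto
  finally show ?case .
next
  case (const c) then show ?case by (rule trig_const)
next
  case (add f g) then show ?case by (simp add: trig.add)
next
  case (mult f g) then show ?case by (simp add: trig_mult)
qed

text \<open>Membership in the \<open>L\<^sup>2\<close> closure of the trigonometric polynomials.\<close>

definition trig_limit :: "(real^'d \<Rightarrow> complex) \<Rightarrow> bool" where
  "trig_limit f \<longleftrightarrow> f \<in> torus_L2 \<and> (\<forall>e>0. \<exists>p\<in>trig. (L2_norm (\<lambda>x. f x - p x))\<^sup>2 < e)"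

lemma trig_torus_L2: "p \<in> trig \<Longrightarrow> p \<in> torus_L2"
  by (intro torus_L2_continuous trig_continuous)

lemma L2_norm_two_squares:
  assumes f: "f \<in> torus_L2" and g: "g \<in> torus_L2" and h: "h \<in> torus_L2"
  shows "(L2_norm (\<lambda>x. f x - h x))\<^sup>2 \<le> 2 * (L2_norm (\<lambda>x. f x - g x))\<^sup>2 + 2 * (L2_norm (\<lambda>x. g x - h x))\<^sup>2"
proof -
  have "(\<integral>x. (norm (f x - h x))\<^sup>2 \<partial>torus)
      \<le> (\<integral>x. 2 * (norm (f x - g x))\<^sup>2 + 2 * (norm (g x - h x))\<^sup>2 \<partial>torus)"
  proof (rule integral_mono)
    show "(norm (f x - h x))\<^sup>2 \<le> 2 * (norm (f x - g x))\<^sup>2 + 2 * (norm (g x - h x))\<^sup>2" for x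
      using norm_add_sq_le[of "f x - g x" "g x - h x"] by simp
  qed (use torus_L2D(2)[OF torus_L2_diff[OF f g]] torus_L2D(2)[OF torus_L2_diff[OF g h]] torus_L2D(2)[OF torus_L2_diff[OF f h]] in auto)
  then show ?thesis
    unfolding L2_norm_sq using torus_L2D(2)[OF torus_L2_diff[OF f g]] torus_L2D(2)[OF torus_L2_diff[OF g h]] by simp
qed

lemma trig_limit_closed:
  assumes f: "f \<in> torus_L2" and *: "\<And>e. e > 0 \<Longrightarrow> \<exists>g. trig_limit g \<and> (L2_norm (\<lambda>x. f x - g x))\<^sup>2 < e"
  shows "trig_limit f"
  unfolding trig_limit_def
proof (intro conjI f allI impI)
  fix e :: real assume e: "e > 0"
  obtain g where g: "trig_limit g" "(L2_norm (\<lambda>x. f x - g x))\<^sup>2 < e / 4" using *[of "e / 4"] e by auto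
  obtain p where p: "p \<in> trig" "(L2_norm (\<lambda>x. g x - p x))\<^sup>2 < e / 4"
    using g(1) e unfolding trig_limit_def by (meson divide_pos_pos zero_less_numeral)
  have "(L2_norm (\<lambda>x. f x - p x))\<^sup>2 < e"
    using L2_norm_two_squares[OF f _ trig_torus_L2[OF p(1)], of g] g p unfolding trig_limit_def by auto
  then show "\<exists>p\<in>trig. (L2_norm (\<lambda>x. f x - p x))\<^sup>2 < e" using p(1) by blast
qed

lemma trig_limit_add:
  assumes "trig_limit f" "trig_limit g" shows "trig_limit (\<lambda>x. f x + g x)"
proof -
  have fg: "f \<in> torus_L2" "g \<in> torus_L2" using assms by (auto simp: trig_limit_def)
  show ?thesis
    unfolding trig_limit_def
  proof (intro conjI torus_L2_add fg allI impI)
    fix e :: real assume e: "e > 0"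
    obtain p where p: "p \<in> trig" "(L2_norm (\<lambda>x. f x - p x))\<^sup>2 < e / 4"
      using assms(1) e unfolding trig_limit_def by (meson divide_pos_pos zero_less_numeral)
    obtain q where q: "q \<in> trig" "(L2_norm (\<lambda>x. g x - q x))\<^sup>2 < e / 4"
      using assms(2) e unfolding trig_limit_def by (meson divide_pos_pos zero_less_numeral)
    note L = fg trig_torus_L2[OF p(1)] trig_torus_L2[OF q(1)]
    have "(L2_norm (\<lambda>x. (f x + g x) - (p x + q x)))\<^sup>2
        \<le> 2 * (L2_norm (\<lambda>x. (f x + g x) - (p x + g x)))\<^sup>2 + 2 * (L2_norm (\<lambda>x. (p x + g x) - (p x + q x)))\<^sup>2"
      by (intro L2_norm_two_squares torus_L2_add L)
    also have "\<dots> < e" using p q by simp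
    finally show "\<exists>p\<in>trig. (L2_norm (\<lambda>x. f x + g x - p x))\<^sup>2 < e"
      by (rule bexI[of _ "\<lambda>x. p x + q x", OF _ trig.add[OF p(1) q(1)]])
  qed
qed

lemma trig_limit_trig: "p \<in> trig \<Longrightarrow> trig_limit p"
  unfolding trig_limit_def
proof (intro conjI allI impI)
  assume p: "p \<in> trig"
  show "p \<in> torus_L2" by (rule trig_torus_L2[OF p])
  fix e :: real assume "e > 0"
  then have "(L2_norm (\<lambda>x. p x - p x))\<^sup>2 < e" by (simp add: L2_norm_sq)
  then show "\<exists>q\<in>trig. (L2_norm (\<lambda>x. p x - q x))\<^sup>2 < e" by (rule bexI[OF _ p])
qed

lemma trig_limit_scale:
  assumes "trig_limit f" shows "trig_limit (\<lambda>x. c * f x)"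
proof (cases "c = 0")
  case True
  have "trig_limit (\<lambda>x. 0)" by (rule trig_limit_trig[OF trig_const])
  then show ?thesis unfolding True by (simp only: mult_zero_left)
next
  case False
  have f: "f \<in> torus_L2" using assms by (auto simp: trig_limit_def)
  show ?thesis unfolding trig_limit_def
  proof (intro conjI torus_L2_scale f allI impI)
    fix e :: real assume e: "e > 0"
    have "0 < e / (norm c)\<^sup>2" using e False by simp
    then obtain p where p: "p \<in> trig" "(L2_norm (\<lambda>x. f x - p x))\<^sup>2 < e / (norm c)\<^sup>2"
      using assms unfolding trig_limit_def by blast
    have "(L2_norm (\<lambda>x. c * f x - c * p x))\<^sup>2 = (norm c)\<^sup>2 * (L2_norm (\<lambda>x. f x - p x))\<^sup>2"
      unfolding L2_norm_sq right_diff_distrib[symmetric] norm_mult power_mult_distrib by simp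
    also have "\<dots> < e"
    proof -
      have "(norm c)\<^sup>2 > 0" using False by simp
      then show ?thesis using p(2) by (simp only: pos_less_divide_eq mult.commute)
    qed
    finally show "\<exists>p\<in>trig. (L2_norm (\<lambda>x. c * f x - p x))\<^sup>2 < e"
      by (rule bexI[of _ "\<lambda>x. c * p x", OF _ trig.scale[OF p(1)]])
  qed
qed

lemma trig_limit_sum: "finite A \<Longrightarrow> (\<And>i. i \<in> A \<Longrightarrow> trig_limit (f i)) \<Longrightarrow> trig_limit (\<lambda>x. \<Sum>i\<in>A. f i x)"
proof (induction A rule: finite_induct)
  case empty
  show ?case by (simp only: sum.empty) (rule trig_limit_trig[OF trig_const])
next
  case (insert i A)
  have "trig_limit (f i)" by (rule insert.prems) simp
  moreover have "trig_limit (\<lambda>x. \<Sum>i\<in>A. f i x)" by (rule insert.IH, rule insert.prems) simp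
  ultimately have "trig_limit (\<lambda>x. f i x + (\<Sum>i\<in>A. f i x))" by (rule trig_limit_add)
  then show ?case by (simp only: sum.insert[OF insert.hyps])
qed

lemma trig_limit_continuous:
  fixes g :: "complex^'d \<Rightarrow> real"
  assumes g: "continuous_on UNIV g"
  shows "trig_limit (\<lambda>x. complex_of_real (g (torus_point x)))"
  unfolding trig_limit_def
proof (intro conjI allI impI)
  let ?f = "\<lambda>x. complex_of_real (g (torus_point x))"
  show f: "?f \<in> torus_L2"
    by (intro torus_L2_continuous continuous_on_of_real continuous_on_compose2[OF g continuous_torus_point] subset_UNIV)
  fix e :: real assume e: "e > 0"
  define V where "V = (2 * pi) ^ CARD('d)"
  have V: "V > 0" by (simp add: V_def)
  define r where "r = sqrt (e / (2 * V))"
  have r: "r > 0" "r\<^sup>2 = e / (2 * V)" using e V by (auto simp: r_def)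
  have "compact (torus_point ` (UNIV :: (real^'d) set))"
  proof -
    have "torus_point ` UNIV = {z :: complex^'d. \<forall>i. norm (z $ i) = 1}"
    proof (intro equalityI subsetI)
      fix z :: "complex^'d" assume z: "z \<in> {z. \<forall>i. norm (z $ i) = 1}"
      have "z = torus_point (torus_angle z)"
      proof -
        have "cis (Arg2pi (z $ i)) = z $ i" for i
          using z complex_norm_eq_1_exp[of "z $ i"] by (simp add: cis_conv_exp)
        then show ?thesis by (simp add: vec_eq_iff torus_point_def torus_angle_def)
      qed
      then show "z \<in> torus_point ` UNIV" by blast
    qed (auto simp: torus_point_def)
    moreover have "compact {z :: complex^'d. \<forall>i. norm (z $ i) = 1}"
    proof (rule compact_eq_bounded_closed[THEN iffD2], intro conjI)
      show "bounded {z :: complex^'d. \<forall>i. norm (z $ i) = 1}"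
      proof (rule boundedI)
        fix z :: "complex^'d" assume "z \<in> {z. \<forall>i. norm (z $ i) = 1}"
        then show "norm z \<le> real CARD('d)"
          using L2_set_le_sum[of UNIV "\<lambda>i. norm (z $ i)"] by (simp add: norm_vec_def)
      qed
      have "closed {z :: complex^'d. norm (z $ i) = 1}" for i
        by (intro closed_Collect_eq continuous_intros)
      then show "closed {z :: complex^'d. \<forall>i. norm (z $ i) = 1}"
        by (rule closed_Collect_all)
    qed
    ultimately show ?thesis by simp
  qed
  then obtain q where q: "real_polynomial_function q" "\<And>z. z \<in> torus_point ` (UNIV :: (real^'d) set) \<Longrightarrow> \<bar>g z - q z\<bar> < r"
    by (rule Stone_Weierstrass_real_polynomial_function[OF _ continuous_on_subset[OF g subset_UNIV] r(1)]) (rule that; assumption)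
  let ?p = "\<lambda>x. complex_of_real (q (torus_point x))"
  have p: "?p \<in> trig" by (rule trig_real_polynomial[OF q(1)])
  have "(L2_norm (\<lambda>x. ?f x - ?p x))\<^sup>2 \<le> (\<integral>x. r\<^sup>2 \<partial>(torus :: (real^'d) measure))"
    unfolding L2_norm_sq
  proof (rule integral_mono)
    show "integrable torus (\<lambda>x. (norm (?f x - ?p x))\<^sup>2)"
      by (rule torus_L2D(2)[OF torus_L2_diff[OF f trig_torus_L2[OF p]]])
    show "(norm (?f x - ?p x))\<^sup>2 \<le> r\<^sup>2" for x
    proof -
      have "norm (?f x - ?p x) = \<bar>g (torus_point x) - q (torus_point x)\<bar>"
        by (simp only: of_real_diff[symmetric] norm_of_real)
      then show ?thesis using q(2)[of "torus_point x"] by (intro power_mono) (auto simp: less_imp_le)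
    qed
  qed auto
  also have "\<dots> = e / 2" using r V by (simp add: measure_torus V_def)
  also have "\<dots> < e" using e by simp
  finally show "\<exists>p\<in>trig. (L2_norm (\<lambda>x. ?f x - p x))\<^sup>2 < e" using p by (intro bexI[of _ ?p])
qed

text \<open>The image of the torus measure on \<open>\<complex>\<^sup>d\<close> is a finite Borel measure, hence regular. A set is enclosed
between a compact set and an open set that differ by small measure, and a Urysohn function between them
approximates the indicator. Working on the image instead of on \<open>Omega\<close> makes all these functions
periodic automatically.\<close>

lemma trig_limit_indicator:
  fixes A :: "(real^'d) set"
  assumes A: "A \<in> sets torus"
  shows "trig_limit (indicator A)"
proof (rule trig_limit_closed)
  have AO: "A \<subseteq> Omega" "A \<in> sets borel"
    using A by (auto simp: torus_def sets_restrict_space)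
  show fL: "(indicator A :: real^'d \<Rightarrow> complex) \<in> torus_L2"
  proof -
    have "integrable torus (\<lambda>x. (norm (indicator A x :: complex))\<^sup>2)"
    proof (rule integrable_torus_bounded[where B = 1])
      show "(\<lambda>x. (norm (indicator A x :: complex))\<^sup>2) \<in> borel_measurable torus" using A by measurable
    qed (auto simp: indicator_def)
    then show ?thesis using A by (simp add: torus_L2_def)
  qed
  fix e :: real assume e: "e > 0"
  have E: "torus_point \<in> measurable torus borel"
    by (intro measurable_torusI borel_measurable_continuous_onI continuous_torus_point)
  define N where "N = distr (torus :: (real^'d) measure) borel torus_point"
  have N: "finite_measure N" unfolding N_def by (rule torus.finite_measure_distr[OF E])
  interpret N: finite_measure N by (rule N)
  have sN: "sets N = sets borel" by (simp add: N_def)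
  have fin: "emeasure N (space N) \<noteq> \<infinity>" by simp
  define A' where "A' = torus_angle -` A"
  have A': "A' \<in> sets borel"
    using measurable_sets_borel[OF borel_measurable_torus_angle AO(2)] by (simp add: A'_def)
  have AA': "torus_point x \<in> A' \<longleftrightarrow> x \<in> A" if "x \<in> Omega" for x
    using torus_angle_point[OF that] by (simp add: A'_def)
  obtain K where K: "K \<subseteq> A'" "compact K" "measure N A' - e / 3 < measure N K"
  proof (cases "measure N A' - e / 3 < 0")
    case True
    then show thesis using that[of "{}"] by simp
  next
    case False
    have "ennreal (measure N A' - e / 3) < emeasure N A'"
      using e False by (simp add: N.emeasure_eq_measure ennreal_less_iff)
    also have "\<dots> = (SUP K \<in> {K. K \<subseteq> A' \<and> compact K}. emeasure N K)"
      by (rule inner_regular[OF sN fin A'])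
    finally obtain K where "K \<subseteq> A'" "compact K" "ennreal (measure N A' - e / 3) < emeasure N K"
      by (auto simp: less_SUP_iff)
    then show thesis using that[of K] False by (simp add: N.emeasure_eq_measure ennreal_less_iff)
  qed
  obtain U where U: "A' \<subseteq> U" "open U" "measure N U < measure N A' + e / 3"
  proof -
    have "(INF U \<in> {U. A' \<subseteq> U \<and> open U}. emeasure N U) = emeasure N A'"
      by (rule outer_regular[OF sN fin A', symmetric])
    also have "\<dots> < ennreal (measure N A' + e / 3)"
      using e by (simp add: N.emeasure_eq_measure ennreal_less_iff)
    finally obtain U where "A' \<subseteq> U" "open U" "emeasure N U < ennreal (measure N A' + e / 3)"
      by (auto simp: INF_less_iff)
    then show thesis using that[of U] by (simp add: N.emeasure_eq_measure ennreal_less_iff del: ennreal_plus)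
  qed
  have KU: "K \<subseteq> U" using K U by blast
  have [measurable]: "K \<in> sets borel" "U \<in> sets borel" using K(2) U(2) by (auto intro: borel_compact borel_open)
  obtain g :: "complex^'d \<Rightarrow> real" where g: "continuous_on UNIV g" "\<And>z. g z \<in> closed_segment 1 0"
    "\<And>z. z \<in> K \<Longrightarrow> g z = 1" "\<And>z. z \<in> - U \<Longrightarrow> g z = 0"
    using Urysohn[of K "- U" 1 0] K(2) U(2) KU by (auto simp: compact_imp_closed)
  have g01: "0 \<le> g z" "g z \<le> 1" for z using g(2)[of z] by (auto simp: closed_segment_eq_real_ivl)
  let ?g = "\<lambda>x. complex_of_real (g (torus_point x))"
  have "(L2_norm (\<lambda>x. indicator A x - ?g x))\<^sup>2 \<le> (\<integral>x. indicator (U - K) (torus_point x) \<partial>torus)"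
    unfolding L2_norm_sq
  proof (rule integral_mono_AE)
    show "integrable torus (\<lambda>x. (norm (indicator A x - ?g x))\<^sup>2)"
      using trig_limit_continuous[OF g(1)] by (intro torus_L2D(2) torus_L2_diff fL) (simp add: trig_limit_def)
    show "integrable torus (\<lambda>x. indicator (U - K) (torus_point x) :: real)"
      by (rule integrable_torus_bounded[where B = 1])
         (auto intro!: measurable_compose[OF E] simp: indicator_def)
    show "AE x in torus. (norm (indicator A x - ?g x))\<^sup>2 \<le> indicator (U - K) (torus_point x)"
    proof (rule AE_I2)
      fix x :: "real^'d" assume "x \<in> space torus"
      then have x: "x \<in> Omega" by (simp add: space_torus)
      have n: "norm (indicator A x - ?g x) = \<bar>indicator A x - g (torus_point x)\<bar>"
      proof -
        have "indicator A x - ?g x = complex_of_real (indicator A x - g (torus_point x))"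
          by (simp add: indicator_def)
        then show ?thesis by (simp only: norm_of_real)
      qed
      show "(norm (indicator A x - ?g x))\<^sup>2 \<le> indicator (U - K) (torus_point x)"
      proof (cases "torus_point x \<in> U - K")
        case True
        have "\<bar>indicator A x - g (torus_point x)\<bar> \<le> 1" using g01[of "torus_point x"] by (auto simp: indicator_def)
        then show ?thesis using True by (simp add: n abs_square_le_1)
      next
        case False
        then consider "torus_point x \<in> K" | "torus_point x \<in> - U" by blast
        then have "indicator A x = g (torus_point x)"
        proof cases
          case 1 then show ?thesis using AA'[OF x] K(1) g(3) by auto
        next
          case 2 then show ?thesis using AA'[OF x] U(1) g(4) by (auto simp: indicator_def)
        qed
        then show ?thesis using False by (simp add: n)
      qed
    qed
  qed
  also have "\<dots> = (\<integral>z. indicator (U - K) z \<partial>N)"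
    unfolding N_def by (subst integral_distr[OF E]) auto
  also have "\<dots> = measure N U - measure N K"
    using KU by (simp add: sN N.finite_measure_Diff)
  also have "\<dots> < e" using K(3) U(3) e by linarith
  finally show "\<exists>g. trig_limit g \<and> (L2_norm (\<lambda>x. indicator A x - g x))\<^sup>2 < e"
    using trig_limit_continuous[OF g(1)] by (intro exI[of _ ?g] conjI)
qed

text \<open>Simple functions reduce the claim to indicators, and dominated convergence reduces it to simple functions.\<close>

theorem trig_dense:
  assumes f: "f \<in> torus_L2" shows "trig_limit f"
proof (rule trig_limit_closed[OF f])
  fix e :: real assume e: "e > 0"
  note [measurable] = torus_L2D(1)[OF f]
  obtain s where s': "\<forall>i. simple_function torus (s i)" "\<forall>x\<in>space torus. (\<lambda>i. s i x) \<longlonglongrightarrow> f x"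
    "\<forall>i. \<forall>x\<in>space torus. dist (s i x) 0 \<le> 2 * dist (f x) 0"
    using borel_measurable_implies_sequence_metric[OF torus_L2D(1)[OF f], of 0] by (elim exE conjE) (rule that)
  have s: "simple_function torus (s i)" "x \<in> space torus \<Longrightarrow> (\<lambda>i. s i x) \<longlonglongrightarrow> f x"
    "x \<in> space torus \<Longrightarrow> norm (s i x) \<le> 2 * norm (f x)" for i x
    using s' by (simp_all add: dist_norm)
  have ms [measurable]: "s i \<in> borel_measurable torus" for i using s(1) by (rule borel_measurable_simple_function)
  have tl: "trig_limit (s i)" for i
  proof -
    let ?Y = "s i ` space torus"
    define h where "h = (\<lambda>x. \<Sum>y\<in>?Y. y * indicator (s i -` {y} \<inter> space torus) x)"
    have finY: "finite ?Y" using s(1)[of i] by (simp add: simple_function_def)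
    have tlh: "trig_limit h"
      unfolding h_def
    proof (intro trig_limit_sum finY trig_limit_scale trig_limit_indicator)
      show "s i -` {y} \<inter> space torus \<in> sets torus" if "y \<in> ?Y" for y
        using s(1)[of i] that by (simp add: simple_function_def)
    qed
    have eq: "s i x = h x" if "x \<in> Omega" for x
    proof -
      have "h x = (\<Sum>y\<in>?Y. if s i x = y then y else 0)"
        unfolding h_def using that by (intro sum.cong) (auto simp: space_torus indicator_def)
      also have "\<dots> = s i x" using finY that by (simp add: space_torus)
      finally show ?thesis by simp
    qed
    have "s i \<in> torus_L2 \<longleftrightarrow> h \<in> torus_L2"
      unfolding torus_L2_def mem_Collect_eq
      by (intro conj_cong measurable_cong Bochner_Integration.integrable_cong) (auto simp: eq space_torus)
    moreover have "L2_norm (\<lambda>x. s i x - p x) = L2_norm (\<lambda>x. h x - p x)" for p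
      unfolding L2_norm_def by (intro arg_cong[where f = sqrt] Bochner_Integration.integral_cong) (auto simp: eq space_torus)
    ultimately show ?thesis using tlh unfolding trig_limit_def by simp
  qed
  have "(\<lambda>i. \<integral>x. (norm (f x - s i x))\<^sup>2 \<partial>torus) \<longlonglongrightarrow> (\<integral>x. 0 \<partial>(torus :: (real^'a) measure))"
  proof (rule integral_dominated_convergence[where w = "\<lambda>x. 9 * (norm (f x))\<^sup>2"])
    show "integrable torus (\<lambda>x. 9 * (norm (f x))\<^sup>2)" using torus_L2D(2)[OF f] by simp
    show "AE x in torus. (\<lambda>i. (norm (f x - s i x))\<^sup>2) \<longlonglongrightarrow> 0"
    proof (rule AE_I2)
      fix x :: "real^'a" assume "x \<in> space torus"
      then have "(\<lambda>i. (norm (f x - s i x))\<^sup>2) \<longlonglongrightarrow> (norm (f x - f x))\<^sup>2"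
        using s(2) by (intro tendsto_intros) auto
      then show "(\<lambda>i. (norm (f x - s i x))\<^sup>2) \<longlonglongrightarrow> 0" by simp
    qed
    show "AE x in torus. norm ((norm (f x - s i x))\<^sup>2) \<le> 9 * (norm (f x))\<^sup>2" for i
    proof (rule AE_I2)
      fix x :: "real^'a" assume x: "x \<in> space torus"
      have "norm (f x - s i x) \<le> 3 * norm (f x)"
        using norm_triangle_ineq4[of "f x" "s i x"] s(3)[OF x, of i] by linarith
      then have "(norm (f x - s i x))\<^sup>2 \<le> (3 * norm (f x))\<^sup>2" by (intro power_mono) auto
      then show "norm ((norm (f x - s i x))\<^sup>2) \<le> 9 * (norm (f x))\<^sup>2" by (simp add: power_mult_distrib)
    qed
  qed auto
  then have "(\<lambda>i. (L2_norm (\<lambda>x. f x - s i x))\<^sup>2) \<longlonglongrightarrow> 0" by (simp add: L2_norm_sq)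
  then have "eventually (\<lambda>i. (L2_norm (\<lambda>x. f x - s i x))\<^sup>2 < e) sequentially"
    using e by (rule order_tendstoD)
  then obtain i where "(L2_norm (\<lambda>x. f x - s i x))\<^sup>2 < e" by (auto simp: eventually_sequentially)
  then show "\<exists>g. trig_limit g \<and> (L2_norm (\<lambda>x. f x - g x))\<^sup>2 < e" using tl by blast
qed

theorem Parseval:
  assumes v: "v \<in> torus_L2"
  shows "((\<lambda>k. (norm (fcoef v k))\<^sup>2) has_sum (L2_norm v)\<^sup>2) UNIV"
  unfolding has_sum_def
proof (rule tendstoI)
  fix e :: real assume e: "e > 0"
  obtain p where p: "p \<in> trig" "(L2_norm (\<lambda>x. v x - p x))\<^sup>2 < e"
    using trig_dense[OF v] e unfolding trig_limit_def by blast
  obtain F c where F: "finite F" "p = (\<lambda>x. \<Sum>k\<in>F. c k * phi k x)" using trig_expansion[OF p(1)] by blast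
  have F1: "(L2_norm v)\<^sup>2 - (\<Sum>k\<in>F. (norm (fcoef v k))\<^sup>2) < e"
    using p(2) L2_norm_minus_trig[OF v F(1), of c] sum_nonneg[of F "\<lambda>k. (norm (fcoef v k - c k))\<^sup>2"]
    unfolding F(2) by simp
  have bessel: "(\<Sum>k\<in>G. (norm (fcoef v k))\<^sup>2) \<le> (L2_norm v)\<^sup>2" if "finite G" for G
    using L2_norm_minus_trig[OF v that, of "fcoef v"] zero_le_power2[of "L2_norm (\<lambda>x. v x - (\<Sum>k\<in>G. fcoef v k * phi k x))"] by simp
  show "eventually (\<lambda>G. dist (\<Sum>k\<in>G. (norm (fcoef v k))\<^sup>2) ((L2_norm v)\<^sup>2) < e) (finite_subsets_at_top UNIV)"
    unfolding eventually_finite_subsets_at_top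
  proof (intro exI[of _ F] conjI F(1) allI impI; simp)
    fix G assume G: "finite G \<and> F \<subseteq> G"
    then have "(\<Sum>k\<in>F. (norm (fcoef v k))\<^sup>2) \<le> (\<Sum>k\<in>G. (norm (fcoef v k))\<^sup>2)"
      by (intro sum_mono2) auto
    then show "dist (\<Sum>k\<in>G. (norm (fcoef v k))\<^sup>2) ((L2_norm v)\<^sup>2) < e"
      using bessel[of G] G F1 by (simp add: dist_real_def)
  qed
qed

corollary fcoef_eq_imp_AE_eq:
  assumes "u \<in> torus_L2" "v \<in> torus_L2" "\<And>k. fcoef u k = fcoef v k"
  shows "AE x in torus. u x = v x"
proof -
  let ?w = "\<lambda>x. u x + (-1) * v x"
  have w: "?w \<in> torus_L2" by (rule torus_L2_add[OF assms(1) torus_L2_scale[OF assms(2)]])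
  have c: "fcoef ?w k = 0" for k
    using fcoef_add[OF assms(1) torus_L2_scale[OF assms(2)], of "-1" k] fcoef_scale[of "-1" v k] assms(3)[of k] by simp
  have "((\<lambda>k::int^'a. 0::real) has_sum (L2_norm ?w)\<^sup>2) UNIV" using Parseval[OF w] unfolding c by simp
  then have "(L2_norm ?w)\<^sup>2 = 0" by (rule has_sum_unique) simp
  then have "(\<integral>x. (norm (?w x))\<^sup>2 \<partial>torus) = 0" by (simp only: L2_norm_sq)
  then have "AE x in torus. (norm (?w x))\<^sup>2 = 0"
    using integral_nonneg_eq_0_iff_AE[OF torus_L2D(2)[OF w]] by simp
  then show ?thesis by eventually_elim simp
qed

section \<open>Weak derivatives and the Sobolev norm\<close>

lemma phi_has_derivative:
  "(phi k has_derivative (\<lambda>h. \<i> * of_real (rvec k \<bullet> h) * phi k x)) (at x)"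
proof -
  have "((\<lambda>x. \<i> * complex_of_real (rvec k \<bullet> x)) has_derivative (\<lambda>h. \<i> * of_real (rvec k \<bullet> h))) (at x)"
    by (auto intro!: derivative_eq_intros)
  from has_derivative_compose[OF this has_field_derivative_imp_has_derivative[OF DERIV_exp]]
  have "((\<lambda>x. exp (\<i> * complex_of_real (rvec k \<bullet> x))) has_derivative
      (\<lambda>h. exp (\<i> * of_real (rvec k \<bullet> x)) * (\<i> * of_real (rvec k \<bullet> h)))) (at x)" .
  from has_derivative_mult_right[OF this, of "complex_of_real ((2 * pi) powr (- real CARD('a) / 2))"]
  show ?thesis unfolding phi_def by (simp only: mult_ac)
qed

lemma phi_differentiable: "(\<lambda>x. c * phi k x) differentiable (at x)"
  using has_derivative_mult_right[OF phi_has_derivative] unfolding differentiable_def by blast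

lemma partial_phi: "frechet_derivative (\<lambda>x. c * phi k x) (at x) (axis i 1) = (c * (\<i> * of_int (k $ i))) * phi k x"
proof -
  have "((\<lambda>x. c * phi k x) has_derivative (\<lambda>h. c * (\<i> * of_real (rvec k \<bullet> h) * phi k x))) (at x)"
    by (intro has_derivative_mult_right phi_has_derivative)
  from frechet_derivative_at[OF this]
  have "frechet_derivative (\<lambda>x. c * phi k x) (at x) = (\<lambda>h. c * (\<i> * of_real (rvec k \<bullet> h) * phi k x))"
    by (rule sym)
  then show ?thesis by (simp add: inner_axis rvec_def)
qed

lemma Ck_phi: "Ck m (\<lambda>x. c * phi k x)"
proof (induction m arbitrary: c)
  case 0
  show ?case unfolding Ck.simps by (intro continuous_on_mult_left phi_continuous)
next
  case (Suc m)
  show ?case unfolding Ck.simps partial_phi using Suc phi_differentiable by blast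
qed

lemma L2p_iff: "v \<in> L2p \<longleftrightarrow> v \<in> borel_measurable borel \<and> periodic v \<and> v \<in> torus_L2"
  by (auto simp: L2p_def torus_L2_def integrable_torus_iff measurable_torusI)

lemma L2p_phi: "(\<lambda>x. c * phi k x) \<in> L2p"
  using phi_periodic[of k]
  by (auto simp: L2p_iff periodic_def intro!: torus_L2_scale torus_L2_phi borel_measurable_continuous_onI continuous_intros phi_continuous)

lemma L2p_add: "u \<in> L2p \<Longrightarrow> v \<in> L2p \<Longrightarrow> (\<lambda>x. u x + v x) \<in> L2p"
  by (auto simp: L2p_iff periodic_def torus_L2_add intro: borel_measurable_add)

lemma L2p_scale: "u \<in> L2p \<Longrightarrow> (\<lambda>x. c * u x) \<in> L2p"
  by (auto simp: L2p_iff periodic_def torus_L2_scale intro: borel_measurable_times)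

lemma Ck1D:
  assumes "Ck 1 \<psi>"
  shows "\<psi> differentiable (at x)" "continuous_on UNIV (\<lambda>x. frechet_derivative \<psi> (at x) (axis i 1))"
    "continuous_on UNIV \<psi>"
proof -
  show d: "\<psi> differentiable (at x)" for x using assms by simp
  show "continuous_on UNIV (\<lambda>x. frechet_derivative \<psi> (at x) (axis i 1))" using assms by simp
  show "continuous_on UNIV \<psi>"
    by (intro continuous_at_imp_continuous_on ballI differentiable_imp_continuous_within d)
qed

text \<open>Integration by parts: the derivative of the periodic product of \<open>phi k\<close> and the test function has
integral \<open>0\<close>.\<close>

lemma weak_partial_phi: "weak_partial i (phi k) (\<lambda>x. (\<i> * of_int (k $ i)) * phi k x)"
  unfolding weak_partial_def
proof (intro conjI allI impI)
  show "(\<lambda>x. (\<i> * of_int (k $ i)) * phi k x) \<in> L2p" by (rule L2p_phi)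
  fix \<psi> :: "real^'a \<Rightarrow> complex" assume \<psi>: "periodic \<psi> \<and> (\<forall>m. Ck m \<psi>)"
  then have "Ck 1 \<psi>" by blast
  note c = Ck1D[OF this]
  let ?F = "\<lambda>x. phi k x * \<psi> x"
  let ?D = "\<lambda>x. phi k x * frechet_derivative \<psi> (at x) (axis i 1)"
  let ?E = "\<lambda>x. (\<i> * of_int (k $ i)) * phi k x * \<psi> x"
  have "(?F has_derivative (\<lambda>h. phi k x * frechet_derivative \<psi> (at x) h + \<i> * of_real (rvec k \<bullet> h) * phi k x * \<psi> x)) (at x)" for x
    by (intro has_derivative_mult phi_has_derivative) (use c(1) frechet_derivative_works in blast)
  then have "?F differentiable (at x)"
    and "frechet_derivative ?F (at x) = (\<lambda>h. phi k x * frechet_derivative \<psi> (at x) h + \<i> * of_real (rvec k \<bullet> h) * phi k x * \<psi> x)" for x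
    by (auto simp: differentiable_def dest: frechet_derivative_at[symmetric])
  then have F: "?F differentiable (at x)" "frechet_derivative ?F (at x) (axis i 1) = ?D x + ?E x" for x
    by (simp_all add: inner_axis rvec_def)
  have contD: "continuous_on UNIV ?D" by (intro continuous_on_mult phi_continuous c(2))
  have contE: "continuous_on UNIV ?E" by (intro continuous_on_mult phi_continuous c(3) continuous_on_const)
  have "(\<integral>x. frechet_derivative ?F (at x) (axis i 1) \<partial>torus) = 0"
  proof (rule torus_integral_partial_derivative)
    show "periodic ?F" using \<psi> phi_periodic by (intro periodic_mult) auto
    show "continuous_on UNIV (\<lambda>x. frechet_derivative ?F (at x) (axis i 1))"
      unfolding F(2) by (intro continuous_on_add contD contE)
  qed (rule F(1))
  then have "(\<integral>x. ?D x \<partial>torus) + (\<integral>x. ?E x \<partial>torus) = 0"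
    unfolding F(2)
    by (subst (asm) Bochner_Integration.integral_add[OF integrable_torus_continuous[OF contD] integrable_torus_continuous[OF contE]])
  then show "(LINT x:Omega|lborel. ?D x) = - (LINT x:Omega|lborel. ?E x)"
    unfolding integral_torus by (simp only: add_eq_0_iff2)
qed

text \<open>The conjugate of \<open>phi k\<close> is \<open>phi (- k)\<close>, an admissible test function.\<close>

lemma fcoef_weak_partial:
  assumes "weak_partial i v g"
  shows "fcoef g k = \<i> * of_int (k $ i) * fcoef v k"
proof -
  let ?\<psi> = "\<lambda>x. 1 * phi (- k) x"
  have "periodic ?\<psi> \<and> (\<forall>m. Ck m ?\<psi>)" using phi_periodic[of "- k"] Ck_phi[of _ 1 "- k"] by auto
  then have "(LINT x:Omega|lborel. v x * frechet_derivative ?\<psi> (at x) (axis i 1))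
      = - (LINT x:Omega|lborel. g x * ?\<psi> x)"
    using assms unfolding weak_partial_def by blast
  moreover have "(LINT x:Omega|lborel. v x * frechet_derivative ?\<psi> (at x) (axis i 1))
      = (LINT x:Omega|lborel. (- \<i> * of_int (k $ i)) * (v x * phi (- k) x))"
    unfolding partial_phi by (simp add: mult_ac)
  moreover have "\<dots> = (- \<i> * of_int (k $ i)) * (LINT x:Omega|lborel. v x * phi (- k) x)"
    unfolding integral_torus by (rule integral_mult_right_zero)
  ultimately show ?thesis unfolding fcoef_def cnj_phi by simp
qed

lemma torus_L2_cnj: "f \<in> torus_L2 \<Longrightarrow> (\<lambda>x. cnj (f x)) \<in> torus_L2"
  by (simp add: torus_L2_def borel_measurable_cnj)

lemma torus_L2_mult_integrable: assumes "f \<in> torus_L2" "g \<in> torus_L2" shows "integrable torus (\<lambda>x. f x * g x)"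
  using torus_L2_prod_integrable[OF assms(1) torus_L2_cnj[OF assms(2)]] by simp

lemma weak_partial_lincomb:
  assumes u: "u \<in> L2p" "weak_partial i u g" and v: "v \<in> L2p" "weak_partial i v h"
  shows "weak_partial i (\<lambda>x. a * u x + b * v x) (\<lambda>x. a * g x + b * h x)"
  unfolding weak_partial_def
proof (intro conjI allI impI)
  have gh: "g \<in> L2p" "h \<in> L2p" using u v by (auto simp: weak_partial_def)
  show "(\<lambda>x. a * g x + b * h x) \<in> L2p" by (rule L2p_add[OF L2p_scale[OF gh(1)] L2p_scale[OF gh(2)]])
  fix \<psi> :: "real^'a \<Rightarrow> complex" assume \<psi>: "periodic \<psi> \<and> (\<forall>m. Ck m \<psi>)"
  then have "Ck 1 \<psi>" by blast
  note c = Ck1D[OF this]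
  let ?D = "\<lambda>x. frechet_derivative \<psi> (at x) (axis i 1)"
  have lin: "(\<integral>x. (a * p x + b * q x) * r x \<partial>torus) = a * (\<integral>x. p x * r x \<partial>torus) + b * (\<integral>x. q x * r x \<partial>torus)"
    if "p \<in> L2p" "q \<in> L2p" "continuous_on UNIV r" for p q r
  proof -
    have "integrable torus (\<lambda>x. p x * r x)" "integrable torus (\<lambda>x. q x * r x)"
      by (rule torus_L2_mult_integrable[OF L2p_subset torus_L2_continuous], fact that, fact that)+
    then show ?thesis by (simp add: ring_distribs mult.assoc)
  qed
  show "(LINT x:Omega|lborel. (a * u x + b * v x) * ?D x) = - (LINT x:Omega|lborel. (a * g x + b * h x) * \<psi> x)"
    using u(2) v(2) \<psi>
    unfolding weak_partial_def integral_torus lin[OF u(1) v(1) c(2)] lin[OF gh c(3)] by simp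
qed

lemma H1p_L2p: "v \<in> H1p \<Longrightarrow> v \<in> L2p" by (simp add: H1p_def)

lemma H1p_torus_L2: "v \<in> H1p \<Longrightarrow> v \<in> torus_L2" by (intro L2p_subset H1p_L2p)

lemma wderiv_weak_partial: "v \<in> H1p \<Longrightarrow> weak_partial i v (wderiv i v)"
proof -
  assume "v \<in> H1p"
  then have "\<exists>g. weak_partial i v g" by (simp add: H1p_def)
  then show ?thesis unfolding wderiv_def by (rule someI_ex)
qed

lemma wderiv_torus_L2: "v \<in> H1p \<Longrightarrow> wderiv i v \<in> torus_L2"
  using wderiv_weak_partial[of v i] by (simp add: weak_partial_def L2p_subset)

lemma fcoef_wderiv: "v \<in> H1p \<Longrightarrow> fcoef (wderiv i v) k = \<i> * of_int (k $ i) * fcoef v k"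
  by (intro fcoef_weak_partial wderiv_weak_partial)

lemma H1p_lincomb:
  assumes "u \<in> H1p" "v \<in> H1p" shows "(\<lambda>x. a * u x + b * v x) \<in> H1p"
proof -
  have "(\<lambda>x. a * u x + b * v x) \<in> L2p"
    using assms by (intro L2p_add[OF L2p_scale L2p_scale] H1p_L2p)
  moreover have "weak_partial i (\<lambda>x. a * u x + b * v x) (\<lambda>x. a * wderiv i u x + b * wderiv i v x)" for i
    using assms by (intro weak_partial_lincomb H1p_L2p wderiv_weak_partial)
  ultimately show ?thesis unfolding H1p_def by blast
qed

lemma H1p_add: "u \<in> H1p \<Longrightarrow> v \<in> H1p \<Longrightarrow> (\<lambda>x. u x + v x) \<in> H1p"
  using H1p_lincomb[of u v 1 1] by simp

lemma H1p_diff: "u \<in> H1p \<Longrightarrow> v \<in> H1p \<Longrightarrow> (\<lambda>x. u x - v x) \<in> H1p"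
  using H1p_lincomb[of u v 1 "-1"] by simp

lemma H1p_scale: "u \<in> H1p \<Longrightarrow> (\<lambda>x. c * u x) \<in> H1p"
  using H1p_lincomb[of u u c 0] by simp

lemma H1p_phi: "phi k \<in> H1p"
  using L2p_phi[of 1 k] weak_partial_phi[of _ k] by (auto simp: H1p_def)

lemma H1p_sum: "finite F \<Longrightarrow> (\<And>k. k \<in> F \<Longrightarrow> u k \<in> H1p) \<Longrightarrow> (\<lambda>x. \<Sum>k\<in>F. u k x) \<in> H1p"
proof (induction F rule: finite_induct)
  case empty
  show ?case using H1p_scale[OF H1p_phi, of 0] by simp
next
  case (insert k F)
  have "u k \<in> H1p" by (rule insert.prems) simp
  moreover have "(\<lambda>x. \<Sum>k\<in>F. u k x) \<in> H1p" by (rule insert.IH, rule insert.prems) simp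
  ultimately have "(\<lambda>x. u k x + (\<Sum>k\<in>F. u k x)) \<in> H1p" by (rule H1p_add)
  then show ?case by (simp only: sum.insert[OF insert.hyps])
qed

lemma H1p_trig: "finite F \<Longrightarrow> (\<lambda>x. \<Sum>k\<in>F. c k * phi k x) \<in> H1p"
  by (rule H1p_sum) (auto intro: H1p_scale H1p_phi)

text \<open>Since \<open>wderiv\<close> is an arbitrary choice among almost everywhere equal functions, linearity can only hold
almost everywhere. Both sides have the same Fourier coefficients.\<close>

lemma wderiv_lincomb_AE:
  assumes "u \<in> H1p" "v \<in> H1p"
  shows "AE x in torus. wderiv i (\<lambda>x. a * u x + b * v x) x = a * wderiv i u x + b * wderiv i v x"
proof (rule fcoef_eq_imp_AE_eq)
  note uv = H1p_lincomb[OF assms, of a b]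
  note D = wderiv_torus_L2[OF assms(1), of i] wderiv_torus_L2[OF assms(2), of i]
  show "wderiv i (\<lambda>x. a * u x + b * v x) \<in> torus_L2" by (rule wderiv_torus_L2[OF uv])
  show "(\<lambda>x. a * wderiv i u x + b * wderiv i v x) \<in> torus_L2" by (rule torus_L2_add[OF torus_L2_scale[OF D(1)] torus_L2_scale[OF D(2)]])
  fix k
  have "fcoef (\<lambda>x. a * u x + b * v x) k = a * fcoef u k + b * fcoef v k"
    by (simp only: fcoef_add[OF torus_L2_scale[OF H1p_torus_L2[OF assms(1)]] torus_L2_scale[OF H1p_torus_L2[OF assms(2)]]] fcoef_scale)
  moreover have "fcoef (\<lambda>x. a * wderiv i u x + b * wderiv i v x) k = a * fcoef (wderiv i u) k + b * fcoef (wderiv i v) k"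
    by (simp only: fcoef_add[OF torus_L2_scale[OF D(1)] torus_L2_scale[OF D(2)]] fcoef_scale)
  ultimately show "fcoef (wderiv i (\<lambda>x. a * u x + b * v x)) k = fcoef (\<lambda>x. a * wderiv i u x + b * wderiv i v x) k"
    by (simp only: fcoef_wderiv[OF uv] fcoef_wderiv[OF assms(1)] fcoef_wderiv[OF assms(2)]) (simp add: algebra_simps)
qed

definition sobolev_sq :: "int^'d \<Rightarrow> real" where "sobolev_sq k = 1 + (norm (rvec k))\<^sup>2"

lemma sobolev_sq_ge_1: "sobolev_sq k \<ge> 1" by (simp add: sobolev_sq_def)

lemma sobolev_sq_pos: "sobolev_sq k > 0" using sobolev_sq_ge_1[of k] by linarith

text \<open>Parseval's identity for \<open>v\<close> and for its weak derivatives, added up.\<close>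

lemma H1_has_sum:
  assumes v: "v \<in> H1p"
  shows "((\<lambda>k. sobolev_sq k * (norm (fcoef v k))\<^sup>2) has_sum (L2_norm v)\<^sup>2 + (\<Sum>i\<in>UNIV. (L2_norm (wderiv i v))\<^sup>2)) UNIV"
proof -
  have D: "((\<lambda>k. (real_of_int (k $ i))\<^sup>2 * (norm (fcoef v k))\<^sup>2) has_sum (L2_norm (wderiv i v))\<^sup>2) UNIV" for i
    using Parseval[OF wderiv_torus_L2[OF v, of i]]
    by (simp add: fcoef_wderiv[OF v] norm_mult power_mult_distrib)
  have "((\<lambda>k. \<Sum>i\<in>UNIV. (real_of_int (k $ i))\<^sup>2 * (norm (fcoef v k))\<^sup>2) has_sum (\<Sum>i\<in>UNIV. (L2_norm (wderiv i v))\<^sup>2)) UNIV"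
  proof -
    have "((\<lambda>F. \<Sum>i\<in>UNIV. \<Sum>k\<in>F. (real_of_int (k $ i))\<^sup>2 * (norm (fcoef v k))\<^sup>2) \<longlongrightarrow>
        (\<Sum>i\<in>UNIV. (L2_norm (wderiv i v))\<^sup>2)) (finite_subsets_at_top UNIV)"
      by (intro tendsto_sum D[unfolded has_sum_def])
    moreover have "(\<lambda>F. \<Sum>i\<in>UNIV. \<Sum>k\<in>F. (real_of_int (k $ i))\<^sup>2 * (norm (fcoef v k))\<^sup>2)
        = (\<lambda>F. \<Sum>k\<in>F. \<Sum>i\<in>UNIV. (real_of_int (k $ i))\<^sup>2 * (norm (fcoef v k))\<^sup>2)"
      by (rule ext) (rule sum.swap)
    ultimately show ?thesis unfolding has_sum_def by (simp only:)
  qed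
  from has_sum_add[OF Parseval[OF H1p_torus_L2[OF v]] this]
  have "((\<lambda>k. (norm (fcoef v k))\<^sup>2 + (\<Sum>i\<in>UNIV. (real_of_int (k $ i))\<^sup>2 * (norm (fcoef v k))\<^sup>2)) has_sum
      (L2_norm v)\<^sup>2 + (\<Sum>i\<in>UNIV. (L2_norm (wderiv i v))\<^sup>2)) UNIV" .
  moreover have "(norm (fcoef v k))\<^sup>2 + (\<Sum>i\<in>UNIV. (real_of_int (k $ i))\<^sup>2 * (norm (fcoef v k))\<^sup>2)
      = sobolev_sq k * (norm (fcoef v k))\<^sup>2" for k
  proof -
    have "(norm (rvec k))\<^sup>2 = (\<Sum>i\<in>UNIV. (real_of_int (k $ i))\<^sup>2)"
      by (simp add: norm_vec_def L2_set_def rvec_def sum_nonneg)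
    then show ?thesis by (simp add: sobolev_sq_def ring_distribs sum_distrib_right)
  qed
  ultimately show ?thesis by simp
qed

lemma H1_norm_sq:
  assumes v: "v \<in> H1p"
  shows "(H1_norm v)\<^sup>2 = (L2_norm v)\<^sup>2 + (\<Sum>i\<in>UNIV. (L2_norm (wderiv i v))\<^sup>2)"
  using infsumI[OF H1_has_sum[OF v]] by (simp add: H1_norm_def sobolev_sq_def sum_nonneg)

lemma H1_norm_nonneg: "H1_norm v \<ge> 0"
  unfolding H1_norm_def by (intro real_sqrt_ge_zero infsum_nonneg) auto

lemma H1_norm_has_sum:
  assumes v: "v \<in> H1p"
  shows "((\<lambda>k. sobolev_sq k * (norm (fcoef v k))\<^sup>2) has_sum (H1_norm v)\<^sup>2) UNIV"
  using H1_has_sum[OF v] by (simp only: H1_norm_sq[OF v])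

lemma L2_norm_le_H1_norm:
  assumes v: "v \<in> H1p"
  shows "L2_norm v \<le> H1_norm v" "L2_norm (wderiv i v) \<le> H1_norm v"
proof -
  have "(L2_norm v)\<^sup>2 \<le> (H1_norm v)\<^sup>2" unfolding H1_norm_sq[OF v] by (simp add: sum_nonneg)
  then show "L2_norm v \<le> H1_norm v" by (rule power2_le_imp_le) (rule H1_norm_nonneg)
  have "(L2_norm (wderiv i v))\<^sup>2 \<le> (\<Sum>i\<in>UNIV. (L2_norm (wderiv i v))\<^sup>2)" by (rule member_le_sum) auto
  then have "(L2_norm (wderiv i v))\<^sup>2 \<le> (H1_norm v)\<^sup>2" unfolding H1_norm_sq[OF v] by (simp add: add_increasing)
  then show "L2_norm (wderiv i v) \<le> H1_norm v" by (rule power2_le_imp_le) (rule H1_norm_nonneg)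
qed

section \<open>The elliptic form\<close>

definition weighted_inner :: "(real^'d \<Rightarrow> real) \<Rightarrow> (real^'d \<Rightarrow> complex) \<Rightarrow> (real^'d \<Rightarrow> complex) \<Rightarrow> complex" where
  "weighted_inner \<kappa> f g = (\<integral>x. complex_of_real (\<kappa> x) * f x * cnj (g x) \<partial>torus)"

lemma admissible_coeffD:
  assumes "admissible_coeff \<kappa>"
  obtains lo hi where "0 < lo" "0 < hi" "\<And>x. lo \<le> \<kappa> x" "\<And>x. \<kappa> x \<le> hi"
    "(\<lambda>x. complex_of_real (\<kappa> x)) \<in> borel_measurable torus" "\<And>x. norm (complex_of_real (\<kappa> x)) \<le> hi"
proof -
  obtain lo hi where *: "0 < lo" "0 < hi" "\<forall>x. lo \<le> \<kappa> x \<and> \<kappa> x \<le> hi"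
    using assms unfolding admissible_coeff_def by blast
  have "Ck 1 \<kappa>" using assms by (simp add: admissible_coeff_def)
  then have "\<kappa> differentiable (at x)" for x by simp
  then have "continuous_on UNIV \<kappa>"
    by (intro continuous_at_imp_continuous_on ballI differentiable_imp_continuous_within)
  then have "(\<lambda>x. complex_of_real (\<kappa> x)) \<in> borel_measurable torus"
    by (intro measurable_torusI borel_measurable_continuous_onI continuous_on_of_real)
  moreover have "norm (complex_of_real (\<kappa> x)) \<le> hi" for x
  proof -
    have "0 \<le> \<kappa> x" using * by (meson less_imp_le order_trans)
    then show ?thesis using * by simp
  qed
  ultimately show thesis using * that by blast
qed

lemma weighted_inner_integrable:
  assumes "admissible_coeff \<kappa>" "f \<in> torus_L2" "g \<in> torus_L2"
  shows "integrable torus (\<lambda>x. complex_of_real (\<kappa> x) * f x * cnj (g x))"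
proof (rule admissible_coeffD[OF assms(1)])
  fix lo hi
  assume "(\<lambda>x. complex_of_real (\<kappa> x)) \<in> borel_measurable torus" "\<And>x. norm (complex_of_real (\<kappa> x)) \<le> hi"
  then show ?thesis by (intro torus_L2_prod_integrable torus_L2_mult_bounded assms)
qed

lemma weighted_inner_lincomb_left:
  assumes "admissible_coeff \<kappa>" "f \<in> torus_L2" "g \<in> torus_L2" "h \<in> torus_L2"
  shows "weighted_inner \<kappa> (\<lambda>x. a * f x + b * g x) h = a * weighted_inner \<kappa> f h + b * weighted_inner \<kappa> g h"
proof -
  have "weighted_inner \<kappa> (\<lambda>x. a * f x + b * g x) h
      = (\<integral>x. a * (complex_of_real (\<kappa> x) * f x * cnj (h x)) + b * (complex_of_real (\<kappa> x) * g x * cnj (h x)) \<partial>torus)"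
    unfolding weighted_inner_def by (intro Bochner_Integration.integral_cong refl) (simp add: algebra_simps)
  also have "\<dots> = a * weighted_inner \<kappa> f h + b * weighted_inner \<kappa> g h"
    unfolding weighted_inner_def using weighted_inner_integrable[OF assms(1,2,4)] weighted_inner_integrable[OF assms(1,3,4)] by simp
  finally show ?thesis .
qed

lemma weighted_inner_cnj: "cnj (weighted_inner \<kappa> f g) = weighted_inner \<kappa> g f"
proof -
  have "cnj (weighted_inner \<kappa> f g) = (\<integral>x. cnj (complex_of_real (\<kappa> x) * f x * cnj (g x)) \<partial>torus)"
    unfolding weighted_inner_def by (rule Bochner_Integration.integral_cnj[symmetric])
  also have "\<dots> = weighted_inner \<kappa> g f"
    unfolding weighted_inner_def by (intro Bochner_Integration.integral_cong refl) (simp add: mult_ac)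
  finally show ?thesis .
qed

lemma weighted_inner_cong_AE:
  assumes "admissible_coeff \<kappa>" "f \<in> torus_L2" "f' \<in> torus_L2" "h \<in> torus_L2" "AE x in torus. f x = f' x"
  shows "weighted_inner \<kappa> f h = weighted_inner \<kappa> f' h"
  unfolding weighted_inner_def
proof (rule integral_cong_AE)
  show "AE x in torus. complex_of_real (\<kappa> x) * f x * cnj (h x) = complex_of_real (\<kappa> x) * f' x * cnj (h x)"
    using assms(5) by eventually_elim simp
qed (use weighted_inner_integrable[OF assms(1,2,4)] weighted_inner_integrable[OF assms(1,3,4)] in \<open>auto intro: borel_measurable_integrable\<close>)

lemma weighted_inner_bound:
  assumes "admissible_coeff \<kappa>"
  shows "\<exists>C>0. \<forall>f\<in>torus_L2. \<forall>g\<in>torus_L2. norm (weighted_inner \<kappa> f g) \<le> C * (L2_norm f * L2_norm g)"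
proof (rule admissible_coeffD[OF assms])
  fix lo hi
  assume "0 < hi" "(\<lambda>x. complex_of_real (\<kappa> x)) \<in> borel_measurable torus" "\<And>x. norm (complex_of_real (\<kappa> x)) \<le> hi"
  then show ?thesis unfolding weighted_inner_def by (intro exI[of _ hi] conjI ballI weighted_inner_product_bound)
qed

lemma weighted_inner_coercive:
  assumes "admissible_coeff \<kappa>"
  shows "\<exists>c>0. \<forall>f\<in>torus_L2. c * (L2_norm f)\<^sup>2 \<le> Re (weighted_inner \<kappa> f f)"
proof (rule admissible_coeffD[OF assms])
  fix lo hi
  assume lo: "0 < lo" "\<And>x. lo \<le> \<kappa> x"
  have "lo * (L2_norm f)\<^sup>2 \<le> Re (weighted_inner \<kappa> f f)" if f: "f \<in> torus_L2" for f
  proof -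
    have eq: "complex_of_real (\<kappa> x) * f x * cnj (f x) = complex_of_real (\<kappa> x * (norm (f x))\<^sup>2)" for x
      by (simp only: mult.assoc of_real_mult complex_norm_square)
    have int: "integrable torus (\<lambda>x. \<kappa> x * (norm (f x))\<^sup>2)"
      using weighted_inner_integrable[OF assms f f] unfolding eq by (simp only: complex_of_real_integrable_eq)
    have "lo * (L2_norm f)\<^sup>2 = (\<integral>x. lo * (norm (f x))\<^sup>2 \<partial>torus)" by (simp add: L2_norm_sq)
    also have "\<dots> \<le> (\<integral>x. \<kappa> x * (norm (f x))\<^sup>2 \<partial>torus)"
      using torus_L2D(2)[OF f] lo by (intro integral_mono int mult_right_mono) auto
    also have "\<dots> = Re (weighted_inner \<kappa> f f)" unfolding weighted_inner_def eq by (simp only: integral_complex_of_real Re_complex_of_real)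
    finally show ?thesis .
  qed
  then show ?thesis using lo(1) by blast
qed

lemma aform_eq:
  assumes "admissible_coeff \<nu>" "u \<in> H1p" "v \<in> H1p"
  shows "aform \<nu> \<sigma> u v = (\<Sum>i\<in>UNIV. weighted_inner \<nu> (wderiv i u) (wderiv i v)) + weighted_inner \<sigma> u v"
proof -
  have "(\<integral>x. complex_of_real (\<nu> x) * (\<Sum>i\<in>UNIV. wderiv i u x * cnj (wderiv i v x)) \<partial>torus)
      = (\<integral>x. (\<Sum>i\<in>UNIV. complex_of_real (\<nu> x) * wderiv i u x * cnj (wderiv i v x)) \<partial>torus)"
    by (intro Bochner_Integration.integral_cong refl) (simp add: sum_distrib_left mult.assoc)
  also have "\<dots> = (\<Sum>i\<in>UNIV. weighted_inner \<nu> (wderiv i u) (wderiv i v))"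
    unfolding weighted_inner_def using assms by (intro Bochner_Integration.integral_sum weighted_inner_integrable wderiv_torus_L2)
  finally show ?thesis unfolding aform_def integral_torus weighted_inner_def by simp
qed

lemma aform_lincomb_left:
  assumes k: "admissible_coeff \<nu>" "admissible_coeff \<sigma>" and H: "u \<in> H1p" "v \<in> H1p" "w \<in> H1p"
  shows "aform \<nu> \<sigma> (\<lambda>x. a * u x + b * v x) w = a * aform \<nu> \<sigma> u w + b * aform \<nu> \<sigma> v w"
proof -
  have "weighted_inner \<nu> (wderiv i (\<lambda>x. a * u x + b * v x)) (wderiv i w)
      = a * weighted_inner \<nu> (wderiv i u) (wderiv i w) + b * weighted_inner \<nu> (wderiv i v) (wderiv i w)" for i
  proof -
    note D = wderiv_torus_L2[OF H(1), of i] wderiv_torus_L2[OF H(2), of i] wderiv_torus_L2[OF H(3), of i]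
    have "weighted_inner \<nu> (wderiv i (\<lambda>x. a * u x + b * v x)) (wderiv i w)
        = weighted_inner \<nu> (\<lambda>x. a * wderiv i u x + b * wderiv i v x) (wderiv i w)"
      by (rule weighted_inner_cong_AE[OF k(1) wderiv_torus_L2[OF H1p_lincomb[OF H(1,2)]]
            torus_L2_add[OF torus_L2_scale[OF D(1)] torus_L2_scale[OF D(2)]] D(3) wderiv_lincomb_AE[OF H(1,2)]])
    then show ?thesis by (simp only: weighted_inner_lincomb_left[OF k(1) D])
  qed
  moreover have "weighted_inner \<sigma> (\<lambda>x. a * u x + b * v x) w = a * weighted_inner \<sigma> u w + b * weighted_inner \<sigma> v w"
    by (intro weighted_inner_lincomb_left k H1p_torus_L2 H)
  ultimately show ?thesis
    unfolding aform_eq[OF k(1) H1p_lincomb[OF H(1,2)] H(3)] aform_eq[OF k(1) H(1) H(3)] aform_eq[OF k(1) H(2) H(3)]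
    by (simp add: sum.distrib sum_distrib_left algebra_simps)
qed

lemma aform_cnj:
  assumes "admissible_coeff \<nu>" "u \<in> H1p" "v \<in> H1p"
  shows "cnj (aform \<nu> \<sigma> u v) = aform \<nu> \<sigma> v u"
  by (simp only: aform_eq[OF assms] aform_eq[OF assms(1,3,2)] complex_cnj_add cnj_sum weighted_inner_cnj)

lemma aform_add_right:
  assumes k: "admissible_coeff \<nu>" "admissible_coeff \<sigma>" and H: "u \<in> H1p" "v \<in> H1p" "w \<in> H1p"
  shows "aform \<nu> \<sigma> w (\<lambda>x. u x + v x) = aform \<nu> \<sigma> w u + aform \<nu> \<sigma> w v"
proof -
  have "cnj (aform \<nu> \<sigma> (\<lambda>x. 1 * u x + 1 * v x) w) = cnj (1 * aform \<nu> \<sigma> u w + 1 * aform \<nu> \<sigma> v w)"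
    by (simp only: aform_lincomb_left[OF k H])
  then show ?thesis
    by (simp only: mult_1 complex_cnj_add aform_cnj[OF k(1) H(1,3)] aform_cnj[OF k(1) H(2,3)]
          aform_cnj[OF k(1) H1p_add[OF H(1,2)] H(3)])
qed

lemma aform_scale_right:
  assumes k: "admissible_coeff \<nu>" "admissible_coeff \<sigma>" and H: "u \<in> H1p" "w \<in> H1p"
  shows "aform \<nu> \<sigma> w (\<lambda>x. c * u x) = cnj c * aform \<nu> \<sigma> w u"
proof -
  have "aform \<nu> \<sigma> (\<lambda>x. c * u x) w = c * aform \<nu> \<sigma> u w"
    using aform_lincomb_left[OF k H(1) H(1) H(2), of c 0] by simp
  then have "cnj (aform \<nu> \<sigma> (\<lambda>x. c * u x) w) = cnj c * cnj (aform \<nu> \<sigma> u w)" by simp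
  then show ?thesis
    by (simp only: aform_cnj[OF k(1) H] aform_cnj[OF k(1) H1p_scale[OF H(1)] H(2)])
qed

text \<open>By the Cauchy-Schwarz inequality each of the \<open>d + 1\<close> terms of the form is at most a multiple of the product
of the norms.\<close>

lemma aform_bound:
  assumes k: "admissible_coeff \<nu>" "admissible_coeff \<sigma>"
  shows "\<exists>C>0. \<forall>u\<in>H1p. \<forall>v\<in>H1p. norm (aform \<nu> \<sigma> u v) \<le> C * (H1_norm u * H1_norm v)"
proof -
  obtain C1 C2 where C: "C1 > 0" "\<forall>f\<in>torus_L2. \<forall>g\<in>torus_L2. norm (weighted_inner \<nu> f g) \<le> C1 * (L2_norm f * L2_norm g)"
      "C2 > 0" "\<forall>f\<in>torus_L2. \<forall>g\<in>torus_L2. norm (weighted_inner \<sigma> f g) \<le> C2 * (L2_norm f * L2_norm g)"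
    using weighted_inner_bound[OF k(1)] weighted_inner_bound[OF k(2)] by blast
  have "norm (aform \<nu> \<sigma> u v) \<le> (real CARD('a) * C1 + C2) * (H1_norm u * H1_norm v)"
    if u: "u \<in> H1p" and v: "v \<in> H1p" for u v
  proof -
    let ?H = "H1_norm u * H1_norm v"
    have 1: "norm (weighted_inner \<nu> (wderiv i u) (wderiv i v)) \<le> C1 * ?H" for i
    proof -
      have "norm (weighted_inner \<nu> (wderiv i u) (wderiv i v)) \<le> C1 * (L2_norm (wderiv i u) * L2_norm (wderiv i v))"
        using C(2) wderiv_torus_L2[OF u] wderiv_torus_L2[OF v] by blast
      also have "\<dots> \<le> C1 * ?H"
        using C(1) by (intro mult_left_mono mult_mono L2_norm_le_H1_norm u v L2_norm_nonneg H1_norm_nonneg) auto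
      finally show ?thesis .
    qed
    have 2: "norm (weighted_inner \<sigma> u v) \<le> C2 * ?H"
    proof -
      have "norm (weighted_inner \<sigma> u v) \<le> C2 * (L2_norm u * L2_norm v)"
        using C(4) H1p_torus_L2[OF u] H1p_torus_L2[OF v] by blast
      also have "\<dots> \<le> C2 * ?H"
        using C(3) by (intro mult_left_mono mult_mono L2_norm_le_H1_norm u v L2_norm_nonneg H1_norm_nonneg) auto
      finally show ?thesis .
    qed
    have "norm (\<Sum>i\<in>UNIV. weighted_inner \<nu> (wderiv i u) (wderiv i v)) \<le> (\<Sum>i\<in>(UNIV :: 'a set). C1 * ?H)"
      by (intro order_trans[OF norm_sum] sum_mono 1)
    then have "norm (aform \<nu> \<sigma> u v) \<le> real CARD('a) * (C1 * ?H) + C2 * ?H"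
      unfolding aform_eq[OF k(1) u v] using 2 by (intro order_trans[OF norm_triangle_ineq] add_mono) auto
    then show ?thesis by (simp add: algebra_simps)
  qed
  moreover have "real CARD('a) * C1 + C2 > 0" using C by (intro add_nonneg_pos) auto
  ultimately show ?thesis by blast
qed

lemma aform_coercive:
  assumes k: "admissible_coeff \<nu>" "admissible_coeff \<sigma>"
  shows "\<exists>c>0. \<forall>u\<in>H1p. c * (H1_norm u)\<^sup>2 \<le> Re (aform \<nu> \<sigma> u u)"
proof -
  obtain c1 c2 where c: "c1 > 0" "\<forall>f\<in>torus_L2. c1 * (L2_norm f)\<^sup>2 \<le> Re (weighted_inner \<nu> f f)"
      "c2 > 0" "\<forall>f\<in>torus_L2. c2 * (L2_norm f)\<^sup>2 \<le> Re (weighted_inner \<sigma> f f)"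
    using weighted_inner_coercive[OF k(1)] weighted_inner_coercive[OF k(2)] by blast
  let ?c = "min c1 c2"
  have "?c * (H1_norm u)\<^sup>2 \<le> Re (aform \<nu> \<sigma> u u)" if u: "u \<in> H1p" for u
  proof -
    have 1: "?c * (L2_norm (wderiv i u))\<^sup>2 \<le> Re (weighted_inner \<nu> (wderiv i u) (wderiv i u))" for i
    proof -
      have "?c * (L2_norm (wderiv i u))\<^sup>2 \<le> c1 * (L2_norm (wderiv i u))\<^sup>2" by (intro mult_right_mono) auto
      also have "\<dots> \<le> Re (weighted_inner \<nu> (wderiv i u) (wderiv i u))" using c(2) wderiv_torus_L2[OF u] by blast
      finally show ?thesis .
    qed
    have "?c * (L2_norm u)\<^sup>2 \<le> c2 * (L2_norm u)\<^sup>2" by (intro mult_right_mono) auto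
    also have "\<dots> \<le> Re (weighted_inner \<sigma> u u)" using c(4) H1p_torus_L2[OF u] by blast
    finally have 2: "?c * (L2_norm u)\<^sup>2 \<le> Re (weighted_inner \<sigma> u u)" .
    have "(\<Sum>i\<in>UNIV. ?c * (L2_norm (wderiv i u))\<^sup>2) \<le> (\<Sum>i\<in>UNIV. Re (weighted_inner \<nu> (wderiv i u) (wderiv i u)))"
      by (intro sum_mono 1)
    then show ?thesis
      unfolding aform_eq[OF k(1) u u] H1_norm_sq[OF u] using 2
      by (simp add: ring_distribs sum_distrib_left)
  qed
  moreover have "?c > 0" using c by simp
  ultimately show ?thesis by blast
qed

lemma aform_trig_left:
  assumes k: "admissible_coeff \<nu>" "admissible_coeff \<sigma>" and F: "finite F" and v: "v \<in> H1p"
  shows "aform \<nu> \<sigma> (\<lambda>x. \<Sum>k\<in>F. c k * phi k x) v = (\<Sum>k\<in>F. c k * aform \<nu> \<sigma> (phi k) v)"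
  using F
proof (induction F rule: finite_induct)
  case empty
  show ?case using aform_lincomb_left[OF k v v v, of 0 0] by simp
next
  case (insert l F)
  have "aform \<nu> \<sigma> (\<lambda>x. c l * phi l x + 1 * (\<Sum>k\<in>F. c k * phi k x)) v
      = c l * aform \<nu> \<sigma> (phi l) v + 1 * aform \<nu> \<sigma> (\<lambda>x. \<Sum>k\<in>F. c k * phi k x) v"
    by (intro aform_lincomb_left k H1p_phi H1p_trig insert.hyps v)
  then show ?case by (simp only: sum.insert[OF insert.hyps] mult_1 insert.IH)
qed

lemma fcoef_tail:
  assumes u: "u \<in> H1p" and F: "finite F"
  shows "fcoef (\<lambda>x. u x - (\<Sum>k\<in>F. fcoef u k * phi k x)) l = (if l \<in> F then 0 else fcoef u l)"
proof -
  let ?w = "\<lambda>x. \<Sum>k\<in>F. fcoef u k * phi k x"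
  have "fcoef (\<lambda>x. u x + (-1) * ?w x) l = fcoef u l + (-1) * fcoef ?w l"
    by (simp only: fcoef_add[OF H1p_torus_L2[OF u] torus_L2_scale[OF torus_L2_trig]] fcoef_scale)
  then show ?thesis by (simp add: fcoef_trig[OF F])
qed

lemma H1_norm_tail:
  assumes u: "u \<in> H1p" and F: "finite F"
  shows "(H1_norm (\<lambda>x. u x - (\<Sum>k\<in>F. fcoef u k * phi k x)))\<^sup>2
      = (H1_norm u)\<^sup>2 - (\<Sum>k\<in>F. sobolev_sq k * (norm (fcoef u k))\<^sup>2)"
proof -
  let ?w = "\<lambda>k. sobolev_sq k * (norm (fcoef u k))\<^sup>2"
  have "(\<lambda>k. sobolev_sq k * (norm (if k \<in> F then 0 else fcoef u k))\<^sup>2) = (\<lambda>k. if k \<in> F then 0 else ?w k)"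
    by auto
  then have "((\<lambda>k. if k \<in> F then 0 else ?w k) has_sum
      (H1_norm (\<lambda>x. u x - (\<Sum>k\<in>F. fcoef u k * phi k x)))\<^sup>2) UNIV"
    using H1_norm_has_sum[OF H1p_diff[OF u H1p_trig[OF F]], of "fcoef u"]
    unfolding fcoef_tail[OF u F] by (simp only:)
  moreover have "((\<lambda>k. if k \<in> F then ?w k else 0) has_sum (\<Sum>k\<in>F. ?w k)) UNIV"
    by (subst has_sum_cong_neutral[where T = F and g = ?w]) (auto intro: has_sum_finite F)
  ultimately have "((\<lambda>k. (if k \<in> F then 0 else ?w k) + (if k \<in> F then ?w k else 0)) has_sum
      (H1_norm (\<lambda>x. u x - (\<Sum>k\<in>F. fcoef u k * phi k x)))\<^sup>2 + (\<Sum>k\<in>F. ?w k)) UNIV"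
    by (rule has_sum_add)
  moreover have "(\<lambda>k. (if k \<in> F then 0 else ?w k) + (if k \<in> F then ?w k else 0)) = ?w" by auto
  ultimately have "(?w has_sum (H1_norm (\<lambda>x. u x - (\<Sum>k\<in>F. fcoef u k * phi k x)))\<^sup>2 + (\<Sum>k\<in>F. ?w k)) UNIV"
    by (simp only:)
  from has_sum_unique[OF this H1_norm_has_sum[OF u]] show ?thesis by linarith
qed

text \<open>By boundedness of the form, the error of a partial sum is at most a multiple of the \<open>H\<^sup>1\<close> norm of
\<open>u - P\<^bsub>F\<^esub> u\<close>, the square root of a tail of a convergent series.\<close>

lemma aform_expansion:
  assumes k: "admissible_coeff \<nu>" "admissible_coeff \<sigma>" and u: "u \<in> H1p" and v: "v \<in> H1p"
  shows "((\<lambda>k. fcoef u k * aform \<nu> \<sigma> (phi k) v) has_sum aform \<nu> \<sigma> u v) UNIV"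
proof -
  obtain C where C: "C > 0" "\<forall>u\<in>H1p. \<forall>v\<in>H1p. norm (aform \<nu> \<sigma> u v) \<le> C * (H1_norm u * H1_norm v)"
    using aform_bound[OF k] by blast
  let ?T = "\<lambda>F x. \<Sum>k\<in>F. fcoef u k * phi k x"
  let ?tail = "\<lambda>F. sqrt ((H1_norm u)\<^sup>2 - (\<Sum>k\<in>F. sobolev_sq k * (norm (fcoef u k))\<^sup>2))"
  have b: "norm ((\<Sum>k\<in>F. fcoef u k * aform \<nu> \<sigma> (phi k) v) - aform \<nu> \<sigma> u v) \<le> C * (?tail F * H1_norm v)"
    if F: "finite F" for F
  proof -
    have "aform \<nu> \<sigma> (\<lambda>x. 1 * u x + (-1) * ?T F x) v = 1 * aform \<nu> \<sigma> u v + (-1) * aform \<nu> \<sigma> (?T F) v"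
      by (intro aform_lincomb_left k u v H1p_trig F)
    then have "aform \<nu> \<sigma> (\<lambda>x. u x - ?T F x) v = aform \<nu> \<sigma> u v - (\<Sum>k\<in>F. fcoef u k * aform \<nu> \<sigma> (phi k) v)"
      by (simp add: aform_trig_left[OF k F v])
    moreover have "norm (aform \<nu> \<sigma> (\<lambda>x. u x - ?T F x) v) \<le> C * (H1_norm (\<lambda>x. u x - ?T F x) * H1_norm v)"
      using C(2) H1p_diff[OF u H1p_trig[OF F]] v by blast
    moreover have "H1_norm (\<lambda>x. u x - ?T F x) = ?tail F"
      unfolding H1_norm_tail[OF u F, symmetric] by (simp only: real_sqrt_abs abs_of_nonneg[OF H1_norm_nonneg])
    ultimately show ?thesis by (simp add: norm_minus_commute)
  qed
  have "(?tail \<longlongrightarrow> sqrt ((H1_norm u)\<^sup>2 - (H1_norm u)\<^sup>2)) (finite_subsets_at_top UNIV)"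
    using H1_norm_has_sum[OF u] unfolding has_sum_def by (intro tendsto_intros)
  then have "(?tail \<longlongrightarrow> 0) (finite_subsets_at_top UNIV)" by (simp only: diff_self real_sqrt_zero)
  then have "((\<lambda>F. C * (?tail F * H1_norm v)) \<longlongrightarrow> C * (0 * H1_norm v)) (finite_subsets_at_top UNIV)"
    by (rule tendsto_mult_left[OF tendsto_mult_right])
  then have t: "((\<lambda>F. C * (?tail F * H1_norm v)) \<longlongrightarrow> 0) (finite_subsets_at_top UNIV)" by simp
  have "((\<lambda>F. (\<Sum>k\<in>F. fcoef u k * aform \<nu> \<sigma> (phi k) v) - aform \<nu> \<sigma> u v) \<longlongrightarrow> 0) (finite_subsets_at_top UNIV)"
  proof (rule Lim_null_comparison[OF _ t])
    show "\<forall>\<^sub>F F in finite_subsets_at_top UNIV.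
        norm ((\<Sum>k\<in>F. fcoef u k * aform \<nu> \<sigma> (phi k) v) - aform \<nu> \<sigma> u v) \<le> C * (?tail F * H1_norm v)"
      unfolding eventually_finite_subsets_at_top using b by blast
  qed
  then show ?thesis unfolding has_sum_def by (simp only: LIM_zero_iff)
qed

section \<open>Localization of the Galerkin residual\<close>

definition sobolev_wt :: "int^'d \<Rightarrow> real" where "sobolev_wt k = sqrt (sobolev_sq k)"

lemma sobolev_wt_pos: "sobolev_wt k > 0" by (simp add: sobolev_wt_def sobolev_sq_pos)

lemma sobolev_wt_sq: "(sobolev_wt k)\<^sup>2 = sobolev_sq k" using sobolev_sq_pos[of k] by (simp add: sobolev_wt_def)

lemma stiffness_eq: "stiffness \<nu> \<sigma> l k = aform \<nu> \<sigma> (phi k) (phi l) / of_real (sobolev_wt l * sobolev_wt k)"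
  by (simp add: stiffness_def sobolev_wt_def sobolev_sq_def)

text \<open>All but finitely many Fourier coefficients vanish.\<close>

lemma H1_norm_trig_sq:
  assumes F: "finite F"
  shows "(H1_norm (\<lambda>x. \<Sum>k\<in>F. c k * phi k x))\<^sup>2 = (\<Sum>k\<in>F. sobolev_sq k * (norm (c k))\<^sup>2)"
proof -
  have "((\<lambda>k. sobolev_sq k * (norm (if k \<in> F then c k else 0))\<^sup>2) has_sum (H1_norm (\<lambda>x. \<Sum>k\<in>F. c k * phi k x))\<^sup>2) UNIV"
    using H1_norm_has_sum[OF H1p_trig[OF F], of c] unfolding fcoef_trig[OF F] .
  moreover have "((\<lambda>k. sobolev_sq k * (norm (if k \<in> F then c k else 0))\<^sup>2) has_sum (\<Sum>k\<in>F. sobolev_sq k * (norm (c k))\<^sup>2)) UNIV"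
    by (subst has_sum_cong_neutral[where T = F and g = "\<lambda>k. sobolev_sq k * (norm (c k))\<^sup>2"]) (auto intro: has_sum_finite F)
  ultimately show ?thesis by (rule has_sum_unique)
qed

text \<open>The quadratic form of the matrix at \<open>y\<close> is the value of the elliptic form at the function with the
coefficients \<open>y k / c k\<close>, whose \<open>H\<^sup>1\<close> norm is the \<open>\<ell>\<^sup>2\<close> norm of \<open>y\<close>.\<close>

lemma stiffness_coercive:
  assumes k: "admissible_coeff \<nu>" "admissible_coeff \<sigma>"
  shows "\<exists>\<alpha>>0. \<forall>\<Lambda> y. finite \<Lambda> \<longrightarrow>
    \<alpha> * (\<Sum>l\<in>\<Lambda>. (norm (y l))\<^sup>2) \<le> Re (\<Sum>l\<in>\<Lambda>. \<Sum>m\<in>\<Lambda>. cnj (y l) * stiffness \<nu> \<sigma> l m * y m)"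
proof -
  obtain \<alpha> where \<alpha>: "\<alpha> > 0" "\<forall>u\<in>H1p. \<alpha> * (H1_norm u)\<^sup>2 \<le> Re (aform \<nu> \<sigma> u u)"
    using aform_coercive[OF k] by blast
  have "\<alpha> * (\<Sum>l\<in>\<Lambda>. (norm (y l))\<^sup>2) \<le> Re (\<Sum>l\<in>\<Lambda>. \<Sum>m\<in>\<Lambda>. cnj (y l) * stiffness \<nu> \<sigma> l m * y m)"
    if \<Lambda>: "finite \<Lambda>" for \<Lambda> y
  proof -
    define c where "c k = y k / of_real (sobolev_wt k)" for k
    define v where "v = (\<lambda>x. \<Sum>k\<in>\<Lambda>. c k * phi k x)"
    have v: "v \<in> H1p" unfolding v_def by (rule H1p_trig[OF \<Lambda>])
    have n: "(H1_norm v)\<^sup>2 = (\<Sum>l\<in>\<Lambda>. (norm (y l))\<^sup>2)"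
    proof -
      have "sobolev_sq l * (norm (c l))\<^sup>2 = (norm (y l))\<^sup>2" for l
        using sobolev_wt_pos[of l] by (simp add: c_def norm_divide power_divide sobolev_wt_sq[symmetric])
      then show ?thesis unfolding v_def H1_norm_trig_sq[OF \<Lambda>] by simp
    qed
    have "aform \<nu> \<sigma> v v = (\<Sum>l\<in>\<Lambda>. \<Sum>m\<in>\<Lambda>. cnj (y l) * stiffness \<nu> \<sigma> l m * y m)"
    proof -
      have r: "aform \<nu> \<sigma> (phi m) v = (\<Sum>l\<in>\<Lambda>. cnj (c l) * aform \<nu> \<sigma> (phi m) (phi l))" for m
      proof -
        have "aform \<nu> \<sigma> (phi m) v = cnj (aform \<nu> \<sigma> v (phi m))" by (rule aform_cnj[OF k(1) v H1p_phi, symmetric])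
        also have "aform \<nu> \<sigma> v (phi m) = (\<Sum>l\<in>\<Lambda>. c l * aform \<nu> \<sigma> (phi l) (phi m))"
          unfolding v_def by (rule aform_trig_left[OF k \<Lambda> H1p_phi])
        also have "cnj \<dots> = (\<Sum>l\<in>\<Lambda>. cnj (c l) * aform \<nu> \<sigma> (phi m) (phi l))"
          by (simp only: cnj_sum complex_cnj_mult aform_cnj[OF k(1) H1p_phi H1p_phi])
        finally show ?thesis .
      qed
      have "aform \<nu> \<sigma> v v = (\<Sum>m\<in>\<Lambda>. c m * aform \<nu> \<sigma> (phi m) v)"
        using aform_trig_left[OF k \<Lambda> v, of c] by (simp only: v_def)
      also have "\<dots> = (\<Sum>m\<in>\<Lambda>. \<Sum>l\<in>\<Lambda>. c m * (cnj (c l) * aform \<nu> \<sigma> (phi m) (phi l)))"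
        by (simp only: r sum_distrib_left)
      also have "\<dots> = (\<Sum>l\<in>\<Lambda>. \<Sum>m\<in>\<Lambda>. c m * (cnj (c l) * aform \<nu> \<sigma> (phi m) (phi l)))"
        by (rule sum.swap)
      also have "\<dots> = (\<Sum>l\<in>\<Lambda>. \<Sum>m\<in>\<Lambda>. cnj (y l) * stiffness \<nu> \<sigma> l m * y m)"
        by (intro sum.cong refl) (simp add: c_def stiffness_eq mult_ac)
      finally show ?thesis .
    qed
    then show ?thesis using \<alpha>(2)[rule_format, OF v] unfolding n by (simp only:)
  qed
  then show ?thesis using \<alpha>(1) by blast
qed

text \<open>The translation of the weak problem, of the residual and of the Galerkin equations into linear equations for
the scaled Fourier coefficients.\<close>

lemma residual_phi_eq:
  assumes k: "admissible_coeff \<nu>" "admissible_coeff \<sigma>" and \<Lambda>: "finite \<Lambda>"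
    and u: "weak_solution \<nu> \<sigma> f u" and w: "galerkin_solution \<nu> \<sigma> f \<Lambda> w"
  obtains W where
    "\<And>l. ((\<lambda>m. stiffness \<nu> \<sigma> l m * (of_real (sobolev_wt m) * fcoef u m)) has_sum f (phi l) / of_real (sobolev_wt l)) UNIV"
    "\<And>l. residual \<nu> \<sigma> f w (phi l) / of_real (sobolev_wt l) = f (phi l) / of_real (sobolev_wt l) - (\<Sum>m\<in>\<Lambda>. stiffness \<nu> \<sigma> l m * W m)"
    "\<And>l. l \<in> \<Lambda> \<Longrightarrow> (\<Sum>m\<in>\<Lambda>. stiffness \<nu> \<sigma> l m * W m) = f (phi l) / of_real (sobolev_wt l)"
proof -
  have uH: "u \<in> H1p" and uf: "\<And>v. v \<in> H1p \<Longrightarrow> aform \<nu> \<sigma> u v = f v" using u by (auto simp: weak_solution_def)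
  obtain c where c: "w = (\<lambda>x. \<Sum>k\<in>\<Lambda>. c k * phi k x)" using w by (auto simp: galerkin_solution_def V_sub_def)
  define W where "W m = of_real (sobolev_wt m) * c m" for m
  have st: "stiffness \<nu> \<sigma> l m * (of_real (sobolev_wt m) * z) = z * aform \<nu> \<sigma> (phi m) (phi l) / of_real (sobolev_wt l)" for l m z
    using sobolev_wt_pos[of m] by (simp add: stiffness_eq)
  have Wsum: "(\<Sum>m\<in>\<Lambda>. stiffness \<nu> \<sigma> l m * W m) = aform \<nu> \<sigma> w (phi l) / of_real (sobolev_wt l)" for l
    unfolding W_def st c aform_trig_left[OF k \<Lambda> H1p_phi] by (simp only: sum_divide_distrib)
  show thesis
  proof (rule that[of W])
    fix l
    have "((\<lambda>m. fcoef u m * aform \<nu> \<sigma> (phi m) (phi l)) has_sum f (phi l)) UNIV"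
      using aform_expansion[OF k uH H1p_phi] unfolding uf[OF H1p_phi] .
    then have "((\<lambda>m. fcoef u m * aform \<nu> \<sigma> (phi m) (phi l) * (1 / of_real (sobolev_wt l))) has_sum f (phi l) * (1 / of_real (sobolev_wt l))) UNIV"
      by (rule has_sum_cmult_left)
    then show "((\<lambda>m. stiffness \<nu> \<sigma> l m * (of_real (sobolev_wt m) * fcoef u m)) has_sum f (phi l) / of_real (sobolev_wt l)) UNIV"
      unfolding st by simp
    show "residual \<nu> \<sigma> f w (phi l) / of_real (sobolev_wt l) = f (phi l) / of_real (sobolev_wt l) - (\<Sum>m\<in>\<Lambda>. stiffness \<nu> \<sigma> l m * W m)"
      unfolding Wsum residual_def by (rule diff_divide_distrib)
    show "(\<Sum>m\<in>\<Lambda>. stiffness \<nu> \<sigma> l m * W m) = f (phi l) / of_real (sobolev_wt l)" if "l \<in> \<Lambda>"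
    proof -
      have "phi l x = (\<Sum>k\<in>\<Lambda>. (if k = l then 1 else 0) * phi k x)" for x
      proof -
        have "(\<Sum>k\<in>\<Lambda>. (if k = l then 1 else 0) * phi k x) = (\<Sum>k\<in>\<Lambda>. if k = l then phi k x else 0)"
          by (intro sum.cong refl) simp
        then show ?thesis using \<Lambda> that by simp
      qed
      then have "phi l = (\<lambda>x. \<Sum>k\<in>\<Lambda>. (if k = l then 1 else 0) * phi k x)" by (rule ext)
      then have "phi l \<in> V_sub \<Lambda>" unfolding V_sub_def mem_Collect_eq by (rule exI[of _ "\<lambda>k. if k = l then 1 else 0"])
      then show ?thesis using w unfolding Wsum galerkin_solution_def by simp
    qed
  qed
qed

lemma l2_bound_fcoef:
  assumes v: "v \<in> H1p" and B: "H1_norm v \<le> B"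
  shows "l2_bound (\<lambda>k. of_real (sobolev_wt k) * fcoef v k) B"
  unfolding l2_bound_def
proof (intro allI impI)
  fix F :: "(int^'a) set" assume F: "finite F"
  have "(norm (of_real (sobolev_wt k) * fcoef v k))\<^sup>2 = sobolev_sq k * (norm (fcoef v k))\<^sup>2" for k
    using sobolev_wt_pos[of k] by (simp add: norm_mult power_mult_distrib sobolev_wt_sq)
  then have "L2_set (\<lambda>k. norm (of_real (sobolev_wt k) * fcoef v k)) F = sqrt (\<Sum>k\<in>F. sobolev_sq k * (norm (fcoef v k))\<^sup>2)"
    by (simp add: L2_set_def)
  also have "\<dots> \<le> sqrt ((H1_norm v)\<^sup>2)"
    by (intro real_sqrt_le_mono finite_sum_le_has_sum[OF H1_norm_has_sum[OF v] F subset_UNIV])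
       (simp add: less_imp_le[OF sobolev_sq_pos])
  also have "\<dots> \<le> B" using B H1_norm_nonneg[of v] by simp
  finally show "L2_set (\<lambda>k. norm (of_real (sobolev_wt k) * fcoef v k)) F \<le> B" .
qed

lemma l2_bound_scale:
  assumes "l2_bound x B" "\<And>l. norm (y l) \<le> c * norm (x l)" "c \<ge> 0"
  shows "l2_bound y (c * B)"
  unfolding l2_bound_def
proof (intro allI impI)
  fix F :: "'a set" assume F: "finite F"
  have "L2_set (\<lambda>l. norm (y l)) F \<le> L2_set (\<lambda>l. c * norm (x l)) F"
    by (intro L2_set_mono assms) auto
  also have "\<dots> = c * L2_set (\<lambda>l. norm (x l)) F" using assms(3) by (simp add: L2_set_right_distrib)
  also have "\<dots> \<le> c * B" using assms F by (intro mult_left_mono l2_boundD)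
  finally show "L2_set (\<lambda>l. norm (y l)) F \<le> c * B" .
qed

text \<open>The weight \<open>\<omega> l = exp (\<epsilon> \<phi> l)\<close>, where \<open>\<phi> l\<close> is the distance from \<open>l\<close> to \<open>S\<close> cut off at \<open>J\<close>. The
cut-off keeps the amplification of the tail of \<open>u\<close> outside \<open>S\<close> below \<open>exp (\<epsilon> J)\<close>, the factor that is
gained far from \<open>S\<close>.\<close>

lemma residual_localized:
  fixes \<nu> \<sigma> :: "real^'d \<Rightarrow> real"
  assumes k: "admissible_coeff \<nu>" "admissible_coeff \<sigma>" and pos: "0 < \<eta>\<^sub>L" "0 < c\<^sub>L"
    and A_bound: "\<And>l k. norm (stiffness \<nu> \<sigma> l k) \<le> c\<^sub>L * exp (- \<eta>\<^sub>L * norm (rvec (l - k)))"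
  obtains \<epsilon> K where "\<epsilon> > 0" "K > 0"
    "\<And>f u \<Lambda> w S J M \<delta>. \<lbrakk>weak_solution \<nu> \<sigma> f u; finite \<Lambda>; galerkin_solution \<nu> \<sigma> f \<Lambda> w; finite S; 0 \<le> J;
        H1_norm u \<le> M; H1_norm (\<lambda>x. u x - (\<Sum>k\<in>S. fcoef u k * phi k x)) \<le> \<delta>\<rbrakk> \<Longrightarrow>
      l2_bound (\<lambda>l. if \<exists>k\<in>S. norm (rvec (l - k)) \<le> J then 0 else residual \<nu> \<sigma> f w (phi l) / of_real (sobolev_wt l))
        (K * (M * exp (- \<epsilon> * J) + \<delta>))"
proof -
  obtain \<alpha> where \<alpha>: "\<alpha> > 0" and co: "\<And>\<Lambda> y. finite \<Lambda> \<Longrightarrow>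
    \<alpha> * (\<Sum>l\<in>\<Lambda>. (norm (y l))\<^sup>2) \<le> Re (\<Sum>l\<in>\<Lambda>. \<Sum>m\<in>\<Lambda>. cnj (y l) * stiffness \<nu> \<sigma> l m * y m)"
    using stiffness_coercive[OF k] by blast
  show thesis
  proof (rule weighted_galerkin_residual[OF pos \<alpha> A_bound co])
    fix \<epsilon> K :: real
    assume \<epsilon>: "\<epsilon> > 0" and K: "K > 0" and est:
      "\<And>\<omega> U p W \<Lambda> B. \<lbrakk>\<And>l. 0 < \<omega> l; \<And>l m. \<omega> l \<le> exp (\<epsilon> * norm (rvec (l - m))) * \<omega> m;
       \<And>l. ((\<lambda>m. stiffness \<nu> \<sigma> l m * U m) has_sum p l) UNIV; finite \<Lambda>;
       \<And>l. l \<in> \<Lambda> \<Longrightarrow> (\<Sum>m\<in>\<Lambda>. stiffness \<nu> \<sigma> l m * W m) = p l;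
       l2_bound (\<lambda>l. of_real (\<omega> l) * U l) B\<rbrakk> \<Longrightarrow>
       l2_bound (\<lambda>l. of_real (\<omega> l) * (p l - (\<Sum>m\<in>\<Lambda>. stiffness \<nu> \<sigma> l m * W m))) (K * B)"
    show thesis
    proof (rule that[OF \<epsilon> K])
      fix f u \<Lambda> w and S :: "(int^'d) set" and J M \<delta> :: real
      assume u: "weak_solution \<nu> \<sigma> f u" and \<Lambda>: "finite \<Lambda>" and w: "galerkin_solution \<nu> \<sigma> f \<Lambda> w"
        and S: "finite S" and J: "0 \<le> J" and M: "H1_norm u \<le> M"
        and \<delta>: "H1_norm (\<lambda>x. u x - (\<Sum>k\<in>S. fcoef u k * phi k x)) \<le> \<delta>"
      have uH: "u \<in> H1p" using u by (simp add: weak_solution_def)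
      obtain W where
        p: "\<And>l. ((\<lambda>m. stiffness \<nu> \<sigma> l m * (of_real (sobolev_wt m) * fcoef u m)) has_sum f (phi l) / of_real (sobolev_wt l)) UNIV" and
        res: "\<And>l. residual \<nu> \<sigma> f w (phi l) / of_real (sobolev_wt l) = f (phi l) / of_real (sobolev_wt l) - (\<Sum>m\<in>\<Lambda>. stiffness \<nu> \<sigma> l m * W m)" and
        gal: "\<And>l. l \<in> \<Lambda> \<Longrightarrow> (\<Sum>m\<in>\<Lambda>. stiffness \<nu> \<sigma> l m * W m) = f (phi l) / of_real (sobolev_wt l)"
        by (rule residual_phi_eq[OF k \<Lambda> u w]) (rule that; assumption)
      \<comment> \<open>Inserting \<open>J\<close> performs the cut-off and also covers the case that \<open>S\<close> is empty.\<close>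
    define \<phi> where "\<phi> l = Min (insert J ((\<lambda>k. norm (rvec (l - k))) ` S))" for l
      have \<phi>_le: "\<phi> l \<le> J" "k \<in> S \<Longrightarrow> \<phi> l \<le> norm (rvec (l - k))" for l k
        using S by (auto simp: \<phi>_def)
      have \<phi>_in: "\<phi> l = J \<or> (\<exists>k\<in>S. \<phi> l = norm (rvec (l - k)))" for l
        using Min_in[of "insert J ((\<lambda>k. norm (rvec (l - k))) ` S)"] S unfolding \<phi>_def by auto
      have \<phi>_lip: "\<phi> l \<le> norm (rvec (l - m)) + \<phi> m" for l m
      proof (cases "\<phi> m = J")
        case True then show ?thesis using \<phi>_le(1)[of l] by (simp add: add_increasing)
      next
        case False
        then obtain k where k: "k \<in> S" "\<phi> m = norm (rvec (m - k))" using \<phi>_in[of m] by auto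
        have "\<phi> l \<le> norm (rvec (l - k))" by (rule \<phi>_le(2)[OF k(1)])
        also have "\<dots> \<le> norm (rvec (l - m)) + norm (rvec (m - k))" by (rule norm_rvec_diff_triangle)
        finally show ?thesis by (simp only: k(2))
      qed
      define \<omega> where "\<omega> l = exp (\<epsilon> * \<phi> l)" for l
      define U where "U = (\<lambda>l. of_real (sobolev_wt l) * fcoef u l)"
      have \<omega>pos: "0 < \<omega> l" for l by (simp add: \<omega>_def)
      have \<omega>lip: "\<omega> l \<le> exp (\<epsilon> * norm (rvec (l - m))) * \<omega> m" for l m
      proof -
        have "\<epsilon> * \<phi> l \<le> \<epsilon> * (norm (rvec (l - m)) + \<phi> m)" using \<epsilon> \<phi>_lip by (intro mult_left_mono) auto
        then show ?thesis unfolding \<omega>_def by (simp add: distrib_left flip: exp_add)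
      qed
      have \<omega>le: "\<omega> l \<le> exp (\<epsilon> * J)" for l using \<epsilon> \<phi>_le(1)[of l] by (simp add: \<omega>_def)
      have \<omega>S: "\<omega> l \<le> 1" if "l \<in> S" for l
      proof -
        have "rvec (l - l) = 0" by (simp add: rvec_def vec_eq_iff)
        then have "\<phi> l \<le> 0" using \<phi>_le(2)[OF that, of l] by simp
        then show ?thesis using \<epsilon> by (simp add: \<omega>_def mult_nonneg_nonpos)
      qed
      have "l2_bound (\<lambda>l. (if l \<in> S then of_real (\<omega> l) * U l else 0)) M"
      proof (rule l2_bound_mono[OF l2_bound_fcoef[OF uH M]])
        fix l show "norm (if l \<in> S then of_real (\<omega> l) * U l else 0) \<le> norm (of_real (sobolev_wt l) * fcoef u l)"
          using mult_right_mono[OF \<omega>S, of l "norm (U l)"] \<omega>pos[of l] by (auto simp: norm_mult U_def)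
      qed
      moreover have "l2_bound (\<lambda>l. (if l \<in> S then 0 else of_real (\<omega> l) * U l)) (exp (\<epsilon> * J) * \<delta>)"
      proof (rule l2_bound_scale[OF l2_bound_fcoef[OF H1p_diff[OF uH H1p_trig[OF S]] \<delta>]])
        fix l show "norm (if l \<in> S then 0 else of_real (\<omega> l) * U l) \<le>
            exp (\<epsilon> * J) * norm (of_real (sobolev_wt l) * fcoef (\<lambda>x. u x - (\<Sum>k\<in>S. fcoef u k * phi k x)) l)"
          unfolding fcoef_tail[OF uH S]
          using mult_right_mono[OF \<omega>le, of "norm (U l)" l] \<omega>pos[of l] by (auto simp: norm_mult U_def)
      qed simp
      ultimately have "l2_bound (\<lambda>l. (if l \<in> S then of_real (\<omega> l) * U l else 0) + (if l \<in> S then 0 else of_real (\<omega> l) * U l))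
          (M + exp (\<epsilon> * J) * \<delta>)"
        by (rule l2_bound_add)
      then have "l2_bound (\<lambda>l. of_real (\<omega> l) * U l) (M + exp (\<epsilon> * J) * \<delta>)"
        by (rule l2_bound_mono) auto
      from est[OF \<omega>pos \<omega>lip p \<Lambda> gal this[unfolded U_def]]
      have "l2_bound (\<lambda>l. of_real (\<omega> l) * (residual \<nu> \<sigma> f w (phi l) / of_real (sobolev_wt l))) (K * (M + exp (\<epsilon> * J) * \<delta>))"
        unfolding res .
      then have "l2_bound (\<lambda>l. if \<exists>k\<in>S. norm (rvec (l - k)) \<le> J then 0 else residual \<nu> \<sigma> f w (phi l) / of_real (sobolev_wt l))
          (exp (- (\<epsilon> * J)) * (K * (M + exp (\<epsilon> * J) * \<delta>)))"
      proof (rule l2_bound_scale)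
        fix l
        let ?r = "residual \<nu> \<sigma> f w (phi l) / of_real (sobolev_wt l)"
        show "norm (if \<exists>k\<in>S. norm (rvec (l - k)) \<le> J then 0 else ?r) \<le> exp (- (\<epsilon> * J)) * norm (of_real (\<omega> l) * ?r)"
        proof (cases "\<exists>k\<in>S. norm (rvec (l - k)) \<le> J")
          case False
          then have "\<phi> l = J" using \<phi>_in[of l] \<phi>_le(1)[of l] by auto
          then have "norm (of_real (\<omega> l) * ?r) = exp (\<epsilon> * J) * norm ?r"
            by (simp only: \<omega>_def norm_mult norm_of_real abs_exp_cancel)
          then have "exp (- (\<epsilon> * J)) * norm (of_real (\<omega> l) * ?r) = norm ?r"
            by (simp only: mult.assoc[symmetric] exp_add[symmetric]) simp
          then show ?thesis using False by simp
        qed simp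
      qed simp
      moreover have "exp (- (\<epsilon> * J)) * (K * (M + exp (\<epsilon> * J) * \<delta>)) = K * (M * exp (- \<epsilon> * J) + \<delta>)"
        by (simp add: exp_minus field_simps)
      ultimately show "l2_bound (\<lambda>l. if \<exists>k\<in>S. norm (rvec (l - k)) \<le> J then 0 else residual \<nu> \<sigma> f w (phi l) / of_real (sobolev_wt l))
          (K * (M * exp (- \<epsilon> * J) + \<delta>))"
        by (simp only:)
    qed
  qed
qed

text \<open>Boundedness of \<open>v \<mapsto> a(w, v)\<close> with respect to the norm defined by Fourier coefficients.\<close>

lemma residual_Hm1p:
  fixes \<nu> \<sigma> :: "real^'d \<Rightarrow> real"
  assumes k: "admissible_coeff \<nu>" "admissible_coeff \<sigma>" and f: "f \<in> Hm1p" and w: "w \<in> H1p"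
  shows "residual \<nu> \<sigma> f w \<in> Hm1p"
proof -
  obtain C where C: "C > 0" "\<forall>u\<in>H1p. \<forall>v\<in>H1p. norm (aform \<nu> \<sigma> u v) \<le> C * (H1_norm u * H1_norm v)"
    using aform_bound[OF k] by blast
  obtain C' where C': "\<forall>v\<in>H1p. norm (f v) \<le> C' * H1_norm v" using f by (auto simp: Hm1p_def)
  have "norm (residual \<nu> \<sigma> f w v) \<le> (C' + C * H1_norm w) * H1_norm v" if v: "v \<in> H1p" for v
  proof -
    have "norm (residual \<nu> \<sigma> f w v) \<le> norm (f v) + norm (aform \<nu> \<sigma> w v)"
      unfolding residual_def by (rule norm_triangle_ineq4)
    also have "\<dots> \<le> C' * H1_norm v + C * (H1_norm w * H1_norm v)" using C C' v w by (intro add_mono) auto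
    finally show ?thesis by (simp add: algebra_simps)
  qed
  then have b: "\<exists>C. \<forall>v\<in>H1p. norm (residual \<nu> \<sigma> f w v) \<le> C * H1_norm v" by blast
  show ?thesis
    unfolding Hm1p_def mem_Collect_eq
  proof (intro conjI b ballI allI)
    fix v z :: "real^'d \<Rightarrow> complex" assume v: "v \<in> H1p" and z: "z \<in> H1p"
    have "f (\<lambda>x. v x + z x) = f v + f z" using f v z by (simp add: Hm1p_def)
    then show "residual \<nu> \<sigma> f w (\<lambda>x. v x + z x) = residual \<nu> \<sigma> f w v + residual \<nu> \<sigma> f w z"
      by (simp add: residual_def aform_add_right[OF k v z w])
  next
    fix c and v :: "real^'d \<Rightarrow> complex" assume v: "v \<in> H1p"
    have "f (\<lambda>x. c * v x) = cnj c * f v" using f v by (simp add: Hm1p_def)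
    then show "residual \<nu> \<sigma> f w (\<lambda>x. c * v x) = cnj c * residual \<nu> \<sigma> f w v"
      by (simp add: residual_def aform_scale_right[OF k v w] right_diff_distrib)
  qed
qed

text \<open>Subtracting the projection removes the values at \<open>phi k\<close> with \<open>k \<in> T\<close> and leaves the others unchanged, so
the dual norm is an \<open>\<ell>\<^sup>2\<close> norm outside \<open>T\<close>.\<close>

lemma Hm1_norm_projection_le:
  assumes T: "finite T" and B: "l2_bound (\<lambda>l. if l \<in> T then 0 else g (phi l) / of_real (sobolev_wt l)) B"
  shows "Hm1_norm (\<lambda>v. g v - (\<Sum>k\<in>T. g (phi k) * cnj (fcoef v k))) \<le> B"
proof -
  let ?x = "\<lambda>l. if l \<in> T then 0 else g (phi l) / of_real (sobolev_wt l)"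
  have B0: "B \<ge> 0" by (rule l2_bound_nonneg[OF B])
  have v: "g (phi l) - (\<Sum>k\<in>T. g (phi k) * cnj (fcoef (phi l) k)) = (if l \<in> T then 0 else g (phi l))" for l
  proof -
    have "(\<Sum>k\<in>T. g (phi k) * cnj (fcoef (phi l) k)) = (\<Sum>k\<in>T. if l = k then g (phi k) else 0)"
      by (intro sum.cong refl) (simp add: fcoef_phi)
    then show ?thesis using T by simp
  qed
  have eq: "inverse (1 + (norm (rvec l))\<^sup>2) * (norm (if l \<in> T then 0 else g (phi l)))\<^sup>2 = (norm (?x l))\<^sup>2" for l
  proof -
    have "1 + (norm (rvec l))\<^sup>2 = (sobolev_wt l)\<^sup>2" by (simp only: sobolev_wt_sq sobolev_sq_def)
    moreover have "(norm (g (phi l) / of_real (sobolev_wt l)))\<^sup>2 = (norm (g (phi l)))\<^sup>2 / (sobolev_wt l)\<^sup>2"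
      by (simp add: norm_divide power_divide)
    ultimately show ?thesis by (simp add: divide_inverse mult.commute)
  qed
  have "(\<Sum>\<^sub>\<infinity>l. (norm (?x l))\<^sup>2) \<le> B\<^sup>2"
  proof (cases "(\<lambda>l. (norm (?x l))\<^sup>2) summable_on UNIV")
    case True
    then show ?thesis
    proof (rule infsum_le_finite_sums)
      fix F :: "(int^'a) set" assume "finite F"
      then have "sqrt (\<Sum>l\<in>F. (norm (?x l))\<^sup>2) \<le> B" using l2_boundD[OF B, of F] unfolding L2_set_def by blast
      then show "(\<Sum>l\<in>F. (norm (?x l))\<^sup>2) \<le> B\<^sup>2" by (rule sqrt_le_D)
    qed
  next
    case False
    then have "(\<Sum>\<^sub>\<infinity>l. (norm (?x l))\<^sup>2) = 0" by (rule infsum_not_exists)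
    then show ?thesis by simp
  qed
  then have "sqrt (\<Sum>\<^sub>\<infinity>l. (norm (?x l))\<^sup>2) \<le> sqrt (B\<^sup>2)" by (rule real_sqrt_le_mono)
  then show ?thesis unfolding Hm1_norm_def v eq using B0 by (simp only: real_sqrt_abs abs_of_nonneg)
qed

section \<open>Best approximation with a given number of terms\<close>

lemma infinite_frequencies: "infinite (UNIV :: (int^'d) set)"
proof
  assume "finite (UNIV :: (int^'d) set)"
  then have "finite (range (\<lambda>n::int. (\<chi> i. n) :: int^'d))" by (rule finite_subset[rotated]) simp
  moreover have "inj (\<lambda>n::int. (\<chi> i. n) :: int^'d)" by (auto simp: inj_def vec_eq_iff)
  ultimately have "finite (UNIV :: int set)" by (rule finite_imageD)
  then show False by simp
qed

text \<open>The error for exactly \<open>n\<close> terms: a smaller set \<open>Z\<close> is filled up with arbitrary frequencies.\<close>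

lemma best_err_dual_le:
  assumes Z: "finite Z" "card Z \<le> n" and B: "l2_bound (\<lambda>l. if l \<in> Z then 0 else g (phi l) / of_real (sobolev_wt l)) B"
  shows "best_err_dual g n \<le> B"
proof -
  obtain T where T: "Z \<subseteq> T" "finite T" "card T = n"
  proof -
    have "infinite (UNIV - Z)" using infinite_frequencies Z(1) by (rule Diff_infinite_finite[rotated])
    then obtain R where R: "finite R" "card R = n - card Z" "R \<subseteq> UNIV - Z"
      using infinite_arbitrarily_large by blast
    have "card (Z \<union> R) = n" using R Z by (subst card_Un_disjoint) auto
    then show thesis using that[of "Z \<union> R"] R(1) Z(1) by simp
  qed
  have "best_err_dual g n \<le> Hm1_norm (\<lambda>v. g v - (\<Sum>k\<in>T. g (phi k) * cnj (fcoef v k)))"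
    unfolding best_err_dual_def
  proof (rule cINF_lower)
    show "bdd_below ((\<lambda>\<Lambda>. Hm1_norm (\<lambda>v. g v - (\<Sum>k\<in>\<Lambda>. g (phi k) * cnj (fcoef v k)))) ` {\<Lambda>. finite \<Lambda> \<and> card \<Lambda> = n})"
      by (rule bdd_belowI2[of _ 0]) (simp add: Hm1_norm_def infsum_nonneg)
  qed (use T in simp)
  also have "\<dots> \<le> B"
  proof (rule Hm1_norm_projection_le[OF T(2) l2_bound_mono[OF B]])
    show "norm (if l \<in> T then 0 else g (phi l) / of_real (sobolev_wt l)) \<le> norm (if l \<in> Z then 0 else g (phi l) / of_real (sobolev_wt l))" for l
      using T(1) by auto
  qed
  finally show ?thesis .
qed

text \<open>The infimum that defines the best error need not be attained, which is why \<open>M\<close> is strictly larger than the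
norm of the class.\<close>

lemma AG_V_approx:
  fixes u :: "real^'d \<Rightarrow> complex"
  assumes u: "u \<in> AG_V \<eta> t" and M: "AG_V_norm \<eta> t u < M"
  shows "\<exists>S. finite S \<and> card S = N \<and>
    H1_norm (\<lambda>x. u x - (\<Sum>k\<in>S. fcoef u k * phi k x)) \<le> M / exp_weight TYPE('d) \<eta> t N"
proof -
  have e: "exp_weight TYPE('d) \<eta> t N > 0" by (simp add: exp_weight_def)
  have "best_err_V u N * exp_weight TYPE('d) \<eta> t N \<le> AG_V_norm \<eta> t u"
    unfolding AG_V_norm_def using u by (intro cSUP_upper) (auto simp: AG_V_def)
  also have "\<dots> < M" by (rule M)
  finally have "best_err_V u N < M / exp_weight TYPE('d) \<eta> t N" using e by (simp add: pos_less_divide_eq)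
  moreover have "{\<Lambda> :: (int^'d) set. finite \<Lambda> \<and> card \<Lambda> = N} \<noteq> {}"
    using infinite_arbitrarily_large[OF infinite_frequencies, of N] by blast
  moreover have "bdd_below ((\<lambda>\<Lambda>. H1_norm (\<lambda>x. u x - (\<Sum>k\<in>\<Lambda>. fcoef u k * phi k x))) ` {\<Lambda>. finite \<Lambda> \<and> card \<Lambda> = N})"
    by (rule bdd_belowI2[of _ 0]) (rule H1_norm_nonneg)
  ultimately show ?thesis
    unfolding best_err_V_def by (subst (asm) cINF_less_iff) (auto intro: less_imp_le)
qed

text \<open>The case of zero terms, where the weight is \<open>1\<close>.\<close>

lemma H1_norm_le_AG_V_norm:
  fixes u :: "real^'d \<Rightarrow> complex"
  assumes u: "u \<in> AG_V \<eta> t" and t: "t > 0"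
  shows "H1_norm u \<le> AG_V_norm \<eta> t u"
proof -
  have "{\<Lambda> :: (int^'d) set. finite \<Lambda> \<and> card \<Lambda> = 0} = {{}}" by auto
  then have "best_err_V u 0 = H1_norm u" by (simp add: best_err_V_def)
  moreover have "exp_weight TYPE('d) \<eta> t 0 = 1" using t by (simp add: exp_weight_def)
  moreover have "best_err_V u 0 * exp_weight TYPE('d) \<eta> t 0 \<le> AG_V_norm \<eta> t u"
    unfolding AG_V_norm_def using u by (intro cSUP_upper) (auto simp: AG_V_def)
  ultimately show ?thesis by simp
qed

lemma card_neighbourhood_le:
  fixes S :: "(int^'d) set"
  assumes S: "finite S" "card S = N"
  shows "finite {l. \<exists>k\<in>S. norm (rvec (l - k)) \<le> real N}"
    "card {l. \<exists>k\<in>S. norm (rvec (l - k)) \<le> real N} \<le> N * (2 * N + 1) ^ CARD('d)"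
proof -
  have eq: "{l. \<exists>k\<in>S. norm (rvec (l - k)) \<le> real N} = (\<Union>k\<in>S. {l. norm (rvec (l - k)) \<le> real N})" by auto
  show "finite {l. \<exists>k\<in>S. norm (rvec (l - k)) \<le> real N}"
    unfolding eq using S(1) card_lattice_ball_le by blast
  have "card (\<Union>k\<in>S. {l. norm (rvec (l - k)) \<le> real N}) \<le> (\<Sum>k\<in>S. card {l. norm (rvec (l - k)) \<le> real N})"
    by (rule card_UN_le[OF S(1)])
  also have "\<dots> \<le> (\<Sum>k\<in>S. (2 * N + 1) ^ CARD('d))" using card_lattice_ball_le by (intro sum_mono) blast
  also have "\<dots> = N * (2 * N + 1) ^ CARD('d)" using S(2) by simp
  finally show "card {l. \<exists>k\<in>S. norm (rvec (l - k)) \<le> real N} \<le> N * (2 * N + 1) ^ CARD('d)" unfolding eq .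
qed

text \<open>The largest \<open>N\<close> for which the \<open>N\<close>-neighbourhood of any \<open>N\<close> frequencies is guaranteed to have at most \<open>n\<close>
points. Maximality bounds \<open>n\<close> by a power of \<open>N + 1\<close>.\<close>

lemma exists_term_count:
  fixes d n :: nat
  obtains N where "N * (2 * N + 1) ^ d \<le> n" "n \<le> (3 * (N + 1)) ^ (d + 1)"
proof -
  have "\<exists>N. N * (2 * N + 1) ^ d \<le> n \<and> \<not> Suc N * (2 * Suc N + 1) ^ d \<le> n"
  proof (rule ccontr)
    assume *: "\<not> (\<exists>N. N * (2 * N + 1) ^ d \<le> n \<and> \<not> Suc N * (2 * Suc N + 1) ^ d \<le> n)"
    have "N * (2 * N + 1) ^ d \<le> n" for N
    proof (induction N)
      case (Suc N) then show ?case using * by blast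
    qed simp
    from this[of "Suc n"] have "Suc n * (2 * Suc n + 1) ^ d \<le> n" .
    moreover have "Suc n * 1 \<le> Suc n * (2 * Suc n + 1) ^ d" by (rule mult_left_mono) (simp_all only: one_le_power le_add2 zero_le)
    ultimately have "Suc n * 1 \<le> n" by (rule order_trans[rotated])
    then show False by simp
  qed
  then obtain N where N: "N * (2 * N + 1) ^ d \<le> n" "\<not> Suc N * (2 * Suc N + 1) ^ d \<le> n" by blast
  have "n \<le> Suc N * (2 * Suc N + 1) ^ d" using N(2) by linarith
  also have "\<dots> \<le> (3 * (N + 1)) * (3 * (N + 1)) ^ d" by (intro mult_mono power_mono) auto
  finally show thesis using that[of N] N(1) by simp
qed

text \<open>The exponent \<open>\<tau> / (d + 1)\<close> undoes the power \<open>d + 1\<close> lost in passing from \<open>N\<close> to \<open>n\<close>. The additive constant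
covers \<open>N = 0\<close>, where \<open>0 powr \<tau> = 0\<close>.\<close>

lemma powr_term_count:
  fixes \<tau> :: real and d n N :: nat
  assumes n: "n \<le> (3 * (N + 1)) ^ (d + 1)" and \<tau>: "0 < \<tau>" "\<tau> \<le> 1"
  shows "real n powr (\<tau> / real (d + 1)) \<le> 6 * real N powr \<tau> + 3"
proof -
  have "real n powr (\<tau> / real (d + 1)) \<le> ((3 * real (N + 1)) ^ (d + 1)) powr (\<tau> / real (d + 1))"
  proof (rule powr_mono2)
    have "real n \<le> real ((3 * (N + 1)) ^ (d + 1))" using n by (rule of_nat_mono)
    then show "real n \<le> (3 * real (N + 1)) ^ (d + 1)" by (simp only: of_nat_power of_nat_mult of_nat_numeral)
  qed (use \<tau> in auto)
  also have "\<dots> = ((3 * real (N + 1)) powr real (d + 1)) powr (\<tau> / real (d + 1))"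
    by (subst powr_realpow) auto
  also have "\<dots> = (3 * real (N + 1)) powr \<tau>"
    unfolding powr_powr by simp
  also have "\<dots> = 3 powr \<tau> * real (N + 1) powr \<tau>" by (rule powr_mult)
  also have "\<dots> \<le> 3 * (2 * real N powr \<tau> + 1)"
  proof (rule mult_mono)
    show "3 powr \<tau> \<le> (3::real)" using powr_mono[of \<tau> 1 3] \<tau> by simp
    show "real (N + 1) powr \<tau> \<le> 2 * real N powr \<tau> + 1"
    proof (cases "N = 0")
      case False
      have "real (N + 1) powr \<tau> \<le> (2 * real N) powr \<tau>" using False \<tau> by (intro powr_mono2) auto
      also have "\<dots> = 2 powr \<tau> * real N powr \<tau>" by (rule powr_mult)
      also have "\<dots> \<le> 2 * real N powr \<tau>" using powr_mono[of \<tau> 1 2] \<tau> by (intro mult_right_mono) auto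
      finally show ?thesis by simp
    qed simp
  qed auto
  finally show ?thesis by simp
qed

text \<open>With \<open>s = N powr \<tau>\<close>, \<open>\<tau> = t / d \<le> 1\<close>, the tail of \<open>u\<close> is at most \<open>M exp (- a s)\<close> and the localization
error at most \<open>M exp (- \<epsilon> N) \<le> M exp (- \<epsilon> s)\<close>, while \<open>n powr (\<tau> / (d + 1)) \<le> 6 s + 3\<close>. The factor
\<open>1 / 6\<close> in \<open>\<eta>'\<close> makes the weight at \<open>n\<close> grow no faster than \<open>exp (b s)\<close> with \<open>b = min \<epsilon> a\<close>.\<close>

lemma best_err_dual_residual:
  fixes \<nu> \<sigma> :: "real^'d \<Rightarrow> real"
  assumes k: "admissible_coeff \<nu>" "admissible_coeff \<sigma>" and pos: "0 < \<eta>\<^sub>L" "0 < c\<^sub>L"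
    and A_bound: "\<And>l k. norm (stiffness \<nu> \<sigma> l k) \<le> c\<^sub>L * exp (- \<eta>\<^sub>L * norm (rvec (l - k)))"
    and \<eta>t: "0 < \<eta>" "0 < t" "t \<le> real CARD('d)"
  shows "\<exists>\<eta>' t' C. 0 < \<eta>' \<and> \<eta>' \<le> \<eta> \<and> 0 < t' \<and> t' \<le> t \<and> 0 < C \<and>
    (\<forall>f u. weak_solution \<nu> \<sigma> f u \<and> u \<in> AG_V \<eta> t \<longrightarrow>
      (\<forall>\<Lambda> w. finite \<Lambda> \<and> galerkin_solution \<nu> \<sigma> f \<Lambda> w \<longrightarrow>
        (\<forall>n. best_err_dual (residual \<nu> \<sigma> f w) n * exp_weight TYPE('d) \<eta>' t' n \<le> C * AG_V_norm \<eta> t u)))"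
proof (rule residual_localized[OF k pos A_bound])
  fix \<epsilon> K :: real
  assume \<epsilon>: "\<epsilon> > 0" and K: "K > 0" and loc:
    "\<And>f u \<Lambda> w S J M \<delta>. \<lbrakk>weak_solution \<nu> \<sigma> f u; finite \<Lambda>; galerkin_solution \<nu> \<sigma> f \<Lambda> w; finite S; 0 \<le> J;
        H1_norm u \<le> M; H1_norm (\<lambda>x. u x - (\<Sum>k\<in>S. fcoef u k * phi k x)) \<le> \<delta>\<rbrakk> \<Longrightarrow>
      l2_bound (\<lambda>l. if \<exists>k\<in>S. norm (rvec (l - k)) \<le> J then 0 else residual \<nu> \<sigma> f w (phi l) / of_real (sobolev_wt l))
        (K * (M * exp (- \<epsilon> * J) + \<delta>))"
  define d where "d = CARD('d)"
  have d: "real d > 0" by (simp add: d_def)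
  define om where "om = omega TYPE('d)"
  have om: "om > 0" unfolding om_def omega_def by (rule content_ball_pos) simp
  define \<tau> where "\<tau> = t / real d"
  have \<tau>: "0 < \<tau>" "\<tau> \<le> 1" using \<eta>t d by (auto simp: \<tau>_def d_def)
  define a where "a = \<eta> * om powr (- \<tau>)"
  have a: "a > 0" using \<eta>t om by (simp add: a_def)
  define b where "b = min \<epsilon> a"
  have b: "b > 0" "b \<le> \<epsilon>" "b \<le> a" using \<epsilon> a by (auto simp: b_def)
  define t' where "t' = t / real (d + 1)"
  have t': "0 < t'" "t' \<le> t" using \<eta>t by (auto simp: t'_def field_simps)
  have t'd: "t' / real d = \<tau> / real (d + 1)" by (simp add: t'_def \<tau>_def)
  define \<eta>' where "\<eta>' = min \<eta> (b / 6 * om powr (t' / real d))"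
  have \<eta>': "0 < \<eta>'" "\<eta>' \<le> \<eta>" using \<eta>t b om by (auto simp: \<eta>'_def)
  have \<eta>'b: "\<eta>' * om powr (- t' / real d) \<le> b / 6"
  proof -
    have "\<eta>' * om powr (- t' / real d) \<le> (b / 6 * om powr (t' / real d)) * om powr (- t' / real d)"
      by (intro mult_right_mono) (auto simp: \<eta>'_def)
    also have "\<dots> = b / 6" using om by (simp add: powr_minus)
    finally show ?thesis .
  qed
  define C where "C = 2 * K * exp (b / 2)"
  have C: "C > 0" using K by (simp add: C_def)
  have main: "best_err_dual (residual \<nu> \<sigma> f w) n * exp_weight TYPE('d) \<eta>' t' n \<le> C * AG_V_norm \<eta> t u"
    if u: "weak_solution \<nu> \<sigma> f u" "u \<in> AG_V \<eta> t" and w: "finite \<Lambda>" "galerkin_solution \<nu> \<sigma> f \<Lambda> w" for f u \<Lambda> w n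
  proof -
    let ?r = "residual \<nu> \<sigma> f w"
    obtain N where N: "N * (2 * N + 1) ^ d \<le> n" "n \<le> (3 * (N + 1)) ^ (d + 1)" by (rule exists_term_count)
    define s where "s = real N powr \<tau>"
    have s0: "s \<ge> 0" by (simp add: s_def)
    have s: "s \<le> real N"
    proof (cases "N = 0")
      case False then show ?thesis using powr_mono[of \<tau> 1 "real N"] \<tau> by (simp add: s_def)
    qed (simp add: s_def)
    have wt: "exp_weight TYPE('d) \<eta>' t' n \<le> exp (b * s + b / 2)"
    proof -
      have "exp_weight TYPE('d) \<eta>' t' n = exp ((\<eta>' * om powr (- t' / real d)) * real n powr (\<tau> / real (d + 1)))"
        unfolding exp_weight_def om_def[symmetric] d_def[symmetric] t'd ..
      also have "(\<eta>' * om powr (- t' / real d)) * real n powr (\<tau> / real (d + 1)) \<le> b / 6 * (6 * s + 3)"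
        unfolding s_def using b by (intro mult_mono \<eta>'b powr_term_count[OF N(2) \<tau>]) auto
      also have "b / 6 * (6 * s + 3) = b * s + b / 2" by (simp add: algebra_simps)
      finally show ?thesis by simp
    qed
    have wV: "exp_weight TYPE('d) \<eta> t N = exp (a * s)"
      unfolding exp_weight_def om_def[symmetric] d_def[symmetric] a_def s_def \<tau>_def by simp
    have bM: "best_err_dual ?r n * exp_weight TYPE('d) \<eta>' t' n \<le> C * M" if M: "AG_V_norm \<eta> t u < M" for M
    proof -
      have HM: "H1_norm u \<le> M" using H1_norm_le_AG_V_norm[OF u(2) \<eta>t(2)] M by linarith
      have M0: "M \<ge> 0" using HM H1_norm_nonneg[of u] by linarith
      obtain S where S: "finite S" "card S = N"
        "H1_norm (\<lambda>x. u x - (\<Sum>k\<in>S. fcoef u k * phi k x)) \<le> M / exp (a * s)"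
        using AG_V_approx[OF u(2) M, of N] unfolding wV by blast
      let ?Z = "{l. \<exists>k\<in>S. norm (rvec (l - k)) \<le> real N}"
      have "best_err_dual ?r n \<le> K * (M * exp (- \<epsilon> * real N) + M / exp (a * s))"
      proof (rule best_err_dual_le[of ?Z])
        show "finite ?Z" by (rule card_neighbourhood_le[OF S(1,2)])
        show "card ?Z \<le> n" using card_neighbourhood_le(2)[OF S(1,2)] N(1) unfolding d_def by linarith
        show "l2_bound (\<lambda>l. if l \<in> ?Z then 0 else ?r (phi l) / of_real (sobolev_wt l))
            (K * (M * exp (- \<epsilon> * real N) + M / exp (a * s)))"
          using loc[OF u(1) w S(1) _ HM S(3), of "real N"] by simp
      qed
      also have "\<dots> \<le> K * (M * exp (- (b * s)) + M * exp (- (b * s)))"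
      proof -
        have "b * s \<le> \<epsilon> * real N" using b s s0 \<epsilon> by (intro mult_mono) auto
        then have 1: "M * exp (- \<epsilon> * real N) \<le> M * exp (- (b * s))" using M0 by (intro mult_left_mono) auto
        have "b * s \<le> a * s" using b s0 by (intro mult_right_mono) auto
        then have "M * exp (- (a * s)) \<le> M * exp (- (b * s))" using M0 by (intro mult_left_mono) auto
        then have 2: "M / exp (a * s) \<le> M * exp (- (b * s))" by (simp add: exp_minus divide_inverse)
        show ?thesis using K by (intro mult_left_mono add_mono 1 2) auto
      qed
      finally have "best_err_dual ?r n \<le> 2 * K * M * exp (- (b * s))" by (simp add: algebra_simps)
      then have "best_err_dual ?r n * exp_weight TYPE('d) \<eta>' t' n \<le> 2 * K * M * exp (- (b * s)) * exp (b * s + b / 2)"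
        using wt K M0 by (intro mult_mono) (auto simp: exp_weight_def)
      also have "\<dots> = C * M" by (simp add: C_def exp_add exp_minus)
      finally show ?thesis .
    qed
    \<comment> \<open>The estimate for all \<open>M\<close> above the norm of the class gives the estimate for the norm itself.\<close>
    have "best_err_dual ?r n * exp_weight TYPE('d) \<eta>' t' n / C \<le> AG_V_norm \<eta> t u"
    proof (rule dense_ge)
      fix M assume "AG_V_norm \<eta> t u < M"
      from bM[OF this] show "best_err_dual ?r n * exp_weight TYPE('d) \<eta>' t' n / C \<le> M"
        using C by (simp add: pos_divide_le_eq mult.commute)
    qed
    then show ?thesis using C by (simp add: pos_divide_le_eq mult.commute)
  qed
  show ?thesis
  proof (rule exI[of _ \<eta>'], rule exI[of _ t'], rule exI[of _ C], intro conjI \<eta>' t' C allI impI)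
    fix f u \<Lambda> w n
    assume "weak_solution \<nu> \<sigma> f u \<and> u \<in> AG_V \<eta> t" "finite \<Lambda> \<and> galerkin_solution \<nu> \<sigma> f \<Lambda> w"
    then show "best_err_dual (residual \<nu> \<sigma> f w) n * exp_weight TYPE('d) \<eta>' t' n \<le> C * AG_V_norm \<eta> t u"
      by (elim conjE) (rule main)
  qed
qed

theorem proposition5p4:
  fixes \<nu> \<sigma> :: "real^'d \<Rightarrow> real"
    and Ainv :: "int^'d \<Rightarrow> int^'d \<Rightarrow> complex"
    and c\<^sub>L \<eta>\<^sub>L \<eta>inv \<eta> t :: real
  assumes dim: "1 \<le> CARD('d)" "CARD('d) \<le> 10"
    and coeffs: "admissible_coeff \<nu>" "admissible_coeff \<sigma>"
    and pos: "0 < \<eta>\<^sub>L" "0 < c\<^sub>L"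
    and A_De: "stiffness \<nu> \<sigma> \<in> De \<eta>\<^sub>L"
    and A_bound: "\<And>l k. norm (stiffness \<nu> \<sigma> l k) \<le> c\<^sub>L * exp (- \<eta>\<^sub>L * norm (rvec (l - k)))"
    and small: "c\<^sub>L < 1 / 2 * (exp \<eta>\<^sub>L - 1) * (INF l. Re (stiffness \<nu> \<sigma> l l))"
    and inverse: "ell2_inverse (stiffness \<nu> \<sigma>) Ainv"
    and Ainv_De: "Ainv \<in> De \<eta>inv"
    and \<eta>inv: "0 < \<eta>inv" "\<eta>inv \<le> \<eta>\<^sub>L"
    and root: "{z \<in> {0<..<1}. z\<^sup>2 - (exp (2 * \<eta>\<^sub>L) + 2 * c\<^sub>L + 1) / (exp \<eta>\<^sub>L * (c\<^sub>L + 1)) * z + 1 = 0}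
                 = {exp (- \<eta>inv)}"
    and \<eta>t: "0 < \<eta>" "0 < t" "t \<le> real CARD('d)"
    and \<eta>_small: "\<eta> < omega TYPE('d) powr (t / (real CARD('d) * (1 + 2 * t))) * \<eta>inv"
  shows "\<exists>\<eta>' t' C. 0 < \<eta>' \<and> \<eta>' \<le> \<eta> \<and> 0 < t' \<and> t' \<le> t \<and> 0 < C \<and>
    (\<forall>f\<in>Hm1p. \<forall>u. weak_solution \<nu> \<sigma> f u \<and> u \<in> AG_V \<eta> t \<longrightarrow>
      (\<forall>\<Lambda> w. finite \<Lambda> \<and> galerkin_solution \<nu> \<sigma> f \<Lambda> w \<longrightarrow>
        residual \<nu> \<sigma> f w \<in> AG_dual \<eta>' t' \<and>
        AG_dual_norm \<eta>' t' (residual \<nu> \<sigma> f w) \<le> C * AG_V_norm \<eta> t u))"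
proof -
  obtain \<eta>' t' C where c: "0 < \<eta>'" "\<eta>' \<le> \<eta>" "0 < t'" "t' \<le> t" "0 < C" and
    b: "\<forall>f u. weak_solution \<nu> \<sigma> f u \<and> u \<in> AG_V \<eta> t \<longrightarrow>
      (\<forall>\<Lambda> w. finite \<Lambda> \<and> galerkin_solution \<nu> \<sigma> f \<Lambda> w \<longrightarrow>
        (\<forall>n. best_err_dual (residual \<nu> \<sigma> f w) n * exp_weight TYPE('d) \<eta>' t' n \<le> C * AG_V_norm \<eta> t u))"
    using best_err_dual_residual[OF coeffs pos A_bound \<eta>t] by (elim exE conjE) (rule that)
  show ?thesis
  proof (rule exI[of _ \<eta>'], rule exI[of _ t'], rule exI[of _ C], intro conjI c ballI allI impI)
    fix f u \<Lambda> w
    assume f: "f \<in> Hm1p" and u: "weak_solution \<nu> \<sigma> f u \<and> u \<in> AG_V \<eta> t"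
      and w: "finite \<Lambda> \<and> galerkin_solution \<nu> \<sigma> f \<Lambda> w"
    let ?r = "residual \<nu> \<sigma> f w"
    have b': "best_err_dual ?r n * exp_weight TYPE('d) \<eta>' t' n \<le> C * AG_V_norm \<eta> t u" for n
      using b u w by blast
    have "w \<in> H1p" using w H1p_trig unfolding galerkin_solution_def V_sub_def by blast
    then have "?r \<in> Hm1p" by (rule residual_Hm1p[OF coeffs f])
    moreover have "bdd_above (range (\<lambda>N. best_err_dual ?r N * exp_weight TYPE('d) \<eta>' t' N))"
      using b' by (intro bdd_aboveI2)
    ultimately show "?r \<in> AG_dual \<eta>' t'" by (simp add: AG_dual_def)
    show "AG_dual_norm \<eta>' t' ?r \<le> C * AG_V_norm \<eta> t u"
      unfolding AG_dual_norm_def using b' by (intro cSUP_least) auto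
  qed
qed

end
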